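(* Let $T\colon X\to X$ be a continuous transformation of a compact metric space and $\mathbb{E}$ an oriented circle bundle with base $X$. Consider a path $\phi$ in $Sk^+_{\mathbb{E},T}$ and a measure $\mu\in\mathcal{M}(T)$. The rotation number $\rho(\cdot,\phi)$ is defined $\mu$-almost everywhere, bounded, $T$-invariant, measurable, and only depends on the homotopy class of $\phi$ with fixed extremities. Moreover, $$\rho(\mu,\phi):=\int_X\rho(\cdot,\phi)\,d\mu$$ defines a continuous map $\rho\colon\mathcal{M}(T)\times P_1(Sk^+_{\mathbb{E},T})\to\mathbb{R}$.
   Context: $\mathbb{E}=\bigsqcup_{x\in X}\mathbb{E}_x$ is a continuous bundle of circles over $X$ with a continuous orientation of the fibers. $Sk^+_{\mathbb{E},T}$ is the set of continuous maps $f\colon\mathbb{E}\to\mathbb{E}$ that project to $T$ and map each fiber $\mathbb{E}_x$ to $\mathbb{E}_{Tx}$ by an orientation-preserving homeomorphism, with the topology of uniform convergence. A path is a continuous map from a compact interval. $P_1(Sk^+_{\mathbb{E},T})$ is the set of paths in $Sk^+_{\mathbb{E},T}$ with the topology of uniform convergence. $\mathcal{M}(T)$ is the vector space of $T$-invariant finite Borel signed measures on $X$ with the weak-* topology, and $\mathcal{M}(T)\times P_1(Sk^+_{\mathbb{E},T})$ carries the product topology. Endow $\mathbb{E}$ with a metric giving length $1$ to each circle. For a path $\gamma=(\gamma_t)_{t\in[a,b]}$ in a fiber $\mathbb{E}_x$, the winding number $w(\gamma)$ is the algebraic length of the oriented segment $[\widetilde\gamma_a,\widetilde\gamma_b]$,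 where $\widetilde\gamma$ is any lift of $\gamma$ to the universal cover of $\mathbb{E}_x$. For a path $\phi=(f_t)$ in $Sk^+_{\mathbb{E},T}$ and $u\in\mathbb{E}$, $\phi u$ is the path $(f_tu)_t$ and $\phi^{(n)}$ is the path $(f_t^n)_t$ of $n$-th iterates. The rotation number of $\phi$ at $x\in X$ is, when the limit exists, $\rho(x,\phi)=\lim_{n\to+\infty}\frac1n w(\phi^{(n)}u)$ for any $u\in\mathbb{E}_x$; existence and value do not depend on $u\in\mathbb{E}_x$ nor on the metric.
   Formalization: Joint continuity of ρ on M(T) × P_1 fails for signed measures when M(T) is infinite-dimensional; proved instead: joint sequential continuity, joint continuity on measures of total variation at most K for each K, and continuity in μ on all of M(T) for each fixed φ. *)

theory Defs
  imports "HOL-Analysis.Analysis"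
begin

section \<open>Oriented circle bundles\<close>

text \<open>The standard circle is \<^term>\<open>sphere (0::complex) 1\<close> with the counterclockwise orientation,
  parametrised by \<open>t \<mapsto> cis (2 * pi * t)\<close>.\<close>

definition circle_param :: "'e::topological_space set \<Rightarrow> (complex \<Rightarrow> 'e) \<Rightarrow> bool" where
  "circle_param F c \<longleftrightarrow> (\<exists>c'. homeomorphism (sphere 0 1) F c c')"

text \<open>Meant for self-homeomorphisms of the circle: these preserve the orientation iff they lift
  to an increasing map of the line.\<close>

definition circle_increasing :: "(complex \<Rightarrow> complex) \<Rightarrow> bool" where
  "circle_increasing g \<longleftrightarrow>
     (\<exists>G::real \<Rightarrow> real. continuous_on UNIV G \<and> strict_mono G \<and>
        (\<forall>t. g (cis (2 * pi * t)) = cis (2 * pi * G t)))"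

text \<open>An orientation of a topological circle \<open>F\<close> is given by the set \<open>C\<close> of its positively oriented
  parametrisations, i.e. by one of the two classes of homeomorphisms from the standard circle
  modulo precomposition with orientation-preserving homeomorphisms. (Only values on the
  standard circle matter; both sides of the equivalence ignore the values elsewhere.)\<close>

definition circle_orientation :: "'e::topological_space set \<Rightarrow> (complex \<Rightarrow> 'e) set \<Rightarrow> bool" where
  "circle_orientation F C \<longleftrightarrow>
     C \<noteq> {} \<and> (\<forall>c\<in>C. circle_param F c) \<and>
     (\<forall>c\<in>C. \<forall>c2. c2 \<in> C \<longleftrightarrow>
        circle_param F c2 \<and> circle_increasing (inv_into (sphere 0 1) c \<circ> c2))"

text \<open>The total space is the whole type \<open>'e\<close>, the base is the whole type \<open>'x\<close>, the fibre over \<open>x\<close>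
  is \<open>p -` {x}\<close>. The last clause is local triviality; that the trivialisations can be chosen
  positively oriented on every fibre is the continuity of the orientation.\<close>

definition oriented_circle_bundle ::
  "('e::topological_space \<Rightarrow> 'x::topological_space) \<Rightarrow> ('x \<Rightarrow> (complex \<Rightarrow> 'e) set) \<Rightarrow> bool" where
  "oriented_circle_bundle p ori \<longleftrightarrow>
     continuous_on UNIV p \<and>
     (\<forall>x. circle_orientation (p -` {x}) (ori x)) \<and>
     (\<forall>x. \<exists>U h h'. open U \<and> x \<in> U \<and>
        homeomorphism (U \<times> sphere 0 1) (p -` U) h h' \<and>
        (\<forall>y\<in>U. (\<lambda>z. h (y, z)) \<in> ori y))"


section \<open>The space of skew-products and its paths\<close>

definition skew_maps ::
  "('e::topological_space \<Rightarrow> 'x) \<Rightarrow> ('x \<Rightarrow> (complex \<Rightarrow> 'e) set) \<Rightarrow> ('x \<Rightarrow> 'x) \<Rightarrow> ('e \<Rightarrow> 'e) set" where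
  "skew_maps p ori T =
     {f. continuous_on UNIV f \<and> (\<forall>u. p (f u) = T (p u)) \<and>
         (\<forall>x. (\<exists>g. homeomorphism (p -` {x}) (p -` {T x}) f g) \<and>
              (\<forall>c\<in>ori x. f \<circ> c \<in> ori (T x)))}"

text \<open>\<^const>\<open>cfunspace\<close> is the space of bounded continuous maps with the uniform metric; over a compact
  base the total space of a circle bundle is compact, so boundedness holds automatically and
  the topology does not depend on the chosen metric of \<open>'e\<close>.\<close>

definition skew_space ::
  "('e::metric_space \<Rightarrow> 'x) \<Rightarrow> ('x \<Rightarrow> (complex \<Rightarrow> 'e) set) \<Rightarrow> ('x \<Rightarrow> 'x) \<Rightarrow> ('e \<Rightarrow> 'e) metric" where
  "skew_space p ori T = submetric (cfunspace euclidean euclidean_metric) (skew_maps p ori T)"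

text \<open>Paths are parametrised by a fixed compact interval, as uniform convergence only makes sense
  for paths with a common domain.\<close>

definition skew_paths ::
  "('e::metric_space \<Rightarrow> 'x) \<Rightarrow> ('x \<Rightarrow> (complex \<Rightarrow> 'e) set) \<Rightarrow> ('x \<Rightarrow> 'x) \<Rightarrow> real \<Rightarrow> real
     \<Rightarrow> (real \<Rightarrow> 'e \<Rightarrow> 'e) metric" where
  "skew_paths p ori T a b = cfunspace (top_of_set {a..b}) (skew_space p ori T)"

definition homotopic_skew_paths ::
  "('e::metric_space \<Rightarrow> 'x) \<Rightarrow> ('x \<Rightarrow> (complex \<Rightarrow> 'e) set) \<Rightarrow> ('x \<Rightarrow> 'x) \<Rightarrow> real \<Rightarrow> real
     \<Rightarrow> (real \<Rightarrow> 'e \<Rightarrow> 'e) \<Rightarrow> (real \<Rightarrow> 'e \<Rightarrow> 'e) \<Rightarrow> bool" where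
  "homotopic_skew_paths p ori T a b \<phi> \<psi> \<longleftrightarrow>
     homotopic_with (\<lambda>\<eta>. \<eta> a = \<phi> a \<and> \<eta> b = \<phi> b)
       (top_of_set {a..b}) (mtopology_of (skew_space p ori T)) \<phi> \<psi>"


section \<open>Winding numbers and rotation numbers\<close>

definition curve_length :: "('e \<Rightarrow> 'e \<Rightarrow> real) \<Rightarrow> (real \<Rightarrow> 'e) \<Rightarrow> real \<Rightarrow> real \<Rightarrow> ennreal" where
  "curve_length d h s t =
     (SUP (n, q) \<in> {(n::nat, q). mono_on {..n} q \<and> q ` {..n} \<subseteq> {s..t}}.
        \<Sum>i<n. ennreal (d (h (q i)) (h (q (Suc i)))))"

definition unit_length_metric ::
  "('e::topological_space \<Rightarrow> 'x) \<Rightarrow> ('x \<Rightarrow> (complex \<Rightarrow> 'e) set) \<Rightarrow> ('e \<Rightarrow> 'e \<Rightarrow> real) \<Rightarrow> bool" where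
  "unit_length_metric p ori d \<longleftrightarrow>
     Metric_space UNIV d \<and> Metric_space.mtopology UNIV d = euclidean \<and>
     (\<forall>x. \<forall>c\<in>ori x. curve_length d (\<lambda>t. c (cis (2 * pi * t))) 0 1 = 1)"

text \<open>For a positively oriented parametrisation \<open>c\<close> of the circle, \<open>t \<mapsto> c (cis (2 * pi * t))\<close> is its
  universal cover, with the order of the real line as orientation. The length on the cover is the
  one pulled back from the circle; it is the length for \<open>d\<close> of the projected segment.\<close>

definition algebraic_length :: "('e \<Rightarrow> 'e \<Rightarrow> real) \<Rightarrow> (complex \<Rightarrow> 'e) \<Rightarrow> real \<Rightarrow> real \<Rightarrow> real" where
  "algebraic_length d c s t =
     sgn (t - s) * enn2real (curve_length d (\<lambda>r. c (cis (2 * pi * r))) (min s t) (max s t))"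

text \<open>Here \<open>C\<close> is the orientation of the circle in which the path \<open>\<gamma>\<close> lies.\<close>

definition circle_winding ::
  "('e \<Rightarrow> 'e \<Rightarrow> real) \<Rightarrow> (complex \<Rightarrow> 'e) set \<Rightarrow> real \<Rightarrow> real \<Rightarrow> (real \<Rightarrow> 'e) \<Rightarrow> real" where
  "circle_winding d C a b \<gamma> =
     (THE w. \<exists>c\<in>C. \<exists>\<gamma>'. continuous_on {a..b} \<gamma>' \<and>
        (\<forall>t\<in>{a..b}. \<gamma> t = c (cis (2 * pi * \<gamma>' t))) \<and>
        w = algebraic_length d c (\<gamma>' a) (\<gamma>' b))"

definition has_rotation_number ::
  "('e \<Rightarrow> 'x) \<Rightarrow> ('x \<Rightarrow> (complex \<Rightarrow> 'e) set) \<Rightarrow> ('e \<Rightarrow> 'e \<Rightarrow> real) \<Rightarrow> ('x \<Rightarrow> 'x) \<Rightarrow> real \<Rightarrow> real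
     \<Rightarrow> (real \<Rightarrow> 'e \<Rightarrow> 'e) \<Rightarrow> 'x \<Rightarrow> real \<Rightarrow> bool" where
  "has_rotation_number p ori d T a b \<phi> x r \<longleftrightarrow>
     (\<forall>u\<in>p -` {x}.
        (\<lambda>n. circle_winding d (ori ((T ^^ n) x)) a b (\<lambda>t. (\<phi> t ^^ n) u) / real n)
          \<longlonglongrightarrow> r)"

definition rotation_domain ::
  "('e \<Rightarrow> 'x) \<Rightarrow> ('x \<Rightarrow> (complex \<Rightarrow> 'e) set) \<Rightarrow> ('e \<Rightarrow> 'e \<Rightarrow> real) \<Rightarrow> ('x \<Rightarrow> 'x) \<Rightarrow> real \<Rightarrow> real
     \<Rightarrow> (real \<Rightarrow> 'e \<Rightarrow> 'e) \<Rightarrow> 'x set" where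
  "rotation_domain p ori d T a b \<phi> = {x. \<exists>r. has_rotation_number p ori d T a b \<phi> x r}"

text \<open>The value 0 outside the domain is a dummy.\<close>

definition rotation_number ::
  "('e \<Rightarrow> 'x) \<Rightarrow> ('x \<Rightarrow> (complex \<Rightarrow> 'e) set) \<Rightarrow> ('e \<Rightarrow> 'e \<Rightarrow> real) \<Rightarrow> ('x \<Rightarrow> 'x) \<Rightarrow> real \<Rightarrow> real
     \<Rightarrow> (real \<Rightarrow> 'e \<Rightarrow> 'e) \<Rightarrow> 'x \<Rightarrow> real" where
  "rotation_number p ori d T a b \<phi> x =
     (if x \<in> rotation_domain p ori d T a b \<phi>
      then THE r. has_rotation_number p ori d T a b \<phi> x r else 0)"


section \<open>Signed measures\<close>

text \<open>Finite signed Borel measures are countably additive real set functions on the Borel sets,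
  set to 0 on non-Borel sets in order to make them determined by their Borel values.\<close>

definition signed_measures :: "('x::topological_space set \<Rightarrow> real) set" where
  "signed_measures =
     {\<mu>. \<mu> {} = 0 \<and>
         (\<forall>A::nat \<Rightarrow> 'x set. range A \<subseteq> sets borel \<longrightarrow> disjoint_family A \<longrightarrow>
            (\<lambda>i. \<mu> (A i)) sums \<mu> (\<Union>i. A i)) \<and>
         (\<forall>B. B \<notin> sets borel \<longrightarrow> \<mu> B = 0)}"

definition invariant_signed_measures ::
  "('x::topological_space \<Rightarrow> 'x) \<Rightarrow> ('x set \<Rightarrow> real) set" where
  "invariant_signed_measures T =
     {\<mu> \<in> signed_measures. \<forall>B\<in>sets borel. \<mu> (T -` B) = \<mu> B}"

text \<open>Jordan decomposition: the positive part of \<open>\<mu>\<close> maps \<open>B\<close> to the supremum of \<open>\<mu> A\<close> over Borel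
  \<open>A \<subseteq> B\<close> (negative values are cut off by \<^const>\<open>ennreal\<close>, harmlessly since \<open>A = {}\<close> is allowed).\<close>

definition positive_part :: "('x::topological_space set \<Rightarrow> real) \<Rightarrow> 'x measure" where
  "positive_part \<mu> =
     measure_of UNIV (sets borel) (\<lambda>B. SUP A\<in>{A \<in> sets borel. A \<subseteq> B}. ennreal (\<mu> A))"

definition negative_part :: "('x::topological_space set \<Rightarrow> real) \<Rightarrow> 'x measure" where
  "negative_part \<mu> = positive_part (\<lambda>B. - \<mu> B)"

definition total_variation :: "('x::topological_space set \<Rightarrow> real) \<Rightarrow> 'x measure" where
  "total_variation \<mu> =
     measure_of UNIV (sets borel)
       (\<lambda>B. emeasure (positive_part \<mu>) B + emeasure (negative_part \<mu>) B)"

definition signed_integral ::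
  "('x::topological_space set \<Rightarrow> real) \<Rightarrow> ('x \<Rightarrow> real) \<Rightarrow> real" where
  "signed_integral \<mu> f =
     integral\<^sup>L (positive_part \<mu>) f - integral\<^sup>L (negative_part \<mu>) f"

text \<open>The weak-* topology: the coarsest one for which integration against each continuous function
  is continuous (the base being compact, all continuous functions are test functions).\<close>

definition weak_star_topology ::
  "('x::topological_space \<Rightarrow> 'x) \<Rightarrow> ('x set \<Rightarrow> real) topology" where
  "weak_star_topology T =
     pullback_topology (invariant_signed_measures T)
       (\<lambda>\<mu>. restrict (signed_integral \<mu>) {f. continuous_on UNIV f})
       (product_topology (\<lambda>_. euclideanreal) {f. continuous_on UNIV f})"

text \<open>As a function of \<open>(\<mu>, \<phi>)\<close> this is a pairing of the type \<open>\<integral> F d\<mu>\<close> with \<open>F\<close> depending continuously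
  on \<open>\<phi>\<close> in the uniform norm. Such a pairing is continuous for the product of the weak-* and
  uniform topologies along sequences, and on sets of measures of bounded total variation, but not
  on the product with a whole infinite-dimensional space of measures: for \<open>T = id\<close> and
  \<open>\<phi>(t)(x, z) = (x, z * cis (2 * pi * t * g x))\<close> on \<open>X \<times> sphere 0 1\<close> with \<open>t\<close> in \<open>{0..1}\<close> it
  equals \<open>\<integral> g d\<mu>\<close>, and for infinite \<open>X\<close> every weak-* neighbourhood of 0 contains a line on which
  some uniformly small \<open>g\<close> has unbounded integrals.\<close>

definition mean_rotation_number ::
  "('e \<Rightarrow> 'x::topological_space) \<Rightarrow> ('x \<Rightarrow> (complex \<Rightarrow> 'e) set) \<Rightarrow> ('e \<Rightarrow> 'e \<Rightarrow> real)
     \<Rightarrow> ('x \<Rightarrow> 'x) \<Rightarrow> real \<Rightarrow> real \<Rightarrow> ('x set \<Rightarrow> real) \<Rightarrow> (real \<Rightarrow> 'e \<Rightarrow> 'e) \<Rightarrow> real" where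
  "mean_rotation_number p ori d T a b \<mu> \<phi> =
     signed_integral \<mu> (rotation_number p ori d T a b \<phi>)"

end

theory Submission
  imports Defs
begin

text \<open>
  Write \<open>w\<^sub>n u\<close> for the winding number of \<open>t \<mapsto> f\<^sub>t\<^sup>n u\<close>. Up to bounded errors, \<open>w\<^sub>n u\<close> depends only on
  the fibre of \<open>u\<close> (two orbit paths in a circle never meet), is a cocycle over \<open>T\<close> (lift the square
  \<open>(s, t) \<mapsto> f\<^sub>s\<^sup>m (f\<^sub>t\<^sup>n u)\<close> and compare its diagonal with two of its sides), is locally constant in
  the fibre and in the path, and is a homotopy invariant. Hence it is within bounded distance of an
  almost additive sequence of continuous functions \<open>a\<^sub>n\<close> on the base, and
  \<open>\<rho> = lim a\<^sub>n / n\<close> exists almost everywhere by Birkhoff's theorem for each \<open>a\<^sub>k\<close>.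

  The doubling relation \<open>a\<^bsub>2k\<^esub> / 2k = (a\<^sub>k + a\<^sub>k \<circ> T\<^sup>k) / 2k + O(1/k)\<close> shows that, up to coboundaries,
  the functions \<open>a\<^sub>k / k\<close> with \<open>k = 2\<^sup>j\<close> form a uniformly convergent sequence. So \<open>\<integral> \<rho> d\<mu> = \<integral> g d\<mu>\<close> for
  all invariant \<open>\<mu>\<close> with one continuous \<open>g\<close>, which gives weak-* continuity; and as \<open>g\<close> is determined up
  to coboundaries and \<open>O(1/k)\<close> by \<open>a\<^sub>k\<close>, nearby paths have nearby rotation numbers, uniformly on
  bounded sets of measures. Weak-* convergent sequences are bounded by the uniform boundedness
  principle.
\<close>

section \<open>Signed measures\<close>

text \<open>Windings are finally divided by \<open>n\<close>, so only their values up to a bounded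
  error matter. The metric \<open>d\<close> enters the estimates through one bound: an algebraic
  length on the universal cover differs from the difference of the end parameters by at most 1,
  because every period has length 1. From then on the work is done on real lifts, and the constants
  3, 5, 9, 12, 18, 41, 124 add up copies of this error and of the bound 1 on how much two lifted
  paths can turn against each other. The winding is a function on the total space, whereas the
  ergodic theory takes place on the base; a partition of unity turns local closeness up to a
  constant into a continuous function on the base. A signed measure is treated through its Jordan
  parts: they inherit the invariance, so each of them is a finite invariant measure to which
  Birkhoff's theorem applies. The obstacle to joint continuity is that weak-* neighbourhoods do not
  bound the total variation, while a small change of the path costs an amount proportional to it.
  The bound must therefore be assumed or, along sequences, be extracted by Baire's theorem.\<close>

lemma signed_measure_empty: "\<mu> \<in> signed_measures \<Longrightarrow> \<mu> {} = 0"
  by (simp add: signed_measures_def)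

lemma signed_measure_sums:
  assumes "\<mu> \<in> signed_measures" "range A \<subseteq> sets borel" "disjoint_family A"
  shows "(\<lambda>i. \<mu> (A i)) sums \<mu> (\<Union>i. A i)"
  using assms by (simp add: signed_measures_def)

lemma signed_measure_Un:
  assumes "\<mu> \<in> signed_measures" "A \<in> sets borel" "B \<in> sets borel" "A \<inter> B = {}"
  shows "\<mu> (A \<union> B) = \<mu> A + \<mu> B"
proof -
  have "(\<lambda>i. \<mu> (binaryset A B i)) sums \<mu> (\<Union>i. binaryset A B i)"
    using assms by (intro signed_measure_sums)
      (auto simp: range_binaryset_eq disjoint_family_on_def binaryset_def)
  moreover have "(\<lambda>i. \<mu> (binaryset A B i)) sums (\<mu> A + \<mu> B)"
    using assms(1) by (intro binaryset_sums signed_measure_empty)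
  ultimately show ?thesis
    using sums_unique2 by (metis UN_binaryset_eq)
qed

lemma signed_measure_Diff:
  assumes "\<mu> \<in> signed_measures" "A \<in> sets borel" "B \<in> sets borel" "A \<subseteq> B"
  shows "\<mu> (B - A) = \<mu> B - \<mu> A"
  using signed_measure_Un[OF assms(1), of A "B - A"] assms by (simp add: Un_absorb1)

lemma signed_measure_uminus:
  assumes "\<mu> \<in> signed_measures" shows "(\<lambda>B. - \<mu> B) \<in> signed_measures"
  using assms by (auto simp: signed_measures_def intro: sums_minus)

lemma invariant_signed_measure_uminus:
  assumes "\<mu> \<in> invariant_signed_measures T"
  shows "(\<lambda>B. - \<mu> B) \<in> invariant_signed_measures T"
  using assms by (auto simp: invariant_signed_measures_def intro: signed_measure_uminus)

text \<open>If \<open>\<mu>\<close> were unbounded, one could successively cut off pieces with \<open>\<bar>\<mu>\<bar> > 1\<close>, leaving a remainder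
  on which \<open>\<mu>\<close> is still unbounded; this contradicts summability over these disjoint pieces.\<close>

lemma signed_measure_bounded:
  assumes \<mu>: "\<mu> \<in> signed_measures"
  obtains K where "\<And>A. A \<in> sets borel \<Longrightarrow> \<bar>\<mu> A\<bar> \<le> K"
proof -
  define bad where "bad B \<longleftrightarrow> B \<in> sets borel \<and> (\<forall>K. \<exists>A\<in>sets borel. A \<subseteq> B \<and> \<bar>\<mu> A\<bar> > K)" for B
  have step: "\<exists>B'. bad B' \<and> B' \<subseteq> B \<and> \<bar>\<mu> (B - B')\<bar> > 1" if B: "bad B" for B
  proof -
    \<comment> \<open>The margin \<open>\<bar>\<mu> B\<bar>\<close> forces
      \<open>\<bar>\<mu> (B - A)\<bar> > 1\<close> too, so whichever of the two halves remains bad,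
      the piece cut off has measure above 1 in absolute value.\<close>
    obtain A where A: "A \<in> sets borel" "A \<subseteq> B" "\<bar>\<mu> A\<bar> > 1 + \<bar>\<mu> B\<bar>"
      using B unfolding bad_def by blast
    have Bs: "B \<in> sets borel" using B by (simp add: bad_def)
    have d: "\<mu> (B - A) = \<mu> B - \<mu> A" by (rule signed_measure_Diff[OF \<mu> A(1) Bs A(2)])
    have "bad A \<or> bad (B - A)"
    proof (rule ccontr)
      assume "\<not> (bad A \<or> bad (B - A))"
      then obtain K1 K2 where K1: "\<And>C. C \<in> sets borel \<Longrightarrow> C \<subseteq> A \<Longrightarrow> \<bar>\<mu> C\<bar> \<le> K1"
        and K2: "\<And>C. C \<in> sets borel \<Longrightarrow> C \<subseteq> B - A \<Longrightarrow> \<bar>\<mu> C\<bar> \<le> K2"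
        unfolding bad_def using A Bs by (metis linorder_not_less sets.Diff)
      obtain C where C: "C \<in> sets borel" "C \<subseteq> B" "\<bar>\<mu> C\<bar> > K1 + K2"
        using B unfolding bad_def by blast
      have "\<mu> C = \<mu> (C \<inter> A) + \<mu> (C - A)"
        using signed_measure_Un[OF \<mu>, of "C \<inter> A" "C - A"] A(1) C(1)
        by (metis Int_Diff_Un Int_Diff_disjoint sets.Diff sets.Int)
      moreover have "\<bar>\<mu> (C \<inter> A)\<bar> \<le> K1" "\<bar>\<mu> (C - A)\<bar> \<le> K2"
        using K1[of "C \<inter> A"] K2[of "C - A"] A C by auto
      ultimately show False using C(3) by linarith
    qed
    then show ?thesis
    proof
      assume "bad A"
      moreover have "\<bar>\<mu> (B - A)\<bar> > 1" using d A(3) by linarith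
      ultimately show ?thesis using A(2) by blast
    next
      assume "bad (B - A)"
      moreover have "B - (B - A) = A" using A(2) by blast
      ultimately show ?thesis using A(3) by (intro exI[of _ "B - A"]) auto
    qed
  qed
  have "\<not> bad UNIV"
  proof
    assume "bad UNIV"
    then obtain B where B: "\<And>n. bad (B n)" "\<And>n. B (Suc n) \<subseteq> B n \<and> \<bar>\<mu> (B n - B (Suc n))\<bar> > 1"
      using dependent_nat_choice[of "\<lambda>_ B. bad B" "\<lambda>_ B B'. B' \<subseteq> B \<and> \<bar>\<mu> (B - B')\<bar> > 1"] step
      by metis
    have dec: "decseq B" using B(2) by (intro decseq_SucI) auto
    have "disjoint_family (\<lambda>n. B n - B (Suc n))"
      unfolding disjoint_family_on_def
    proof (intro ballI impI)
      fix m n :: nat assume "m \<noteq> n"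
      then have "Suc m \<le> n \<or> Suc n \<le> m" by auto
      then show "(B m - B (Suc m)) \<inter> (B n - B (Suc n)) = {}"
        using decseqD[OF dec] by blast
    qed
    moreover have "range (\<lambda>n. B n - B (Suc n)) \<subseteq> sets borel"
      using B(1) by (auto simp: bad_def)
    ultimately have "summable (\<lambda>n. \<mu> (B n - B (Suc n)))"
      using signed_measure_sums[OF \<mu>] sums_summable by metis
    then have "(\<lambda>n. \<mu> (B n - B (Suc n))) \<longlonglongrightarrow> 0" by (rule summable_LIMSEQ_zero)
    from tendstoD[OF this zero_less_one]
    have "\<forall>\<^sub>F n in sequentially. \<bar>\<mu> (B n - B (Suc n))\<bar> < 1" by (simp add: dist_real_def)
    then obtain n where "\<bar>\<mu> (B n - B (Suc n))\<bar> < 1"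
      by (meson eventually_happens trivial_limit_sequentially)
    then show False using B(2)[of n] by linarith
  qed
  then show ?thesis using that unfolding bad_def by (auto simp: not_less)
qed

section \<open>Jordan decomposition and invariance of its parts\<close>

lemma space_positive_part [simp]: "space (positive_part \<mu>) = UNIV"
  and sets_positive_part [simp, measurable_cong]: "sets (positive_part \<mu>) = sets borel"
  using sets.sigma_sets_eq[of "borel :: 'a measure"]
  by (auto simp: positive_part_def sets_measure_of space_measure_of_conv)

lemma space_negative_part [simp]: "space (negative_part \<mu>) = UNIV"
  and sets_negative_part [simp, measurable_cong]: "sets (negative_part \<mu>) = sets borel"
  by (simp_all add: negative_part_def)

lemma space_total_variation [simp]: "space (total_variation \<mu>) = UNIV"
  and sets_total_variation [simp, measurable_cong]: "sets (total_variation \<mu>) = sets borel"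
  using sets.sigma_sets_eq[of "borel :: 'a measure"]
  by (auto simp: total_variation_def sets_measure_of space_measure_of_conv)

text \<open>\<open>measure_of\<close> returns the supremum formula only once that formula is known
  to be countably additive. Superadditivity on disjoint pairs gives one inequality; for the other, a
  competitor \<open>C\<close> for the union is cut into the slices
  \<open>C \<inter> A i\<close>.\<close>

lemma emeasure_positive_part:
  assumes \<mu>: "\<mu> \<in> signed_measures" and B: "B \<in> sets borel"
  shows "emeasure (positive_part \<mu>) B = (SUP A\<in>{A \<in> sets borel. A \<subseteq> B}. ennreal (\<mu> A))"
    (is "_ = ?F B")
proof -
  have F: "ennreal (\<mu> A) \<le> ?F B" if "A \<in> sets borel" "A \<subseteq> B" for A B
    using that by (intro SUP_upper) auto
  have mono: "?F A \<le> ?F B" if "A \<subseteq> B" for A B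
    using that by (intro SUP_subset_mono) auto
  have F0: "?F {} = 0"
  proof -
    have "{A \<in> sets borel. A \<subseteq> {}} = {{}}" by auto
    then show ?thesis by (simp add: signed_measure_empty[OF \<mu>])
  qed
  have super: "?F A + ?F B \<le> ?F (A \<union> B)" if "A \<inter> B = {}" for A B
  proof -
    have ne: "{D \<in> sets borel. D \<subseteq> B} \<noteq> {}" by auto
    have "?F A + ?F B = (SUP C\<in>{C \<in> sets borel. C \<subseteq> A}. ennreal (\<mu> C) + ?F B)"
      by (rule ennreal_SUP_add_left[symmetric]) auto
    also have "\<dots> = (SUP C\<in>{C \<in> sets borel. C \<subseteq> A}. SUP D\<in>{D \<in> sets borel. D \<subseteq> B}. ennreal (\<mu> C) + ennreal (\<mu> D))"
      by (rule SUP_cong[OF refl], rule ennreal_SUP_add_right[OF ne])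
    also have "\<dots> \<le> ?F (A \<union> B)"
    proof (intro SUP_least)
      fix C D assume C: "C \<in> {C \<in> sets borel. C \<subseteq> A}" and D: "D \<in> {D \<in> sets borel. D \<subseteq> B}"
      show "ennreal (\<mu> C) + ennreal (\<mu> D) \<le> ?F (A \<union> B)"
      proof (cases "\<mu> C \<ge> 0 \<and> \<mu> D \<ge> 0")
        case True
        then have "ennreal (\<mu> C) + ennreal (\<mu> D) = ennreal (\<mu> C + \<mu> D)" by simp
        also have "\<mu> C + \<mu> D = \<mu> (C \<union> D)"
          using C D that by (intro signed_measure_Un[OF \<mu>, symmetric]) auto
        also have "ennreal (\<mu> (C \<union> D)) \<le> ?F (A \<union> B)"
          using C D by (intro F) auto
        finally show ?thesis .
      next
        \<comment> \<open>\<open>ennreal\<close> truncates one of the two values to 0, so the other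
          set alone already bounds the sum.\<close>
        case False
        have "ennreal (\<mu> C) \<le> ?F (A \<union> B)" "ennreal (\<mu> D) \<le> ?F (A \<union> B)"
          using C D by (intro F; blast)+
        moreover have "ennreal (\<mu> C) = 0 \<or> ennreal (\<mu> D) = 0"
          using False by (metis ennreal_neg linorder_le_cases)
        ultimately show ?thesis by (elim disjE) simp_all
      qed
    qed
    finally show ?thesis .
  qed
  have "countably_additive (sets borel) ?F"
    unfolding countably_additive_def
  proof (intro allI impI antisym)
    fix A :: "nat \<Rightarrow> 'a set" assume A: "range A \<subseteq> sets borel" "disjoint_family A" "(\<Union>i. A i) \<in> sets borel"
    have part: "(\<Sum>i<n. ?F (A i)) \<le> ?F (\<Union>i<n. A i)" for n
    proof (induction n)
      case 0 then show ?case by (simp add: F0)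
    next
      case (Suc n)
      have "(\<Sum>i<Suc n. ?F (A i)) \<le> ?F (\<Union>i<n. A i) + ?F (A n)"
        using Suc by (simp add: add_right_mono)
      also have "\<dots> \<le> ?F ((\<Union>i<n. A i) \<union> A n)"
      proof (rule super)
        have "A i \<inter> A n = {}" if "i < n" for i
          using disjoint_family_onD[OF A(2), of i n] that by simp
        then show "(\<Union>i<n. A i) \<inter> A n = {}" by blast
      qed
      also have "(\<Union>i<n. A i) \<union> A n = (\<Union>i<Suc n. A i)"
        by (auto simp: less_Suc_eq)
      finally show ?case .
    qed
    show "(\<Sum>i. ?F (A i)) \<le> ?F (\<Union>i. A i)"
      by (rule suminf_le_const[OF summableI]) (rule order_trans[OF part mono], auto)
    show "?F (\<Union>i. A i) \<le> (\<Sum>i. ?F (A i))"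
    proof (intro SUP_least)
      fix C assume C: "C \<in> {C \<in> sets borel. C \<subseteq> (\<Union>i. A i)}"
      have eq: "(\<Union>i. C \<inter> A i) = C" using C by auto
      have "(\<lambda>i. \<mu> (C \<inter> A i)) sums \<mu> (\<Union>i. C \<inter> A i)"
        using A C by (intro signed_measure_sums[OF \<mu>]) (auto intro: disjoint_family_on_bisimulation)
      then have "(\<lambda>n. \<Sum>i<n. \<mu> (C \<inter> A i)) \<longlonglongrightarrow> \<mu> C" unfolding eq sums_def .
      then have "(\<lambda>n. ennreal (\<Sum>i<n. \<mu> (C \<inter> A i))) \<longlonglongrightarrow> ennreal (\<mu> C)"
        by (rule tendsto_ennrealI)
      moreover have "ennreal (\<Sum>i<n. \<mu> (C \<inter> A i)) \<le> (\<Sum>i. ?F (A i))" for n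
      proof -
        have "ennreal (\<Sum>i<n. \<mu> (C \<inter> A i)) \<le> ennreal (\<Sum>i<n. max 0 (\<mu> (C \<inter> A i)))"
          by (intro ennreal_leI sum_mono) simp
        also have "\<dots> = (\<Sum>i<n. ennreal (max 0 (\<mu> (C \<inter> A i))))"
          by (intro sum_ennreal[symmetric]) simp
        also have "\<dots> = (\<Sum>i<n. ennreal (\<mu> (C \<inter> A i)))"
          by (intro sum.cong refl) (simp add: max_def ennreal_neg)
        also have "\<dots> \<le> (\<Sum>i<n. ?F (A i))"
          using A C by (intro sum_mono F) auto
        also have "\<dots> \<le> (\<Sum>i. ?F (A i))" by (rule sum_le_suminf) auto
        finally show ?thesis .
      qed
      ultimately show "ennreal (\<mu> C) \<le> (\<Sum>i. ?F (A i))"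
        by (intro LIMSEQ_le_const2) auto
    qed
  qed
  moreover have "positive (sets borel) ?F" unfolding positive_def by (rule F0)
  ultimately show ?thesis
    unfolding positive_part_def using B sets.sigma_algebra_axioms[of "borel :: 'a measure"]
    by (intro emeasure_measure_of_sigma) auto
qed

lemma finite_measure_positive_part:
  assumes \<mu>: "\<mu> \<in> signed_measures" shows "finite_measure (positive_part \<mu>)"
proof
  obtain K where "\<And>A. A \<in> sets borel \<Longrightarrow> \<bar>\<mu> A\<bar> \<le> K"
    using signed_measure_bounded[OF \<mu>] by blast
  then have "\<And>A. A \<in> sets borel \<Longrightarrow> \<mu> A \<le> K" by (meson abs_le_D1)
  then have "emeasure (positive_part \<mu>) UNIV \<le> ennreal K"
    by (subst emeasure_positive_part[OF \<mu>]) (auto intro!: SUP_least ennreal_leI)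
  then show "emeasure (positive_part \<mu>) (space (positive_part \<mu>)) \<noteq> \<infinity>"
    by (auto simp: top_unique)
qed

text \<open>The image of \<open>\<mu>\<^sup>+\<close> under \<open>T\<close> dominates \<open>\<mu>\<^sup>+\<close>; as both have the same finite mass, they agree.\<close>

lemma distr_positive_part:
  assumes \<mu>: "\<mu> \<in> invariant_signed_measures T" and T: "T \<in> borel_measurable borel"
  shows "distr (positive_part \<mu>) (positive_part \<mu>) T = positive_part \<mu>"
proof -
  let ?M = "positive_part \<mu>"
  have s: "\<mu> \<in> signed_measures" and inv: "\<And>B. B \<in> sets borel \<Longrightarrow> \<mu> (T -` B) = \<mu> B"
    using \<mu> by (auto simp: invariant_signed_measures_def)
  interpret finite_measure ?M by (rule finite_measure_positive_part[OF s])
  have T': "T \<in> measurable ?M ?M" using T by simp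
  have pre: "T -` B \<in> sets borel" if "B \<in> sets borel" for B
    using measurable_sets[OF T that] by simp
  have ge: "emeasure ?M B \<le> emeasure ?M (T -` B)" if B: "B \<in> sets borel" for B
    unfolding emeasure_positive_part[OF s B] emeasure_positive_part[OF s pre[OF B]]
  proof (intro SUP_least)
    fix A assume A: "A \<in> {A \<in> sets borel. A \<subseteq> B}"
    then have "T -` A \<in> {A \<in> sets borel. A \<subseteq> T -` B}" using pre by auto
    then have "ennreal (\<mu> (T -` A)) \<le> (SUP A\<in>{A \<in> sets borel. A \<subseteq> T -` B}. ennreal (\<mu> A))"
      by (rule SUP_upper)
    then show "ennreal (\<mu> A) \<le> (SUP A\<in>{A \<in> sets borel. A \<subseteq> T -` B}. ennreal (\<mu> A))"
      using A inv by simp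
  qed
  have eq: "measure ?M (T -` B) = measure ?M B" if B: "B \<in> sets borel" for B
  proof (rule antisym)
    have "measure ?M (- B) \<le> measure ?M (T -` (- B))"
      using ge[of "- B"] B by (simp add: emeasure_eq_measure)
    moreover have "measure ?M (- A) = measure ?M UNIV - measure ?M A" if "A \<in> sets borel" for A
      using finite_measure_compl[of A] that by (simp add: Compl_eq_Diff_UNIV)
    ultimately show "measure ?M (T -` B) \<le> measure ?M B"
      using B pre[OF B] by (simp add: vimage_Compl)
    show "measure ?M B \<le> measure ?M (T -` B)"
      using ge[OF B] by (simp add: emeasure_eq_measure)
  qed
  show ?thesis
  proof (rule measure_eqI)
    fix B assume "B \<in> sets (distr ?M ?M T)"
    then show "emeasure (distr ?M ?M T) B = emeasure ?M B"
      by (simp add: emeasure_distr[OF T'] emeasure_eq_measure eq)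
  qed simp
qed

lemma finite_measure_negative_part:
  "\<mu> \<in> signed_measures \<Longrightarrow> finite_measure (negative_part \<mu>)"
  unfolding negative_part_def by (intro finite_measure_positive_part signed_measure_uminus)

lemma distr_negative_part:
  assumes "\<mu> \<in> invariant_signed_measures T" and "T \<in> borel_measurable borel"
  shows "distr (negative_part \<mu>) (negative_part \<mu>) T = negative_part \<mu>"
  unfolding negative_part_def
  using assms by (intro distr_positive_part invariant_signed_measure_uminus)

lemma emeasure_total_variation:
  assumes "B \<in> sets borel"
  shows "emeasure (total_variation \<mu>) B = emeasure (positive_part \<mu>) B + emeasure (negative_part \<mu>) B"
proof -
  let ?F = "\<lambda>B. emeasure (positive_part \<mu>) B + emeasure (negative_part \<mu>) B"
  have "countably_additive (sets borel) ?F"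
    unfolding countably_additive_def
  proof (intro allI impI)
    fix A :: "nat \<Rightarrow> 'a set" assume A: "range A \<subseteq> sets borel" "disjoint_family A"
    have "(\<Sum>i. ?F (A i)) = (\<Sum>i. emeasure (positive_part \<mu>) (A i)) + (\<Sum>i. emeasure (negative_part \<mu>) (A i))"
      by (rule suminf_add[symmetric]) auto
    then show "(\<Sum>i. ?F (A i)) = ?F (\<Union>i. A i)"
      using A by (simp add: suminf_emeasure)
  qed
  moreover have "positive (sets borel) ?F" by (simp add: positive_def)
  ultimately show ?thesis
    unfolding total_variation_def using assms sets.sigma_algebra_axioms[of "borel :: 'a measure"]
    by (intro emeasure_measure_of_sigma) auto
qed

text \<open>The exceptional set need not be Borel. It lies in a null set of each part, hence in
  their intersection, which is null for both parts at once.\<close>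

lemma AE_total_variation:
  assumes "AE x in positive_part \<mu>. P x" "AE x in negative_part \<mu>. P x"
  shows "AE x in total_variation \<mu>. P x"
proof -
  obtain N1 where "N1 \<in> null_sets (positive_part \<mu>)" "{x \<in> space (positive_part \<mu>). \<not> P x} \<subseteq> N1"
    using assms(1) unfolding eventually_ae_filter by blast
  then have N1: "{x. \<not> P x} \<subseteq> N1" "N1 \<in> sets borel" "emeasure (positive_part \<mu>) N1 = 0"
    by (simp_all add: null_sets_def)
  obtain N2 where "N2 \<in> null_sets (negative_part \<mu>)" "{x \<in> space (negative_part \<mu>). \<not> P x} \<subseteq> N2"
    using assms(2) unfolding eventually_ae_filter by blast
  then have N2: "{x. \<not> P x} \<subseteq> N2" "N2 \<in> sets borel" "emeasure (negative_part \<mu>) N2 = 0"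
    by (simp_all add: null_sets_def)
  have "emeasure (positive_part \<mu>) (N1 \<inter> N2) = 0" "emeasure (negative_part \<mu>) (N1 \<inter> N2) = 0"
    using N1 N2 by (metis Int_lower1 Int_lower2 emeasure_eq_0 sets_positive_part sets_negative_part)+
  then have "N1 \<inter> N2 \<in> null_sets (total_variation \<mu>)"
    using N1 N2 by (auto simp: null_sets_def emeasure_total_variation)
  then show ?thesis using N1 N2 by (intro AE_I'[of "N1 \<inter> N2"]) auto
qed

section \<open>Birkhoff's ergodic theorem for bounded functions\<close>

lemma birkhoff_sum_Suc:
  fixes f :: "'a \<Rightarrow> 'b::comm_monoid_add"
  shows "(\<Sum>i<Suc n. f ((T ^^ i) x)) = f x + (\<Sum>i<n. f ((T ^^ i) (T x)))"
  by (subst sum.lessThan_Suc_shift) (simp add: funpow_swap1 del: sum.lessThan_Suc)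

text \<open>The function \<^term>\<open>birkhoff_max T h n x\<close> is the maximum over \<open>k \<le> n\<close> of the Birkhoff sums of \<open>h\<close>
  of length \<open>k\<close>, including the empty one.\<close>

fun birkhoff_max :: "('a \<Rightarrow> 'a) \<Rightarrow> ('a \<Rightarrow> real) \<Rightarrow> nat \<Rightarrow> 'a \<Rightarrow> real" where
  "birkhoff_max T h 0 x = 0"
| "birkhoff_max T h (Suc n) x = max 0 (h x + birkhoff_max T h n (T x))"

lemma birkhoff_max_nonneg: "birkhoff_max T h n x \<ge> 0"
  by (cases n) auto

lemma birkhoff_max_mono_Suc: "birkhoff_max T h n x \<le> birkhoff_max T h (Suc n) x"
proof (induction n arbitrary: x)
  case 0 then show ?case by simp
next
  case (Suc n) from Suc[of "T x"] show ?case by auto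
qed

lemma birkhoff_max_mono: "m \<le> n \<Longrightarrow> birkhoff_max T h m x \<le> birkhoff_max T h n x"
  by (rule lift_Suc_mono_le[of "\<lambda>n. birkhoff_max T h n x"]) (rule birkhoff_max_mono_Suc)

lemma birkhoff_sum_le_max: "(\<Sum>i<n. h ((T ^^ i) x)) \<le> birkhoff_max T h n x"
proof (induction n arbitrary: x)
  case 0 then show ?case by simp
next
  case (Suc n) from Suc[of "T x"] show ?case unfolding birkhoff_sum_Suc by simp
qed

text \<open>The hypothesis on \<open>u\<close> says that its upper limit exceeds \<beta>. Passing
  from the margin \<open>1 / Suc m\<close> to the smaller \<open>1 / Suc (Suc m)\<close> leaves room
  for the vanishing difference.\<close>

lemma frequently_above_transfer:
  fixes u v :: "nat \<Rightarrow> real"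
  assumes uv: "(\<lambda>n. v n - u n) \<longlonglongrightarrow> 0" and m: "\<forall>N. \<exists>n\<ge>N. u n > \<beta> + 1 / Suc m"
  shows "\<exists>m. \<forall>N. \<exists>n\<ge>N. v n > \<beta> + 1 / Suc m"
proof -
  have "1 / Suc m - 1 / Suc (Suc m) > (0::real)" by (simp add: field_simps add_pos_nonneg)
  from tendstoD[OF uv this] obtain N0
    where N0: "\<And>n. n \<ge> N0 \<Longrightarrow> \<bar>v n - u n\<bar> < 1 / Suc m - 1 / Suc (Suc m)"
    unfolding eventually_sequentially dist_real_def by auto
  have "\<exists>n\<ge>N. v n > \<beta> + 1 / Suc (Suc m)" for N
  proof -
    obtain n where n: "n \<ge> max N N0" "u n > \<beta> + 1 / Suc m" using m by blast
    then have "v n > \<beta> + 1 / Suc (Suc m)" using N0[of n] by auto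
    then show ?thesis using n by auto
  qed
  then show ?thesis by blast
qed

text \<open>If the lower limit were below the upper one, two rationals would fit strictly between
  them. Rational thresholds are used so that only countably many null sets will have to be
  removed.\<close>

lemma convergent_if_no_gap:
  fixes u :: "nat \<Rightarrow> real"
  assumes K: "\<And>n. \<bar>u n\<bar> \<le> K"
    and gap: "\<And>\<alpha> \<beta>. \<alpha> \<in> \<rat> \<Longrightarrow> \<beta> \<in> \<rat> \<Longrightarrow> \<alpha> < \<beta> \<Longrightarrow>
      \<not> ((\<exists>m. \<forall>N. \<exists>n\<ge>N. u n > \<beta> + 1 / Suc m) \<and> (\<exists>m. \<forall>N. \<exists>n\<ge>N. - u n > - \<alpha> + 1 / Suc m))"
  shows "convergent u"
proof -
  have freq: "\<exists>m. \<forall>N. \<exists>n\<ge>N. v n > c + 1 / Suc m"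
    if lt: "ereal c < limsup (\<lambda>n. ereal (v n))" for v :: "nat \<Rightarrow> real" and c
  proof -
    obtain e where e: "ereal c < ereal e" "ereal e < limsup (\<lambda>n. ereal (v n))"
      using ereal_dense2[OF lt] by blast
    obtain m where m: "inverse (real (Suc m)) < e - c" using reals_Archimedean[of "e - c"] e(1) by auto
    have "\<exists>n\<ge>N. v n > c + 1 / Suc m" for N
    proof (rule ccontr)
      assume "\<not> ?thesis"
      then have "\<forall>n\<ge>N. ereal (v n) \<le> ereal e" using m by (force simp: inverse_eq_divide not_less)
      then have "limsup (\<lambda>n. ereal (v n)) \<le> ereal e"
        by (intro Limsup_bounded) (auto simp: eventually_sequentially)
      then show False using e(2) by simp
    qed
    then show ?thesis by blast
  qed
  have "limsup (\<lambda>n. ereal (u n)) \<le> liminf (\<lambda>n. ereal (u n))"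
  proof (rule ccontr)
    assume "\<not> ?thesis"
    then have "liminf (\<lambda>n. ereal (u n)) < limsup (\<lambda>n. ereal (u n))" by simp
    then obtain s t where s: "liminf (\<lambda>n. ereal (u n)) < ereal s" and st: "ereal s < ereal t"
      and t: "ereal t < limsup (\<lambda>n. ereal (u n))"
      using ereal_dense2[of "liminf (\<lambda>n. ereal (u n))"] ereal_dense2 by blast
    obtain \<beta> where \<beta>: "\<beta> \<in> \<rat>" "s < \<beta>" "\<beta> < t" using Rats_dense_in_real[of s t] st by auto
    obtain \<alpha> where \<alpha>: "\<alpha> \<in> \<rat>" "s < \<alpha>" "\<alpha> < \<beta>" using Rats_dense_in_real[of s \<beta>] \<beta>(2) by auto
    have "ereal \<beta> < limsup (\<lambda>n. ereal (u n))" using \<beta>(3) by (intro less_trans[OF _ t]) simp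
    moreover have "ereal (- \<alpha>) < limsup (\<lambda>n. ereal (- u n))"
    proof -
      have "limsup (\<lambda>n. ereal (- u n)) = - liminf (\<lambda>n. ereal (u n))"
        using ereal_Limsup_uminus[of sequentially "\<lambda>n. ereal (u n)"] by simp
      moreover have "liminf (\<lambda>n. ereal (u n)) < ereal \<alpha>" using \<alpha>(2) by (intro less_trans[OF s]) simp
      ultimately show ?thesis by (simp flip: uminus_ereal.simps(1))
    qed
    ultimately show False using freq[of \<beta> u] freq[of "- \<alpha>" "\<lambda>n. - u n"] gap[OF \<alpha>(1) \<beta>(1) \<alpha>(3)] by blast
  qed
  then have eq: "liminf (\<lambda>n. ereal (u n)) = limsup (\<lambda>n. ereal (u n))"
    by (intro antisym Liminf_le_Limsup) auto
  have "ereal (- K) \<le> liminf (\<lambda>n. ereal (u n))" "limsup (\<lambda>n. ereal (u n)) \<le> ereal K"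
    using K by (auto intro!: Liminf_bounded Limsup_bounded simp: abs_le_iff minus_le_iff)
  then obtain l where "limsup (\<lambda>n. ereal (u n)) = ereal l"
    using eq by (cases "limsup (\<lambda>n. ereal (u n))") auto
  then have "(\<lambda>n. ereal (u n)) \<longlonglongrightarrow> ereal l"
    using eq by (intro Liminf_eq_Limsup) auto
  then show ?thesis by (auto simp: convergent_def)
qed

section \<open>Maximal inequality and almost everywhere convergence\<close>

locale finite_measure_preserving = finite_measure M for M :: "'a measure" +
  fixes T :: "'a \<Rightarrow> 'a"
  assumes T_measurable [measurable]: "T \<in> measurable M M"
    and distr_T: "distr M M T = M"
begin

lemma funpow_measurable [measurable]: "(T ^^ n) \<in> measurable M M"
  by (induction n) (auto intro: measurable_comp)

lemma integral_comp_T: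
  fixes f :: "'a \<Rightarrow> real"
  assumes "f \<in> borel_measurable M"
  shows "(\<integral>x. f (T x) \<partial>M) = (\<integral>x. f x \<partial>M)"
  using integral_distr[OF T_measurable assms] by (simp add: distr_T)

lemma integral_comp_funpow:
  fixes f :: "'a \<Rightarrow> real"
  assumes f: "f \<in> borel_measurable M"
  shows "(\<integral>x. f ((T ^^ n) x) \<partial>M) = (\<integral>x. f x \<partial>M)"
proof (induction n)
  case (Suc n)
  have "(\<integral>x. f ((T ^^ n) (T x)) \<partial>M) = (\<integral>x. f ((T ^^ n) x) \<partial>M)"
    by (intro integral_comp_T measurable_compose[OF funpow_measurable f])
  then show ?case using Suc by (simp add: funpow_swap1)
qed simp

lemma integrable_bounded:
  fixes f :: "'a \<Rightarrow> real"
  assumes "f \<in> borel_measurable M" "\<And>x. \<bar>f x\<bar> \<le> K"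
  shows "integrable M f"
  using assms by (intro integrable_const_bound[of _ K]) auto

lemma birkhoff_max_measurable [measurable]:
  "h \<in> borel_measurable M \<Longrightarrow> birkhoff_max T h n \<in> borel_measurable M"
proof (induction n)
  case 0 then show ?case by (simp cong: measurable_cong)
next
  case (Suc n)
  then have [measurable]: "h \<in> borel_measurable M" "birkhoff_max T h n \<in> borel_measurable M" by auto
  have "(\<lambda>x. max 0 (h x + birkhoff_max T h n (T x))) \<in> borel_measurable M" by measurable
  then show ?case by (simp cong: measurable_cong)
qed

lemma birkhoff_max_bounded:
  fixes h :: "'a \<Rightarrow> real"
  assumes "\<And>x. \<bar>h x\<bar> \<le> K"
  shows "\<bar>birkhoff_max T h n x\<bar> \<le> real n * K"
proof (induction n arbitrary: x)
  case (Suc n)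
  have "\<bar>birkhoff_max T h (Suc n) x\<bar> \<le> \<bar>h x\<bar> + \<bar>birkhoff_max T h n (T x)\<bar>" by auto
  also have "\<dots> \<le> K + real n * K" using assms Suc by (intro add_mono) auto
  finally show ?case by (simp add: algebra_simps)
qed simp

text \<open>Garsia's argument. Where the running maximum \<open>G n\<close> is positive,
  \<open>G n x \<le> h x + G n (T x)\<close>; integrating and using invariance, the integral of
  \<open>h\<close> over \<open>G n > 0\<close> is nonnegative. By \<open>pos\<close> these sets
  eventually contain every point with \<open>h x \<noteq> 0\<close>, so dominated convergence
  finishes.\<close>

lemma maximal_ergodic:
  fixes h :: "'a \<Rightarrow> real"
  assumes h [measurable]: "h \<in> borel_measurable M" and K: "\<And>x. \<bar>h x\<bar> \<le> K"
    and pos: "\<And>x. h x \<noteq> 0 \<Longrightarrow> \<exists>n. (\<Sum>i<n. h ((T ^^ i) x)) > 0"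
  shows "(\<integral>x. h x \<partial>M) \<ge> 0"
proof -
  define G where "G n = birkhoff_max T h n" for n
  define P where "P n x = h x * (if G n x > 0 then 1 else 0)" for n x
  have G [measurable]: "G n \<in> borel_measurable M" for n
    unfolding G_def by (intro birkhoff_max_measurable h)
  have intG: "integrable M (G n)" for n
    using birkhoff_max_bounded[of h K n, OF K] by (intro integrable_bounded) (auto simp: G_def[symmetric])
  have intGT: "integrable M (\<lambda>x. G n (T x))" for n
    using birkhoff_max_bounded[of h K n, OF K]
    by (intro integrable_bounded[where K = "real n * K"]) (auto simp: G_def[symmetric])
  have [measurable]: "P n \<in> borel_measurable M" for n
    unfolding P_def by measurable
  have Pb: "\<bar>P n x\<bar> \<le> K" for n x
    using K[of x] by (auto simp: P_def)
  have G0: "G n x \<ge> 0" for n x by (simp add: G_def birkhoff_max_nonneg)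
  have P_ge: "P n x \<ge> G n x - G n (T x)" for n x
  proof (cases "G n x > 0")
    case True
    then obtain m where n: "n = Suc m" by (cases n) (auto simp: G_def)
    have "G n x = h x + G m (T x)" using True by (auto simp: G_def n max_def split: if_splits)
    also have "G m (T x) \<le> G n (T x)" unfolding G_def n by (rule birkhoff_max_mono_Suc)
    finally show ?thesis using True by (simp add: P_def)
  next
    case False
    then show ?thesis using G0[of n x] G0[of n "T x"] by (simp add: P_def)
  qed
  have "0 \<le> (\<integral>x. P n x \<partial>M)" for n
  proof -
    have "0 = (\<integral>x. G n x - G n (T x) \<partial>M)"
      using intG intGT by (simp add: integral_comp_T)
    also have "\<dots> \<le> (\<integral>x. P n x \<partial>M)"
      using intG intGT Pb P_ge by (intro integral_mono integrable_bounded[of "P n" K]) auto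
    finally show ?thesis .
  qed
  moreover have "(\<lambda>n. \<integral>x. P n x \<partial>M) \<longlonglongrightarrow> (\<integral>x. h x \<partial>M)"
  proof (rule integral_dominated_convergence[where w = "\<lambda>_. K"])
    show "AE x in M. (\<lambda>n. P n x) \<longlonglongrightarrow> h x"
    proof (rule AE_I2)
      fix x
      show "(\<lambda>n. P n x) \<longlonglongrightarrow> h x"
      proof (cases "h x = 0")
        case True then show ?thesis by (simp add: P_def)
      next
        case False
        then obtain m where m: "(\<Sum>i<m. h ((T ^^ i) x)) > 0" using pos by blast
        have "P n x = h x" if "n \<ge> m" for n
        proof -
          have "0 < G m x" using m birkhoff_sum_le_max[where h = h and T = T and n = m and x = x]
            by (simp add: G_def)
          also have "\<dots> \<le> G n x" unfolding G_def using that by (rule birkhoff_max_mono)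
          finally show ?thesis by (simp add: P_def)
        qed
        then show ?thesis
          by (intro tendsto_eventually) (auto simp: eventually_sequentially)
      qed
    qed
  qed (use Pb in auto)
  ultimately show ?thesis by (intro LIMSEQ_le_const) auto
qed

lemma birkhoff_average_shift:
  fixes f :: "'a \<Rightarrow> real"
  assumes K: "\<And>x. \<bar>f x\<bar> \<le> K"
  shows "(\<lambda>n. (\<Sum>i<n. f ((T ^^ i) (T x))) / n - (\<Sum>i<n. f ((T ^^ i) x)) / n) \<longlonglongrightarrow> 0"
proof (rule Lim_null_comparison)
  show "(\<lambda>n. 2 * K / real n) \<longlonglongrightarrow> 0" by (rule lim_const_over_n)
  have eq: "(\<Sum>i<n. f ((T ^^ i) (T x))) - (\<Sum>i<n. f ((T ^^ i) x)) = f ((T ^^ n) x) - f x" for n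
    using birkhoff_sum_Suc[of f T x n] by simp
  show "\<forall>\<^sub>F n in sequentially. norm ((\<Sum>i<n. f ((T ^^ i) (T x))) / n - (\<Sum>i<n. f ((T ^^ i) x)) / n)
      \<le> 2 * K / real n"
  proof (rule always_eventually, rule allI)
    fix n
    have "\<bar>f ((T ^^ n) x) - f x\<bar> \<le> 2 * K"
      using K[of "(T ^^ n) x"] K[of x] by linarith
    then show "norm ((\<Sum>i<n. f ((T ^^ i) (T x))) / n - (\<Sum>i<n. f ((T ^^ i) x)) / n) \<le> 2 * K / real n"
      unfolding diff_divide_distrib[symmetric] eq by (simp add: divide_right_mono)
  qed
qed

text \<open>The points where the upper limit of the Birkhoff averages exceeds \<beta>. With the
  margin \<open>1 / Suc m\<close> only countable quantifiers occur, which gives measurability; a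
  lower limit below \<alpha> is expressed by \<open>- f\<close> and
  \<open>- \<alpha>\<close>.\<close>

definition above :: "('a \<Rightarrow> real) \<Rightarrow> real \<Rightarrow> 'a set" where
  "above f \<beta> = {x \<in> space M. \<exists>m::nat. \<forall>N. \<exists>n\<ge>N. (\<Sum>i<n. f ((T ^^ i) x)) / real n > \<beta> + 1 / Suc m}"

lemma above_sets [measurable]: "f \<in> borel_measurable M \<Longrightarrow> above f \<beta> \<in> sets M"
proof -
  assume f [measurable]: "f \<in> borel_measurable M"
  have [measurable]: "(\<lambda>x. (\<Sum>i<n. f ((T ^^ i) x)) / real n) \<in> borel_measurable M" for n
    by (intro borel_measurable_divide borel_measurable_sum borel_measurable_const
        measurable_compose[OF funpow_measurable f])
  show "above f \<beta> \<in> sets M"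
    unfolding above_def by measurable
qed

lemma above_T:
  assumes K: "\<And>x. \<bar>f x\<bar> \<le> K" and x: "x \<in> space M"
  shows "T x \<in> above f \<beta> \<longleftrightarrow> x \<in> above f \<beta>"
proof -
  let ?u = "\<lambda>x n. (\<Sum>i<n. f ((T ^^ i) x)) / real n"
  have 1: "(\<lambda>n. ?u (T x) n - ?u x n) \<longlonglongrightarrow> 0"
    by (rule birkhoff_average_shift[OF K])
  have 2: "(\<lambda>n. ?u x n - ?u (T x) n) \<longlonglongrightarrow> 0"
    using tendsto_minus[OF 1] by simp
  have "T x \<in> space M" using x by (meson T_measurable measurable_space)
  then show ?thesis
    unfolding above_def using x frequently_above_transfer[OF 1] frequently_above_transfer[OF 2] by blast
qed

text \<open>On the invariant set \<open>A\<close> where the upper limit exceeds \<open>\<beta>\<close> and the lower limit is below \<open>\<alpha>\<close>, the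
  maximal inequality gives both \<open>\<integral>\<^sub>A (f - \<beta>) \<ge> 0\<close> and \<open>\<integral>\<^sub>A (\<alpha> - f) \<ge> 0\<close>.\<close>

lemma birkhoff_gap_null:
  assumes f [measurable]: "f \<in> borel_measurable M" and K: "\<And>x. \<bar>f x\<bar> \<le> K" and ab: "\<alpha> < \<beta>"
  shows "above f \<beta> \<inter> above (\<lambda>x. - f x) (- \<alpha>) \<in> null_sets M"
proof -
  let ?A = "above f \<beta> \<inter> above (\<lambda>x. - f x) (- \<alpha>)"
  have A [measurable]: "?A \<in> sets M" by measurable
  have inv: "(T ^^ i) x \<in> ?A" if "x \<in> ?A" for i x
  proof (induction i)
    case 0 then show ?case using that by simp
  next
    case (Suc i)
    moreover have "(T ^^ i) x \<in> space M" using Suc sets.sets_into_space[OF A] by blast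
    ultimately show ?case using above_T[of f K] above_T[of "\<lambda>x. - f x" K] K by simp
  qed
  have key: "0 \<le> (\<integral>x. (g x - c) * indicator ?A x \<partial>M)"
    if g [measurable]: "g \<in> borel_measurable M" and Kg: "\<And>x. \<bar>g x\<bar> \<le> K" and sub: "?A \<subseteq> above g c" for g c
  proof (rule maximal_ergodic[where K = "K + \<bar>c\<bar>"])
    fix x
    show "\<bar>(g x - c) * indicator ?A x\<bar> \<le> K + \<bar>c\<bar>"
      using Kg[of x] by (auto simp: indicator_def)
    assume "(g x - c) * indicator ?A x \<noteq> 0"
    then have x: "x \<in> ?A" by (auto simp: indicator_def split: if_splits)
    then have "x \<in> above g c" using sub by blast
    \<comment> \<open>Requiring \<open>n \<ge> 1\<close> discards the empty average: its value is 0
      by the convention for division by 0 and would exceed a negative \<open>c\<close> without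
      saying anything about the sums.\<close>
    then obtain m where "\<exists>n\<ge>1. (\<Sum>i<n. g ((T ^^ i) x)) / real n > c + 1 / Suc m"
      unfolding above_def by blast
    then obtain n where n: "n \<ge> 1" "(\<Sum>i<n. g ((T ^^ i) x)) / real n > c + 1 / Suc m" by blast
    then have "(\<Sum>i<n. g ((T ^^ i) x)) / real n > c"
      by (smt (verit) divide_nonneg_nonneg of_nat_0_le_iff)
    then have "(\<Sum>i<n. g ((T ^^ i) x)) > real n * c"
      using n(1) by (simp add: field_simps)
    then have "(\<Sum>i<n. g ((T ^^ i) x) - c) > 0" by (simp add: sum_subtractf)
    \<comment> \<open>The set is invariant, so the indicator is 1 along the whole orbit and the
      Birkhoff sums are those of \<open>g - c\<close>.\<close>
    moreover have "(g ((T ^^ i) x) - c) * indicator ?A ((T ^^ i) x) = g ((T ^^ i) x) - c" for i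
      using inv[OF x, of i] by (simp only: indicator_simps mult_1_right)
    ultimately show "\<exists>n. (\<Sum>i<n. (g ((T ^^ i) x) - c) * indicator ?A ((T ^^ i) x)) > 0"
      by (metis (no_types, lifting) mult.right_neutral sum.cong)
  qed measurable
  have int: "integrable M (\<lambda>x. (g x - c) * indicator ?A x)"
    if "g \<in> borel_measurable M" "\<And>x. \<bar>g x\<bar> \<le> K" for g c
  proof (rule integrable_bounded[where K = "K + \<bar>c\<bar>"])
    show "(\<lambda>x. (g x - c) * indicator ?A x) \<in> borel_measurable M" using that(1) by measurable
    show "\<bar>(g x - c) * indicator ?A x\<bar> \<le> K + \<bar>c\<bar>" for x
      using that(2)[of x] by (auto simp: indicator_def)
  qed
  have "0 \<le> (\<integral>x. (f x - \<beta>) * indicator ?A x \<partial>M) + (\<integral>x. (- f x - (- \<alpha>)) * indicator ?A x \<partial>M)"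
    using key[of f \<beta>] key[of "\<lambda>x. - f x" "- \<alpha>"] K by simp
  also have "\<dots> = (\<integral>x. (f x - \<beta>) * indicator ?A x + (- f x - (- \<alpha>)) * indicator ?A x \<partial>M)"
    using int[of f \<beta>] int[of "\<lambda>x. - f x" "- \<alpha>"] K by (subst Bochner_Integration.integral_add) auto
  also have "\<dots> = (\<integral>x. (\<alpha> - \<beta>) * indicator ?A x \<partial>M)"
    by (intro Bochner_Integration.integral_cong) (auto simp: algebra_simps)
  also have "\<dots> = (\<alpha> - \<beta>) * measure M ?A"
    using sets.sets_into_space[OF A] by (simp add: Int_absorb2)
  finally have "measure M ?A = 0"
    using ab measure_nonneg[of M ?A] by (simp add: zero_le_mult_iff)
  then show ?thesis using A by (simp add: null_sets_def emeasure_eq_measure)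
qed

lemma birkhoff_convergent:
  fixes f :: "'a \<Rightarrow> real"
  assumes f: "f \<in> borel_measurable M" and K: "\<And>x. \<bar>f x\<bar> \<le> K"
  shows "AE x in M. convergent (\<lambda>n. (\<Sum>i<n. f ((T ^^ i) x)) / real n)"
proof -
  have gap: "AE x in M. \<forall>\<alpha>\<in>\<rat>. \<forall>\<beta>\<in>\<rat>. \<alpha> < \<beta> \<longrightarrow> x \<notin> above f \<beta> \<inter> above (\<lambda>x. - f x) (- \<alpha>)"
    unfolding AE_ball_countable[OF countable_rat]
  proof (intro ballI)
    fix \<alpha> \<beta> :: real
    show "AE x in M. \<alpha> < \<beta> \<longrightarrow> x \<notin> above f \<beta> \<inter> above (\<lambda>x. - f x) (- \<alpha>)"
    proof (cases "\<alpha> < \<beta>")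
      case True
      show ?thesis using AE_not_in[OF birkhoff_gap_null[OF f K True]] by (rule AE_mp) auto
    qed simp
  qed
  have conv: "convergent (\<lambda>n. (\<Sum>i<n. f ((T ^^ i) x)) / real n)"
    if x: "x \<in> space M" "\<forall>\<alpha>\<in>\<rat>. \<forall>\<beta>\<in>\<rat>. \<alpha> < \<beta> \<longrightarrow> x \<notin> above f \<beta> \<inter> above (\<lambda>x. - f x) (- \<alpha>)" for x
  proof (rule convergent_if_no_gap[where K = K])
    fix n :: nat
    have "\<bar>\<Sum>i<n. f ((T ^^ i) x)\<bar> \<le> (\<Sum>i<n. K)"
      by (intro order_trans[OF sum_abs] sum_mono K)
    moreover have "0 \<le> K" using K[of x] by linarith
    ultimately show "\<bar>(\<Sum>i<n. f ((T ^^ i) x)) / real n\<bar> \<le> K"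
      by (cases "n = 0") (auto simp: field_simps)
  next
    fix \<alpha> \<beta> :: real assume "\<alpha> \<in> \<rat>" "\<beta> \<in> \<rat>" "\<alpha> < \<beta>"
    then have "x \<notin> above f \<beta> \<inter> above (\<lambda>x. - f x) (- \<alpha>)" using x by blast
    then show "\<not> ((\<exists>m. \<forall>N. \<exists>n\<ge>N. (\<Sum>i<n. f ((T ^^ i) x)) / real n > \<beta> + 1 / Suc m) \<and>
        (\<exists>m. \<forall>N. \<exists>n\<ge>N. - ((\<Sum>i<n. f ((T ^^ i) x)) / real n) > - \<alpha> + 1 / Suc m))"
      using x(1) by (simp add: above_def sum_negf)
  qed
  show ?thesis by (rule AE_mp[OF gap AE_I2]) (use conv in blast)
qed

end

section \<open>Length of curves\<close>

lemma curve_length_upper: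
  assumes "mono_on {..n} q" "q ` {..n} \<subseteq> {s..t}"
  shows "(\<Sum>i<n. ennreal (d (h (q i)) (h (q (Suc i))))) \<le> curve_length d h s t"
  unfolding curve_length_def using assms by (intro SUP_upper2[of "(n, q)"]) auto

lemma curve_length_least:
  assumes "\<And>n q. mono_on {..n} q \<Longrightarrow> q ` {..n} \<subseteq> {s..t} \<Longrightarrow>
    (\<Sum>i<n. ennreal (d (h (q i)) (h (q (Suc i))))) \<le> u"
  shows "curve_length d h s t \<le> u"
  unfolding curve_length_def using assms by (intro SUP_least) auto

text \<open>Subdivisions of \<open>{s..t}\<close> and of \<open>{G s..G t}\<close> correspond to
  each other under \<open>G\<close>; the intermediate value theorem supplies the preimages.\<close>

lemma curve_length_reparam:
  fixes G :: "real \<Rightarrow> real"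
  assumes G: "strict_mono G" "continuous_on UNIV G" and st: "s \<le> t"
  shows "curve_length d (\<lambda>r. h (G r)) s t = curve_length d h (G s) (G t)"
proof (rule antisym)
  have le: "G r \<le> G r' \<longleftrightarrow> r \<le> r'" for r r' by (rule strict_mono_less_eq[OF G(1)])
  show "curve_length d (\<lambda>r. h (G r)) s t \<le> curve_length d h (G s) (G t)"
  proof (rule curve_length_least)
    fix n :: nat and q assume q: "mono_on {..n} q" "q ` {..n} \<subseteq> {s..t}"
    show "(\<Sum>i<n. ennreal (d (h (G (q i))) (h (G (q (Suc i)))))) \<le> curve_length d h (G s) (G t)"
      using q by (intro curve_length_upper[of n "\<lambda>i. G (q i)"]) (auto simp: mono_on_def le)
  qed
  show "curve_length d h (G s) (G t) \<le> curve_length d (\<lambda>r. h (G r)) s t"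
  proof (rule curve_length_least)
    fix n :: nat and q assume q: "mono_on {..n} q" "q ` {..n} \<subseteq> {G s..G t}"
    have "\<exists>r. s \<le> r \<and> r \<le> t \<and> G r = q i" if "i \<in> {..n}" for i
      using q(2) that st continuous_on_subset[OF G(2)] by (intro IVT') auto
    then obtain q' where q': "\<And>i. i \<in> {..n} \<Longrightarrow> s \<le> q' i \<and> q' i \<le> t \<and> G (q' i) = q i"
      by metis
    have "(\<Sum>i<n. ennreal (d (h (q i)) (h (q (Suc i))))) =
        (\<Sum>i<n. ennreal (d (h (G (q' i))) (h (G (q' (Suc i))))))"
      using q' by (intro sum.cong) auto
    also have "\<dots> \<le> curve_length d (\<lambda>r. h (G r)) s t"
    proof (rule curve_length_upper)
      show "mono_on {..n} q'"
      proof (rule mono_onI)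
        fix i j assume ij: "i \<in> {..n}" "j \<in> {..n}" "i \<le> j"
        then have "G (q' i) \<le> G (q' j)" using q' q(1) by (auto simp: mono_on_def)
        then show "q' i \<le> q' j" by (simp add: le)
      qed
      show "q' ` {..n} \<subseteq> {s..t}" using q' by auto
    qed
    finally show "(\<Sum>i<n. ennreal (d (h (q i)) (h (q (Suc i))))) \<le> curve_length d (\<lambda>r. h (G r)) s t" .
  qed
qed

lemma sum_lessThan_add:
  fixes f :: "nat \<Rightarrow> 'a::comm_monoid_add"
  shows "(\<Sum>i<m + n. f i) = (\<Sum>i<m. f i) + (\<Sum>i<n. f (m + i))"
  by (induction n) (simp_all add: add.assoc)

text \<open>Truncating a subdivision at \<open>m\<close> with \<open>min\<close> and
  \<open>max\<close> splits it into two; the triangle inequality is spent only on a step that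
  straddles \<open>m\<close>. Conversely, two subdivisions are concatenated.\<close>

lemma curve_length_add:
  assumes d: "Metric_space UNIV d" and sm: "s \<le> m" and mt: "m \<le> t"
  shows "curve_length d h s t = curve_length d h s m + curve_length d h m t"
proof (rule antisym)
  interpret Metric_space UNIV d by (rule d)
  let ?S = "\<lambda>n q. \<Sum>i<n. ennreal (d (h (q i)) (h (q (Suc i))))"
  show "curve_length d h s t \<le> curve_length d h s m + curve_length d h m t"
  proof (rule curve_length_least)
    fix n :: nat and q assume q: "mono_on {..n} q" "q ` {..n} \<subseteq> {s..t}"
    let ?q1 = "\<lambda>i. min (q i) m" and ?q2 = "\<lambda>i. max (q i) m"
    have "?S n q \<le> (\<Sum>i<n. ennreal (d (h (?q1 i)) (h (?q1 (Suc i)))) + ennreal (d (h (?q2 i)) (h (?q2 (Suc i)))))"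
    proof (rule sum_mono)
      fix i assume "i \<in> {..<n}"
      then have le: "q i \<le> q (Suc i)" using q(1) by (auto simp: mono_on_def)
      consider "q (Suc i) \<le> m" | "m \<le> q i" | "q i \<le> m" "m \<le> q (Suc i)" by linarith
      then show "ennreal (d (h (q i)) (h (q (Suc i)))) \<le>
          ennreal (d (h (?q1 i)) (h (?q1 (Suc i)))) + ennreal (d (h (?q2 i)) (h (?q2 (Suc i))))"
      proof cases
        case 3
        then show ?thesis
          using triangle[of "h (q i)" "h m" "h (q (Suc i))"]
          by (simp add: min_absorb1 min_absorb2 max_absorb1 max_absorb2 ennreal_plus[symmetric] ennreal_leI del: ennreal_plus)
      qed (use le in \<open>simp_all add: min_absorb1 min_absorb2 max_absorb1 max_absorb2\<close>)
    qed
    also have "\<dots> = ?S n ?q1 + ?S n ?q2" by (rule sum.distrib)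
    also have "\<dots> \<le> curve_length d h s m + curve_length d h m t"
    proof (intro add_mono curve_length_upper)
      show "mono_on {..n} ?q1" "mono_on {..n} ?q2"
        using q(1) by (fastforce simp: mono_on_def min_def max_def)+
      show "?q1 ` {..n} \<subseteq> {s..m}" "?q2 ` {..n} \<subseteq> {m..t}"
        using q(2) sm mt by (auto simp: image_subset_iff)
    qed
    finally show "?S n q \<le> curve_length d h s m + curve_length d h m t" .
  qed
  show "curve_length d h s m + curve_length d h m t \<le> curve_length d h s t"
  proof -
    let ?P = "\<lambda>s t. {(n::nat, q). mono_on {..n} q \<and> q ` {..n} \<subseteq> {s..t::real}}"
    let ?V = "\<lambda>(n, q). ?S n q"
    have ne: "?P s m \<noteq> {}" "?P m t \<noteq> {}"
      using sm mt by (auto simp: mono_on_def intro!: exI[of _ 0] exI[of _ "\<lambda>_. m"])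
    have "curve_length d h s m + curve_length d h m t = (SUP x\<in>?P s m. SUP y\<in>?P m t. ?V x + ?V y)"
      unfolding curve_length_def ennreal_SUP_add_left[OF ne(1), symmetric]
      by (rule SUP_cong[OF refl], rule ennreal_SUP_add_right[OF ne(2)])
    also have "\<dots> \<le> curve_length d h s t"
    proof (intro SUP_least; clarify)
      fix n1 :: nat and q1 and n2 :: nat and q2
      assume q1: "mono_on {..n1} q1" "q1 ` {..n1} \<subseteq> {s..m}" and q2: "mono_on {..n2} q2" "q2 ` {..n2} \<subseteq> {m..t}"
      \<comment> \<open>The point with index 0 of \<open>q2\<close> gets index
        \<open>Suc n1\<close>, so the concatenation has one additional step, from
        \<open>q1 n1\<close> to \<open>q2 0\<close>; its nonnegative contribution is
        dropped.\<close>
      define q where "q i = (if i \<le> n1 then q1 i else q2 (i - Suc n1))" for i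
      have "?S n1 q1 + ?S n2 q2 \<le> ?S (Suc n1 + n2) q"
      proof -
        have "?S (Suc n1 + n2) q = ?S (Suc n1) q + (\<Sum>i<n2. ennreal (d (h (q (Suc n1 + i))) (h (q (Suc (Suc n1 + i))))))"
          by (subst sum_lessThan_add) simp
        also have "(\<Sum>i<n2. ennreal (d (h (q (Suc n1 + i))) (h (q (Suc (Suc n1 + i)))))) = ?S n2 q2"
          by (intro sum.cong) (auto simp: q_def Suc_diff_le)
        also have "?S (Suc n1) q = ?S n1 q1 + ennreal (d (h (q n1)) (h (q (Suc n1))))"
          by (simp add: q_def)
        finally show ?thesis by (simp add: add_right_mono)
      qed
      also have "\<dots> \<le> curve_length d h s t"
      proof (rule curve_length_upper)
        have 1: "s \<le> q1 i" "q1 i \<le> m" if "i \<le> n1" for i using q1(2) that by auto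
        have 2: "m \<le> q2 i" "q2 i \<le> t" if "i \<le> n2" for i using q2(2) that by auto
        show "mono_on {..Suc n1 + n2} q"
        proof (rule mono_onI)
          fix i j assume ij: "i \<in> {..Suc n1 + n2}" "j \<in> {..Suc n1 + n2}" "i \<le> j"
          consider "j \<le> n1" | "i \<le> n1" "n1 < j" | "n1 < i" by linarith
          then show "q i \<le> q j"
          proof cases
            case 1 then show ?thesis using ij q1(1) by (auto simp: q_def mono_on_def)
          next
            case A: 2
            have "j - Suc n1 \<le> n2" using ij by auto
            then show ?thesis using 1(2)[OF A(1)] 2(1)[of "j - Suc n1"] A by (simp add: q_def)
          next
            case 3
            then have "i - Suc n1 \<le> j - Suc n1" "i - Suc n1 \<le> n2" "j - Suc n1 \<le> n2" using ij by auto
            then show ?thesis using 3 ij q2(1) by (simp add: q_def mono_on_def)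
          qed
        qed
        show "q ` {..Suc n1 + n2} \<subseteq> {s..t}"
        proof (rule image_subsetI)
          fix i assume "i \<in> {..Suc n1 + n2}"
          then show "q i \<in> {s..t}"
            using 1[of i] order_trans[OF sm 2(1)[of "i - Suc n1"]] 2(2)[of "i - Suc n1"] mt
            by (cases "i \<le> n1") (auto simp: q_def)
        qed
      qed
      finally show "?S n1 q1 + ?S n2 q2 \<le> curve_length d h s t" .
    qed
    finally show ?thesis .
  qed
qed

lemma curve_length_unit_steps:
  assumes d: "Metric_space UNIV d" and unit: "\<And>s. curve_length d h s (s + 1) = 1"
  shows "curve_length d h s (s + real k) = of_nat k"
proof (induction k)
  case 0
  have "curve_length d h s s + 1 = ennreal 1"
    using curve_length_add[OF d, of s s "s + 1" h] unit[of s] by simp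
  then have "curve_length d h s s = 0"
    by (cases "curve_length d h s s") (auto simp flip: ennreal_1 ennreal_plus)
  then show ?case by simp
next
  case (Suc k)
  have "curve_length d h s (s + real (Suc k)) =
      curve_length d h s (s + real k) + curve_length d h (s + real k) (s + real k + 1)"
    using curve_length_add[OF d, of s "s + real k" "s + real k + 1" h] by (simp add: algebra_simps)
  then show ?case using Suc unit[of "s + real k"] by (simp add: add.commute)
qed

text \<open>Monotonicity squeezes the length between those of the segments from \<open>s\<close> of
  integer lengths \<open>k\<close> and \<open>k + 1\<close>, where \<open>k\<close> is the integer
  part of \<open>t - s\<close>.\<close>

lemma curve_length_unit_bounds:
  assumes d: "Metric_space UNIV d" and unit: "\<And>s. curve_length d h s (s + 1) = 1" and st: "s \<le> t"
  shows "\<bar>enn2real (curve_length d h s t) - (t - s)\<bar> \<le> 1"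
proof -
  define k where "k = nat \<lfloor>t - s\<rfloor>"
  have k: "real k \<le> t - s" "t - s < real (Suc k)" using st unfolding k_def by linarith+
  have "curve_length d h s (s + real k) + curve_length d h (s + real k) t = curve_length d h s t"
    using k by (intro curve_length_add[OF d, symmetric]) auto
  then have "ennreal (real k) \<le> curve_length d h s t"
    unfolding curve_length_unit_steps[OF d unit] by (metis ennreal_of_nat_eq_real_of_nat le_iff_add)
  moreover have "curve_length d h s t + curve_length d h t (s + real (Suc k)) = curve_length d h s (s + real (Suc k))"
    using k st by (intro curve_length_add[OF d, symmetric]) auto
  then have "curve_length d h s t \<le> ennreal (real (Suc k))"
    unfolding curve_length_unit_steps[OF d unit] by (metis ennreal_of_nat_eq_real_of_nat le_iff_add)
  moreover from this have "curve_length d h s t < top" by (auto simp: less_top[symmetric] top_unique)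
  ultimately have "enn2real (ennreal (real k)) \<le> enn2real (curve_length d h s t)"
    "enn2real (curve_length d h s t) \<le> real (Suc k)"
    by (blast intro: enn2real_mono, intro enn2real_leI, simp_all)
  then show ?thesis using k by simp
qed

section \<open>Circles and winding numbers\<close>

lemma cis_2pi_eq_iff: "cis (2 * pi * x) = cis (2 * pi * y) \<longleftrightarrow> x - y \<in> \<int>"
proof -
  have "cis (2 * pi * x) = cis (2 * pi * y) \<longleftrightarrow> cis (2 * pi * (x - y)) = 1"
    by (simp add: right_diff_distrib cis_divide[symmetric])
  also have "\<dots> \<longleftrightarrow> x - y \<in> \<int>"
  proof
    assume "cis (2 * pi * (x - y)) = 1"
    then have "cos (2 * pi * (x - y)) = 1" by (metis cis.simps(1) one_complex.simps(1))
    then obtain n :: int where "2 * pi * (x - y) = of_int n * 2 * pi"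
      using cos_one_2pi_int by blast
    then have "(2 * pi) * (x - y) = (2 * pi) * of_int n" by (simp add: mult_ac)
    then have "x - y = of_int n" by simp
    then show "x - y \<in> \<int>" by simp
  next
    assume "x - y \<in> \<int>"
    then show "cis (2 * pi * (x - y)) = 1" by (rule cis_multiple_2pi)
  qed
  finally show ?thesis .
qed

text \<open>On a convex set a nonvanishing map has a continuous logarithm; its imaginary part is the
  angle. Convexity covers intervals as well as the parameter squares used later.\<close>

lemma lift_to_line:
  fixes f :: "'a::real_normed_vector \<Rightarrow> complex"
  assumes "continuous_on S f" "convex S" "f ` S \<subseteq> sphere 0 1"
  obtains g where "continuous_on S g" "\<And>x. x \<in> S \<Longrightarrow> f x = cis (2 * pi * g x)"
proof -
  have nz: "f z \<noteq> 0" and nf: "norm (f z) = 1" if "z \<in> S" for z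
    using assms(3) that by (auto simp: image_subset_iff)
  obtain l where l: "continuous_on S l" "\<And>x. x \<in> S \<Longrightarrow> f x = exp (l x)"
    using continuous_logarithm_on_contractible[OF assms(1) convex_imp_contractible[OF assms(2)] nz] by blast
  show ?thesis
  proof
    show "continuous_on S (\<lambda>x. Im (l x) / (2 * pi))"
      using l(1) by (intro continuous_intros) auto
    fix x assume x: "x \<in> S"
    have "exp (Re (l x)) = 1" using nf[OF x] l(2)[OF x] by (metis norm_exp_eq_Re)
    then show "f x = cis (2 * pi * (Im (l x) / (2 * pi)))"
      using l(2)[OF x] by (simp add: exp_eq_polar)
  qed
qed

text \<open>A change of at least 1 would cross an integer. Applied to the difference of two lifts,
  where an integer value means that the two paths on the circle meet.\<close>

lemma avoid_Ints_diff_less_1: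
  fixes g :: "real \<Rightarrow> real"
  assumes g: "continuous_on {a..b} g" and ab: "a \<le> b" and avoid: "\<And>t. t \<in> {a..b} \<Longrightarrow> g t \<notin> \<int>"
  shows "\<bar>g b - g a\<bar> < 1"
proof (rule ccontr)
  assume "\<not> ?thesis"
  then consider "g a + 1 \<le> g b" | "g b + 1 \<le> g a" by linarith
  then show False
  proof cases
    case 1
    then have "g a \<le> of_int \<lceil>g a\<rceil>" "of_int \<lceil>g a\<rceil> \<le> g b" by linarith+
    then show False using IVT'[OF _ _ ab g] avoid by (metis Ints_of_int atLeastAtMost_iff)
  next
    case 2
    then have "g b \<le> of_int \<lceil>g b\<rceil>" "of_int \<lceil>g b\<rceil> \<le> g a" by linarith+
    then show False using IVT2'[OF _ _ ab g] avoid by (metis Ints_of_int atLeastAtMost_iff)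
  qed
qed

text \<open>Adding \<open>1/2\<close> turns integer values into values avoiding the integers, so the
  total change is less than 1; being itself an integer, it is 0.\<close>

lemma Ints_valued_constant:
  fixes g :: "real \<Rightarrow> real"
  assumes g: "continuous_on {a..b} g" and ab: "a \<le> b" and ints: "\<And>t. t \<in> {a..b} \<Longrightarrow> g t \<in> \<int>"
  shows "g b = g a"
proof -
  have "\<bar>(g b + 1/2) - (g a + 1/2)\<bar> < 1"
  proof (rule avoid_Ints_diff_less_1[OF _ ab])
    show "continuous_on {a..b} (\<lambda>t. g t + 1/2)" using g by (intro continuous_intros)
    fix t assume "t \<in> {a..b}"
    then have "g t \<in> \<int>" by (rule ints)
    then obtain k where k: "g t = of_int k" by (elim Ints_cases)
    show "g t + 1/2 \<notin> \<int>"
    proof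
      assume "g t + 1/2 \<in> \<int>"
      then obtain l where "g t + 1/2 = of_int l" by (elim Ints_cases)
      then have "(of_int (2 * k + 1) :: real) = of_int (2 * l)" using k by simp
      then have "2 * k + 1 = 2 * l" by (simp only: of_int_eq_iff)
      then show False by presburger
    qed
  qed
  moreover have "g a \<in> \<int>" "g b \<in> \<int>" using ints ab by auto
  ultimately show ?thesis by (auto elim!: Ints_cases)
qed

section \<open>Changes of parametrisation and well-definedness of the winding number\<close>

lemma circle_orientation_nonempty: "circle_orientation F C \<Longrightarrow> \<exists>c. c \<in> C"
  unfolding circle_orientation_def by blast

lemma circle_orientation_iff:
  assumes "circle_orientation F C" "c \<in> C"
  shows "c2 \<in> C \<longleftrightarrow> circle_param F c2 \<and> circle_increasing (inv_into (sphere 0 1) c \<circ> c2)"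
  using assms unfolding circle_orientation_def by blast

lemma circle_orientation_homeomorphism:
  assumes "circle_orientation F C" "c \<in> C"
  obtains c' where "homeomorphism (sphere 0 1) F c c'"
  using assms unfolding circle_orientation_def circle_param_def by meson

lemma circle_orientation_inj:
  assumes "circle_orientation F C" "c \<in> C"
  shows "inj_on c (sphere 0 1)" "c ` sphere 0 1 = F"
  using circle_orientation_homeomorphism[OF assms] homeomorphism_def
  by (metis inj_on_inverseI) (metis assms circle_orientation_homeomorphism homeomorphism_image1)

lemma circle_orientation_cover_eq_iff:
  assumes "circle_orientation F C" "c \<in> C"
  shows "c (cis (2 * pi * s)) = c (cis (2 * pi * t)) \<longleftrightarrow> s - t \<in> \<int>"
  using inj_on_eq_iff[OF circle_orientation_inj(1)[OF assms], of "cis (2 * pi * s)" "cis (2 * pi * t)"]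
  by (simp add: cis_2pi_eq_iff)

lemma circle_orientation_transition:
  assumes C: "circle_orientation F C" "c \<in> C" "c2 \<in> C"
  obtains G where "continuous_on UNIV G" "strict_mono G" "\<And>t. c2 (cis (2 * pi * t)) = c (cis (2 * pi * G t))"
proof -
  have "circle_increasing (inv_into (sphere 0 1) c \<circ> c2)"
    using C circle_orientation_iff by metis
  then obtain G where G: "continuous_on UNIV G" "strict_mono G"
    "\<And>t. inv_into (sphere 0 1) c (c2 (cis (2 * pi * t))) = cis (2 * pi * G t)"
    by (auto simp: circle_increasing_def)
  have "c2 (cis (2 * pi * t)) = c (cis (2 * pi * G t))" for t
  proof -
    have "c2 (cis (2 * pi * t)) \<in> c ` sphere 0 1"
      using circle_orientation_inj(2)[OF C(1,2)] circle_orientation_inj(2)[OF C(1,3)] by auto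
    then show ?thesis unfolding G(3)[symmetric] by (simp add: f_inv_into_f)
  qed
  then show ?thesis using G that by blast
qed

text \<open>The normalisation of \<open>d\<close> speaks only of the parameter interval from 0 to 1.
  Rotating the parametrisation moves the starting point, so that every interval of length 1 in the
  cover gets length 1.\<close>

lemma circle_orientation_rotate:
  assumes C: "circle_orientation F C" "c \<in> C"
  shows "(\<lambda>z. c (cis (2 * pi * s) * z)) \<in> C" (is "?c \<in> C")
proof -
  obtain c' where c': "homeomorphism (sphere 0 1) F c c'"
    by (rule circle_orientation_homeomorphism[OF C])
  have "homeomorphism (sphere 0 1) (sphere 0 1) (\<lambda>z. cis (2 * pi * s) * z) (\<lambda>z. cis (- (2 * pi * s)) * z)"
    by (intro homeomorphismI continuous_intros) (auto simp: norm_mult mult.assoc[symmetric] cis_mult)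
  from homeomorphism_compose[OF this c'] have "circle_param F ?c"
    by (auto simp: circle_param_def o_def)
  moreover have "circle_increasing (inv_into (sphere 0 1) c \<circ> ?c)"
    unfolding circle_increasing_def
  proof (intro exI conjI allI)
    show "continuous_on UNIV (\<lambda>t::real. s + t)" by (intro continuous_intros)
    show "strict_mono (\<lambda>t::real. s + t)" by (simp add: strict_mono_def)
    show "(inv_into (sphere 0 1) c \<circ> ?c) (cis (2 * pi * t)) = cis (2 * pi * (s + t))" for t
      using inv_into_f_f[OF circle_orientation_inj(1)[OF C], of "cis (2 * pi * (s + t))"]
      by (simp add: cis_mult ring_distribs)
  qed
  ultimately show ?thesis using circle_orientation_iff[OF C] by blast
qed

lemma algebraic_length_reparam:
  assumes G: "strict_mono G" "continuous_on UNIV G" and eq: "\<And>t. c2 (cis (2 * pi * t)) = c (cis (2 * pi * G t))"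
  shows "algebraic_length d c2 s t = algebraic_length d c (G s) (G t)"
proof -
  have lt: "G r < G r' \<longleftrightarrow> r < r'" for r r' by (rule strict_mono_less[OF G(1)])
  have "sgn (G t - G s) = sgn (t - s)"
    using lt[of s t] lt[of t s] by (cases s t rule: linorder_cases) simp_all
  moreover have "min (G s) (G t) = G (min s t)" "max (G s) (G t) = G (max s t)"
    using lt[of s t] lt[of t s] by (auto simp: min_def max_def not_le not_less)
  ultimately show ?thesis
    unfolding algebraic_length_def eq
    by (subst curve_length_reparam[OF G, of "min s t" "max s t"  d "\<lambda>r. c (cis (2 * pi * r))"]) auto
qed

lemma algebraic_length_shift:
  assumes "k \<in> \<int>"
  shows "algebraic_length d c (s + k) (t + k) = algebraic_length d c s t"
proof -
  have "cis (2 * pi * r) = cis (2 * pi * (r + k))" for r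
    using assms by (subst cis_2pi_eq_iff) simp
  then show ?thesis
    using algebraic_length_reparam[of "\<lambda>t. t + k" c c d s t]
    by (simp add: strict_mono_def continuous_intros)
qed

locale unit_circle =
  fixes F :: "'e::topological_space set" and C and d
  assumes orient: "circle_orientation F C"
    and metric: "Metric_space UNIV d"
    and unit_length: "\<And>c. c \<in> C \<Longrightarrow> curve_length d (\<lambda>t. c (cis (2 * pi * t))) 0 1 = 1"
begin

lemma curve_length_period:
  assumes c: "c \<in> C" shows "curve_length d (\<lambda>t. c (cis (2 * pi * t))) s (s + 1) = 1"
proof -
  have "curve_length d (\<lambda>t. c (cis (2 * pi * (s + t)))) 0 1 = curve_length d (\<lambda>t. c (cis (2 * pi * t))) (s + 0) (s + 1)"
    by (rule curve_length_reparam[where G = "\<lambda>t. s + t"]) (auto simp: strict_mono_def intro!: continuous_intros)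
  moreover have "curve_length d (\<lambda>t. c (cis (2 * pi * (s + t)))) 0 1 = 1"
    using unit_length[OF circle_orientation_rotate[OF orient c, of s]] by (simp add: cis_mult ring_distribs)
  ultimately show ?thesis by simp
qed

lemma algebraic_length_bounds:
  assumes c: "c \<in> C" shows "\<bar>algebraic_length d c s t - (t - s)\<bar> \<le> 1"
  using curve_length_unit_bounds[OF metric curve_length_period[OF c], of s t]
    curve_length_unit_bounds[OF metric curve_length_period[OF c], of t s]
  by (cases s t rule: linorder_cases) (auto simp: algebraic_length_def)

text \<open>This is what justifies the \<open>THE\<close> in the definition. Lifts for two
  parametrisations are related by the transition map \<open>G\<close> up to an integer, which is
  constant by continuity; algebraic length is invariant both under \<open>G\<close> and under
  integer translations.\<close>

lemma circle_winding_eq: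
  assumes ab: "a \<le> b" and c: "c \<in> C" and g: "continuous_on {a..b} g"
    and lift: "\<And>t. t \<in> {a..b} \<Longrightarrow> \<gamma> t = c (cis (2 * pi * g t))"
  shows "circle_winding d C a b \<gamma> = algebraic_length d c (g a) (g b)"
  unfolding circle_winding_def
proof (rule the_equality, goal_cases)
  case 1
  show ?case using c g lift by blast
next
  case (2 w)
  then have "\<exists>c\<in>C. \<exists>\<gamma>'. continuous_on {a..b} \<gamma>' \<and> (\<forall>t\<in>{a..b}. \<gamma> t = c (cis (2 * pi * \<gamma>' t))) \<and>
      w = algebraic_length d c (\<gamma>' a) (\<gamma>' b)"
    by blast
  then obtain c2 g2 where c2: "c2 \<in> C" and g2: "continuous_on {a..b} g2"
    and lift2: "\<And>t. t \<in> {a..b} \<Longrightarrow> \<gamma> t = c2 (cis (2 * pi * g2 t))"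
    and w: "w = algebraic_length d c2 (g2 a) (g2 b)" by blast
  obtain G where G: "continuous_on UNIV G" "strict_mono G" "\<And>t. c2 (cis (2 * pi * t)) = c (cis (2 * pi * G t))"
    using circle_orientation_transition[OF orient c c2] by blast
  have ints: "G (g2 t) - g t \<in> \<int>" if "t \<in> {a..b}" for t
    using lift[OF that] lift2[OF that] circle_orientation_cover_eq_iff[OF orient c] by (simp add: G(3))
  have "G (g2 b) - g b = G (g2 a) - g a"
  proof (rule Ints_valued_constant[where g = "\<lambda>t. G (g2 t) - g t"])
    show "continuous_on {a..b} (\<lambda>t. G (g2 t) - g t)"
      by (intro continuous_on_diff g continuous_on_compose2[OF G(1) g2]) auto
  qed (use ab ints in auto)
  then have b: "G (g2 b) = g b + (G (g2 a) - g a)" by simp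
  have "w = algebraic_length d c (G (g2 a)) (G (g2 b))"
    unfolding w by (intro algebraic_length_reparam[where G = G] G)
  also have "\<dots> = algebraic_length d c (g a + (G (g2 a) - g a)) (g b + (G (g2 a) - g a))"
    by (subst b) simp
  also have "\<dots> = algebraic_length d c (g a) (g b)"
    using ints[of a] ab by (intro algebraic_length_shift) auto
  finally show ?case .
qed

lemma circle_winding_bounds:
  assumes "a \<le> b" "c \<in> C" "continuous_on {a..b} g" "\<And>t. t \<in> {a..b} \<Longrightarrow> \<gamma> t = c (cis (2 * pi * g t))"
  shows "\<bar>circle_winding d C a b \<gamma> - (g b - g a)\<bar> \<le> 1"
  using circle_winding_eq[OF assms] algebraic_length_bounds[OF assms(2)] by simp

lemma lift_exists:
  fixes f :: "'b::real_normed_vector \<Rightarrow> 'e"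
  assumes c: "c \<in> C" and f: "continuous_on S f" "f ` S \<subseteq> F" and S: "convex S"
  obtains g where "continuous_on S g" "\<And>x. x \<in> S \<Longrightarrow> f x = c (cis (2 * pi * g x))"
proof -
  obtain c' where c': "homeomorphism (sphere 0 1) F c c'"
    by (rule circle_orientation_homeomorphism[OF orient c])
  have "continuous_on S (\<lambda>x. c' (f x))"
    using c' f by (auto simp: homeomorphism_def intro: continuous_on_compose2)
  moreover have "(\<lambda>x. c' (f x)) ` S \<subseteq> sphere 0 1"
    using c' f(2) by (auto simp: homeomorphism_def)
  ultimately obtain g where g: "continuous_on S g" "\<And>x. x \<in> S \<Longrightarrow> c' (f x) = cis (2 * pi * g x)"
    using lift_to_line[of S "\<lambda>x. c' (f x)"] S by blast
  have "f x = c (cis (2 * pi * g x))" if "x \<in> S" for x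
    using g(2)[OF that] c' f(2) that by (metis homeomorphism_apply2 image_subset_iff)
  then show ?thesis using g that by blast
qed

end

section \<open>Almost additive sequences\<close>

lemma continuous_on_funpow:
  fixes T :: "'a::topological_space \<Rightarrow> 'a"
  assumes "continuous_on UNIV T" shows "continuous_on UNIV (T ^^ n)"
  by (induction n) (auto intro: continuous_on_compose2[OF assms] continuous_intros simp: o_def id_def)

lemma compact_UNIV_bounded:
  fixes f :: "'a::topological_space \<Rightarrow> real"
  assumes "compact (UNIV :: 'a set)" "continuous_on UNIV f"
  obtains K where "\<And>x. \<bar>f x\<bar> \<le> K"
proof -
  have "bounded (range f)"
    by (intro compact_imp_bounded compact_continuous_image assms)
  then show ?thesis using that by (auto simp: bounded_iff)
qed

lemma LIMSEQ_div_if_bounded_diff: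
  fixes u v :: "nat \<Rightarrow> real"
  assumes "\<And>n. n \<ge> N \<Longrightarrow> \<bar>u n - v n\<bar> \<le> K" and "(\<lambda>n. v n / real n) \<longlonglongrightarrow> r"
  shows "(\<lambda>n. u n / real n) \<longlonglongrightarrow> r"
proof -
  have "(\<lambda>n. (u n - v n) / real n) \<longlonglongrightarrow> 0"
  proof (rule Lim_null_comparison[OF _ lim_const_over_n[of K]])
    show "\<forall>\<^sub>F n in sequentially. norm ((u n - v n) / real n) \<le> K / real n"
      using eventually_ge_at_top[of N] by eventually_elim (use assms(1) in \<open>auto intro: divide_right_mono\<close>)
  qed
  from tendsto_add[OF this assms(2)] show ?thesis by (simp add: diff_divide_distrib)
qed

locale almost_additive =
  fixes T :: "'x::metric_space \<Rightarrow> 'x" and a :: "nat \<Rightarrow> 'x \<Rightarrow> real" and C :: real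
  assumes compact: "compact (UNIV :: 'x set)"
    and continuous_T: "continuous_on UNIV T"
    and continuous_a: "continuous_on UNIV (a n)"
    and almost: "\<bar>a (n + m) x - a n x - a m ((T ^^ n) x)\<bar> \<le> C"
begin

lemma C_nonneg: "C \<ge> 0"
  using almost[of 0 0 undefined] by linarith

lemma a_bounded: obtains K where "\<And>x. \<bar>a n x\<bar> \<le> K"
  using compact_UNIV_bounded[OF compact continuous_a] by blast

lemma a_linear_growth: obtains K where "K \<ge> 0" "\<And>n x. \<bar>a n x / real n\<bar> \<le> K"
proof -
  obtain K1 where K1: "\<And>x. \<bar>a 1 x\<bar> \<le> K1" using a_bounded by blast
  have K1_0: "0 \<le> K1" using K1[of undefined] by linarith
  have *: "\<bar>a n x\<bar> \<le> real n * (K1 + C) + C" for n x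
  proof (induction n)
    case 0 show ?case using almost[of 0 0 x] by simp
  next
    case (Suc n)
    have "\<bar>a (Suc n) x\<bar> \<le> \<bar>a n x\<bar> + \<bar>a 1 ((T ^^ n) x)\<bar> + C"
      using almost[of n 1 x] by simp
    then show ?case using Suc K1[of "(T ^^ n) x"] by (simp add: algebra_simps)
  qed
  have "\<bar>a n x / real n\<bar> \<le> K1 + 2 * C" for n x
  proof (cases "n = 0")
    case True then show ?thesis using K1_0 C_nonneg by simp
  next
    case False
    then have "C \<le> real n * C" using C_nonneg by (simp add: mult_le_cancel_right1)
    then have "\<bar>a n x\<bar> \<le> real n * (K1 + 2 * C)" using *[of n x] by (simp add: algebra_simps)
    then show ?thesis using False by (simp add: field_simps)
  qed
  then show ?thesis using that[of "K1 + 2 * C"] K1_0 C_nonneg by simp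
qed

text \<open>Splitting \<open>Suc n\<close> both as \<open>1 + n\<close> and as \<open>n + 1\<close>
  bounds \<open>a n (T x) - a n x\<close> independently of \<open>n\<close>.\<close>

lemma LIMSEQ_T_iff: "(\<lambda>n. a n (T x) / real n) \<longlonglongrightarrow> r \<longleftrightarrow> (\<lambda>n. a n x / real n) \<longlonglongrightarrow> r"
proof -
  obtain K where K: "\<And>x. \<bar>a 1 x\<bar> \<le> K" using a_bounded by blast
  have "\<bar>a n (T x) - a n x\<bar> \<le> 2 * C + 2 * K" for n
  proof -
    have "\<bar>a (Suc n) x - a 1 x - a n (T x)\<bar> \<le> C" using almost[of 1 n x] by simp
    moreover have "\<bar>a (Suc n) x - a n x - a 1 ((T ^^ n) x)\<bar> \<le> C" using almost[of n 1 x] by simp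
    ultimately show ?thesis using K[of x] K[of "(T ^^ n) x"] by linarith
  qed
  then have "\<bar>a n (T x) - a n x\<bar> \<le> 2 * C + 2 * K" "\<bar>a n x - a n (T x)\<bar> \<le> 2 * C + 2 * K" for n
    by (simp_all add: abs_minus_commute)
  then show ?thesis
    using LIMSEQ_div_if_bounded_diff[of 0 "\<lambda>n. a n (T x)" "\<lambda>n. a n x"]
      LIMSEQ_div_if_bounded_diff[of 0 "\<lambda>n. a n x" "\<lambda>n. a n (T x)"] by blast
qed

text \<open>Up to \<open>C\<close>, the term \<open>a k ((T ^^ i) x)\<close> is
  \<open>a (i + k) x - a i x\<close>. These differences telescope with stride \<open>k\<close>,
  leaving \<open>k\<close> terms \<open>a (n + i) x - a i x\<close>, each of which is
  \<open>a n x\<close> up to a constant not depending on \<open>n\<close> and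
  \<open>x\<close>.\<close>

lemma birkhoff_sum_approx:
  obtains B where "\<And>n x. \<bar>(\<Sum>i<n. a k ((T ^^ i) x)) - real k * a n x\<bar> \<le> real n * C + B"
proof -
  have "\<exists>K. \<forall>i. \<forall>x. \<bar>a i x\<bar> \<le> K i" by (metis a_bounded)
  then obtain K where K: "\<And>i x. \<bar>a i x\<bar> \<le> K i" by blast
  have "\<bar>(\<Sum>i<n. a k ((T ^^ i) x)) - real k * a n x\<bar> \<le> real n * C + (\<Sum>i<k. C + 2 * K i)" for n x
  proof -
    have "(\<Sum>i<n. a i x) + (\<Sum>i<k. a (n + i) x) = (\<Sum>i<n. a (i + k) x) + (\<Sum>i<k. a i x)"
      using sum_lessThan_add[of "\<lambda>i. a i x" n k] sum_lessThan_add[of "\<lambda>i. a i x" k n]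
      by (simp add: add.commute)
    then have tele: "(\<Sum>i<n. a (i + k) x - a i x) = (\<Sum>i<k. a (n + i) x - a i x)"
      by (simp add: sum_subtractf)
    have 1: "\<bar>(\<Sum>i<n. a k ((T ^^ i) x)) - (\<Sum>i<n. a (i + k) x - a i x)\<bar> \<le> real n * C"
    proof -
      have "\<bar>\<Sum>i<n. a k ((T ^^ i) x) - (a (i + k) x - a i x)\<bar> \<le> (\<Sum>i<n. C)"
      proof (rule order_trans[OF sum_abs], rule sum_mono)
        fix i show "\<bar>a k ((T ^^ i) x) - (a (i + k) x - a i x)\<bar> \<le> C"
          using almost[of i k x] by linarith
      qed
      then show ?thesis by (simp add: sum_subtractf)
    qed
    have 2: "\<bar>(\<Sum>i<k. a (n + i) x - a i x) - real k * a n x\<bar> \<le> (\<Sum>i<k. C + 2 * K i)"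
    proof -
      have "\<bar>\<Sum>i<k. (a (n + i) x - a i x) - a n x\<bar> \<le> (\<Sum>i<k. C + 2 * K i)"
      proof (rule order_trans[OF sum_abs], rule sum_mono)
        fix i show "\<bar>a (n + i) x - a i x - a n x\<bar> \<le> C + 2 * K i"
          using almost[of n i x] K[of i x] K[of i "(T ^^ n) x"] by linarith
      qed
      then show ?thesis by (simp add: sum_subtractf)
    qed
    show ?thesis using 1 2 unfolding tele by linarith
  qed
  then show ?thesis using that by blast
qed

text \<open>The Birkhoff averages of \<open>a k / k\<close> differ from \<open>a n / n\<close> by \<open>C / k\<close> asymptotically, so if all of
  them converge then \<open>a n / n\<close> is Cauchy.\<close>

lemma convergent_if_birkhoff:
  assumes "\<And>k. convergent (\<lambda>n. (\<Sum>i<n. a k ((T ^^ i) x)) / real n)"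
  shows "convergent (\<lambda>n. a n x / real n)"
proof (rule Cauchy_convergent, rule CauchyI)
  fix e :: real assume e: "0 < e"
  \<comment> \<open>The budget: \<open>C / k\<close> and \<open>B / (k n)\<close> take
    \<open>e / 8\<close> each, so replacing \<open>a n x / n\<close> by \<open>S n / k\<close> costs
    \<open>e / 4\<close> at both ends, and the Cauchy property of \<open>S\<close> takes another
    \<open>e / 4\<close>. The successor in \<open>k\<close> only ensures positivity.\<close>
  obtain k0 :: nat where k0: "8 * C / e < real k0" using reals_Archimedean2 by blast
  define k where "k = Suc k0"
  have k: "real k > 0" "C / real k < e / 8"
  proof -
    have "8 * C / e < real k" using k0 by (simp add: k_def)
    then show "C / real k < e / 8" using e by (simp add: field_simps k_def)
  qed (simp add: k_def)
  obtain B where B: "\<And>n x. \<bar>(\<Sum>i<n. a k ((T ^^ i) x)) - real k * a n x\<bar> \<le> real n * C + B"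
    using birkhoff_sum_approx by blast
  define S where "S n = (\<Sum>i<n. a k ((T ^^ i) x)) / real n" for n
  have "Cauchy S" unfolding S_def by (rule convergent_Cauchy[OF assms])
  moreover have "0 < real k * e / 4" using k e by simp
  ultimately obtain N1 where N1: "\<And>m n. m \<ge> N1 \<Longrightarrow> n \<ge> N1 \<Longrightarrow> norm (S m - S n) < real k * e / 4"
    by (meson CauchyD)
  have "(\<lambda>n. B / real k / real n) \<longlonglongrightarrow> 0" by (rule lim_const_over_n)
  then have "\<forall>\<^sub>F n in sequentially. B / real k / real n < e / 8"
    using e by (intro order_tendstoD) auto
  then obtain N2 where N2: "\<And>n. n \<ge> N2 \<Longrightarrow> B / real k / real n < e / 8"
    unfolding eventually_sequentially by blast
  have approx: "\<bar>S n / real k - a n x / real n\<bar> < e / 4" if n: "n \<ge> N2" "n \<ge> 1" for n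
  proof -
    have "S n / real k - a n x / real n = ((\<Sum>i<n. a k ((T ^^ i) x)) - real k * a n x) / (real k * real n)"
      using n k by (simp add: S_def field_simps)
    also have "\<bar>\<dots>\<bar> \<le> (real n * C + B) / (real k * real n)"
      using B[of x n] k n by (simp add: divide_right_mono)
    also have "\<dots> = C / real k + B / real k / real n"
      using n k by (simp add: field_simps)
    also have "\<dots> < e / 4" using k(2) N2[OF n(1)] by linarith
    finally show ?thesis .
  qed
  show "\<exists>M. \<forall>m\<ge>M. \<forall>n\<ge>M. norm (a m x / real m - a n x / real n) < e"
  proof (intro exI allI impI)
    fix m n assume mn: "max (max N1 N2) 1 \<le> m" "max (max N1 N2) 1 \<le> n"
    have "\<bar>S m - S n\<bar> < real k * e / 4" using N1[of m n] mn by simp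
    then have "\<bar>S m - S n\<bar> / real k < (real k * e / 4) / real k"
      using k(1) by (rule divide_strict_right_mono)
    then have "\<bar>S m / real k - S n / real k\<bar> < e / 4"
      using k(1) by (simp add: diff_divide_distrib[symmetric])
    moreover have "\<bar>S m / real k - a m x / real m\<bar> < e / 4" "\<bar>S n / real k - a n x / real n\<bar> < e / 4"
      using mn approx[of m] approx[of n] by simp_all
    ultimately show "norm (a m x / real m - a n x / real n) < e" unfolding real_norm_def by linarith
  qed
qed

text \<open>The functions \<open>a (2 ^ j) / 2 ^ j\<close> for consecutive \<open>j\<close> differ by a coboundary and the small error
  \<open>doubling_defect j\<close>. Adding up these errors yields a single continuous function \<open>potential 0\<close>
  whose integrals are the limits of those of \<open>a n / n\<close>.\<close>

definition doubling_defect :: "nat \<Rightarrow> 'x \<Rightarrow> real" where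
  "doubling_defect j x = (a (2 ^ j + 2 ^ j) x - a (2 ^ j) x - a (2 ^ j) ((T ^^ (2 ^ j)) x)) / 2 ^ Suc j"

definition defect_tail :: "nat \<Rightarrow> 'x \<Rightarrow> real" where
  "defect_tail j x = (\<Sum>i. doubling_defect (i + j) x)"

definition potential :: "nat \<Rightarrow> 'x \<Rightarrow> real" where
  "potential j x = a (2 ^ j) x / 2 ^ j + defect_tail j x"

lemma doubling_defect_bound: "\<bar>doubling_defect j x\<bar> \<le> C / 2 ^ Suc j"
  unfolding doubling_defect_def using almost[of "2 ^ j" "2 ^ j" x] by (simp add: divide_right_mono)

lemma defect_majorant_sums: "(\<lambda>i. C / 2 ^ Suc (i + j)) sums (C / 2 ^ j)"
proof -
  have "(\<lambda>i. (C / 2 ^ j) * (1 / 2) ^ Suc i) sums ((C / 2 ^ j) * 1)"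
    by (intro sums_mult power_half_series)
  then show ?thesis by (simp add: power_add power_one_over field_simps)
qed

lemma defect_summable: "summable (\<lambda>i. doubling_defect (i + j) x)"
  by (rule summable_comparison_test'[OF sums_summable[OF defect_majorant_sums[of j]], of 0])
    (use doubling_defect_bound in \<open>simp del: power_Suc\<close>)

lemma defect_tail_bound: "\<bar>defect_tail j x\<bar> \<le> C / 2 ^ j"
proof -
  have "summable (\<lambda>i. \<bar>doubling_defect (i + j) x\<bar>)"
    by (rule summable_comparison_test'[OF sums_summable[OF defect_majorant_sums[of j]], of 0])
      (use doubling_defect_bound in \<open>simp del: power_Suc\<close>)
  then have "\<bar>defect_tail j x\<bar> \<le> (\<Sum>i. \<bar>doubling_defect (i + j) x\<bar>)"
    unfolding defect_tail_def by (rule summable_rabs)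
  also have "\<dots> \<le> (\<Sum>i. C / 2 ^ Suc (i + j))"
    using doubling_defect_bound
    by (intro suminf_le \<open>summable (\<lambda>i. \<bar>doubling_defect (i + j) x\<bar>)\<close> sums_summable[OF defect_majorant_sums[of j]])
  also have "\<dots> = C / 2 ^ j" using defect_majorant_sums[of j] by (rule sums_unique[symmetric])
  finally show ?thesis .
qed

lemma continuous_comp_funpow:
  assumes "continuous_on UNIV f" shows "continuous_on UNIV (\<lambda>x. f ((T ^^ n) x))"
  by (rule continuous_on_compose2[OF assms continuous_on_funpow[OF continuous_T]]) auto

lemma continuous_defect: "continuous_on UNIV (doubling_defect j)"
  unfolding doubling_defect_def by (intro continuous_intros continuous_a continuous_comp_funpow) auto

lemma continuous_defect_tail: "continuous_on UNIV (defect_tail j)"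
proof (rule uniform_limit_theorem)
  show "uniform_limit UNIV (\<lambda>n x. \<Sum>i<n. doubling_defect (i + j) x) (defect_tail j) sequentially"
    unfolding defect_tail_def
    by (rule Weierstrass_m_test[OF _ sums_summable[OF defect_majorant_sums[of j]]])
      (use doubling_defect_bound in \<open>simp del: power_Suc\<close>)
  show "\<forall>\<^sub>F n in sequentially. continuous_on UNIV (\<lambda>x. \<Sum>i<n. doubling_defect (i + j) x)"
    by (intro always_eventually allI continuous_intros continuous_defect)
qed simp

lemma continuous_potential: "continuous_on UNIV (potential j)"
  unfolding potential_def by (intro continuous_intros continuous_a continuous_defect_tail) auto

text \<open>The head of the tail series is exactly the almost-additivity error of the doubling from
  \<open>2 ^ j\<close> to \<open>2 ^ Suc j\<close>. What survives is a coboundary of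
  \<open>T ^^ (2 ^ j)\<close>, invisible to invariant measures.\<close>

lemma potential_Suc:
  "potential j x - potential (Suc j) x = (a (2 ^ j) x - a (2 ^ j) ((T ^^ (2 ^ j)) x)) / 2 ^ Suc j"
proof -
  have "defect_tail j x = doubling_defect j x + defect_tail (Suc j) x"
    unfolding defect_tail_def using suminf_split_head[OF defect_summable[of j x]] by simp
  moreover have "(2 :: nat) ^ Suc j = 2 ^ j + 2 ^ j" by simp
  moreover have "u / p + (w - u - v) / (2 * p) - w / (2 * p) = (u - v) / (2 * p)" if "p \<noteq> 0" for u v w p :: real
    using that by (simp add: field_simps)
  from this[of "2 ^ j" "a (2 ^ j) x" "a (2 ^ j + 2 ^ j) x" "a (2 ^ j) ((T ^^ (2 ^ j)) x)"]
  have "a (2 ^ j) x / 2 ^ j + doubling_defect j x - a (2 ^ j + 2 ^ j) x / 2 ^ Suc j =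
      (a (2 ^ j) x - a (2 ^ j) ((T ^^ (2 ^ j)) x)) / 2 ^ Suc j"
    by (simp add: doubling_defect_def)
  ultimately show ?thesis
    unfolding potential_def by (metis (no_types, lifting) add.assoc add_diff_cancel_right)
qed

end

section \<open>Integrating the limit of an almost additive sequence\<close>

locale almost_additive_measure = almost_additive T a C + finite_measure_preserving M T
  for T :: "'x::metric_space \<Rightarrow> 'x" and a C and M :: "'x measure" +
  assumes sets_M [simp, measurable_cong]: "sets M = sets borel"
begin

lemma continuous_integrable:
  assumes "continuous_on UNIV f" shows "integrable M (f :: _ \<Rightarrow> real)"
proof -
  have "f \<in> borel_measurable M" using borel_measurable_continuous_onI[OF assms] by simp
  moreover obtain K where "\<And>x. \<bar>f x\<bar> \<le> K" using compact_UNIV_bounded[OF compact assms] by blast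
  ultimately show ?thesis by (intro integrable_bounded)
qed

lemma AE_convergent: "AE x in M. convergent (\<lambda>n. a n x / real n)"
proof -
  have "AE x in M. \<forall>k. convergent (\<lambda>n. (\<Sum>i<n. a k ((T ^^ i) x)) / real n)"
    unfolding AE_all_countable
  proof
    fix k
    obtain K where K: "\<And>x. \<bar>a k x\<bar> \<le> K" using a_bounded by blast
    have "a k \<in> borel_measurable M" using borel_measurable_continuous_onI[OF continuous_a] by simp
    then show "AE x in M. convergent (\<lambda>n. (\<Sum>i<n. a k ((T ^^ i) x)) / real n)"
      using K by (rule birkhoff_convergent)
  qed
  then show ?thesis by eventually_elim (blast intro: convergent_if_birkhoff)
qed

lemma integral_potential: "(\<integral>x. potential j x \<partial>M) = (\<integral>x. potential 0 x \<partial>M)"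
proof (induction j)
  case (Suc j)
  have "(\<integral>x. potential j x \<partial>M) - (\<integral>x. potential (Suc j) x \<partial>M) = (\<integral>x. potential j x - potential (Suc j) x \<partial>M)"
    by (intro Bochner_Integration.integral_diff[symmetric] continuous_integrable continuous_potential)
  also have "\<dots> = ((\<integral>x. a (2 ^ j) x \<partial>M) - (\<integral>x. a (2 ^ j) ((T ^^ (2 ^ j)) x) \<partial>M)) / 2 ^ Suc j"
    unfolding potential_Suc
    by (subst Bochner_Integration.integral_diff[symmetric])
      (auto intro!: continuous_integrable continuous_a continuous_comp_funpow)
  also have "\<dots> = 0"
    using integral_comp_funpow[of "a (2 ^ j)" "2 ^ j"] borel_measurable_continuous_onI[OF continuous_a]
    by simp
  finally show ?case using Suc by simp
qed simp

text \<open>The integrals of \<open>a n / n\<close> along \<open>n = 2 ^ j\<close> have two limits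
  to compare: dominated convergence gives the integral of \<open>f\<close>, and
  \<open>potential j\<close> is within \<open>C / 2 ^ j\<close> of \<open>a (2 ^ j) / 2 ^ j\<close>
  while its integral is the same for all \<open>j\<close>.\<close>

lemma integral_limit:
  assumes f: "f \<in> borel_measurable M" and lim: "AE x in M. (\<lambda>n. a n x / real n) \<longlonglongrightarrow> f x"
  shows "(\<integral>x. f x \<partial>M) = (\<integral>x. potential 0 x \<partial>M)"
proof (rule LIMSEQ_unique)
  obtain K where K: "K \<ge> 0" "\<And>n x. \<bar>a n x / real n\<bar> \<le> K" using a_linear_growth by blast
  have meas: "a n \<in> borel_measurable M" for n using borel_measurable_continuous_onI[OF continuous_a] by simp
  have "(\<lambda>n. \<integral>x. a n x / real n \<partial>M) \<longlonglongrightarrow> (\<integral>x. f x \<partial>M)"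
    using K(2) by (intro integral_dominated_convergence[where w = "\<lambda>_. K"] f lim)
      (auto intro: borel_measurable_divide meas)
  moreover have "filterlim (\<lambda>j. 2 ^ j :: nat) at_top sequentially"
    by (rule filterlim_subseq) (simp add: strict_mono_def)
  ultimately have "(\<lambda>j. \<integral>x. a (2 ^ j) x / real (2 ^ j) \<partial>M) \<longlonglongrightarrow> (\<integral>x. f x \<partial>M)"
    by (rule filterlim_compose)
  then show "(\<lambda>j. \<integral>x. a (2 ^ j) x / 2 ^ j \<partial>M) \<longlonglongrightarrow> (\<integral>x. f x \<partial>M)" by simp
  have "(\<lambda>j. (\<integral>x. a (2 ^ j) x / 2 ^ j \<partial>M) - (\<integral>x. potential 0 x \<partial>M)) \<longlonglongrightarrow> 0"
  proof (rule Lim_null_comparison)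
    have "(\<lambda>j. measure M (space M) * C * (1 / 2) ^ j) \<longlonglongrightarrow> measure M (space M) * C * 0"
      by (intro tendsto_mult tendsto_const LIMSEQ_power_zero) auto
    then show "(\<lambda>j. measure M (space M) * (C / 2 ^ j)) \<longlonglongrightarrow> 0"
      by (simp add: power_one_over field_simps)
    show "\<forall>\<^sub>F j in sequentially. norm ((\<integral>x. a (2 ^ j) x / 2 ^ j \<partial>M) - (\<integral>x. potential 0 x \<partial>M))
        \<le> measure M (space M) * (C / 2 ^ j)"
    proof (rule always_eventually, rule allI)
      fix j
      have "(\<integral>x. a (2 ^ j) x / 2 ^ j \<partial>M) - (\<integral>x. potential 0 x \<partial>M) = (\<integral>x. a (2 ^ j) x / 2 ^ j - potential j x \<partial>M)"
        unfolding integral_potential[of j, symmetric]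
        by (intro Bochner_Integration.integral_diff[symmetric] continuous_integrable continuous_potential continuous_intros continuous_a) auto
      also have "norm \<dots> \<le> (\<integral>x. C / 2 ^ j \<partial>M)"
      proof (rule order_trans[OF integral_norm_bound integral_mono])
        show "integrable M (\<lambda>x. norm (a (2 ^ j) x / 2 ^ j - potential j x))"
          by (intro continuous_integrable continuous_potential continuous_intros continuous_a) auto
        show "norm (a (2 ^ j) x / 2 ^ j - potential j x) \<le> C / 2 ^ j" for x
          using defect_tail_bound[of j x] by (simp add: potential_def)
      qed auto
      finally show "norm ((\<integral>x. a (2 ^ j) x / 2 ^ j \<partial>M) - (\<integral>x. potential 0 x \<partial>M)) \<le> measure M (space M) * (C / 2 ^ j)"
        by simp
    qed
  qed
  from tendsto_add[OF this tendsto_const[of "\<integral>x. potential 0 x \<partial>M"]]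
  show "(\<lambda>j. \<integral>x. a (2 ^ j) x / 2 ^ j \<partial>M) \<longlonglongrightarrow> (\<integral>x. potential 0 x \<partial>M)" by simp
qed

end

section \<open>Winding numbers of iterated paths of skew products\<close>

text \<open>Uniform continuity at the points of a compact \<open>K\<close>, with the second point
  free to leave \<open>K\<close> inside the possibly non-compact \<open>W\<close>; this is what
  comparing a perturbed orbit with a reference orbit requires. The radius is a Lebesgue
  number.\<close>

lemma continuous_near_compact:
  fixes q :: "'a::metric_space \<Rightarrow> 'b::metric_space"
  assumes q: "continuous_on W q" and K: "compact K" "K \<subseteq> W" and e: "e > 0"
  obtains \<delta> where "\<delta> > 0" "\<And>k v. k \<in> K \<Longrightarrow> v \<in> W \<Longrightarrow> dist v k < \<delta> \<Longrightarrow> dist (q v) (q k) < e"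
proof -
  let ?G = "{B. open B \<and> (\<forall>v\<in>B \<inter> W. \<forall>w\<in>B \<inter> W. dist (q v) (q w) < e)}"
  have "K \<subseteq> \<Union>?G"
  proof
    fix k assume k: "k \<in> K"
    have "\<exists>r>0. \<forall>v\<in>W. dist v k < r \<longrightarrow> dist (q v) (q k) < e / 2"
      using q[unfolded continuous_on_iff] e K(2) k half_gt_zero by blast
    then obtain r where r: "r > 0" "\<And>v. v \<in> W \<Longrightarrow> dist v k < r \<Longrightarrow> dist (q v) (q k) < e / 2"
      by blast
    have "dist (q v) (q w) < e" if "v \<in> ball k r \<inter> W" "w \<in> ball k r \<inter> W" for v w
      using r(2)[of v] r(2)[of w] that
      by (intro dist_triangle_half_l[of "q v" "q k" e "q w"]) (auto simp: dist_commute)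
    then show "k \<in> \<Union>?G" using r(1) by (intro UnionI[of "ball k r"]) auto
  qed
  moreover have "open B" if "B \<in> ?G" for B using that by blast
  ultimately obtain \<delta> where \<delta>: "\<delta> > 0" "\<forall>k\<in>K. \<exists>B\<in>?G. ball k \<delta> \<subseteq> B"
    by (metis (lifting) Heine_Borel_lemma[OF K(1)])
  have "dist (q v) (q k) < e" if k: "k \<in> K" and v: "v \<in> W" "dist v k < \<delta>" for k v
  proof -
    obtain B where B: "B \<in> ?G" "ball k \<delta> \<subseteq> B" using \<delta> k by blast
    have "v \<in> B \<inter> W" "k \<in> B \<inter> W" using B(2) \<delta>(1) k v K(2) by (auto simp: dist_commute)
    then show ?thesis using B(1) by blast
  qed
  then show ?thesis using \<delta>(1) that by blast
qed

locale circle_bundle_dynamics =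
  fixes T :: "'x::metric_space \<Rightarrow> 'x"
    and p :: "'e::metric_space \<Rightarrow> 'x"
    and ori :: "'x \<Rightarrow> (complex \<Rightarrow> 'e) set"
    and d :: "'e \<Rightarrow> 'e \<Rightarrow> real"
    and a b :: real
  assumes compact_base: "compact (UNIV :: 'x set)"
    and continuous_T: "continuous_on UNIV T"
    and circle_bundle: "oriented_circle_bundle p ori"
    and unit_metric: "unit_length_metric p ori d"
    and a_le_b: "a \<le> b"
begin

abbreviation P where "P \<equiv> skew_paths p ori T a b"

lemma unit_circle_fibre: "unit_circle (p -` {x}) (ori x) d"
  using circle_bundle unit_metric
  by (intro unit_circle.intro) (simp_all add: oriented_circle_bundle_def unit_length_metric_def)

lemma ori_nonempty: "\<exists>c. c \<in> ori x"
  using unit_circle.orient[OF unit_circle_fibre] circle_orientation_nonempty by blast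

lemma ori_in_fibre: "c \<in> ori x \<Longrightarrow> norm z = 1 \<Longrightarrow> p (c z) = x"
  using circle_orientation_inj(2)[OF unit_circle.orient[OF unit_circle_fibre], of c x] by auto

lemma fibre_nonempty: "\<exists>u. p u = x"
  using ori_nonempty ori_in_fibre norm_one by blast

lemma skew_map_funpow_fibre:
  assumes "f \<in> skew_maps p ori T" shows "p ((f ^^ n) u) = (T ^^ n) (p u)"
  using assms by (induction n) (simp_all add: skew_maps_def)

lemma skew_map_funpow_ori:
  assumes f: "f \<in> skew_maps p ori T" and c: "c \<in> ori x" shows "(f ^^ n) \<circ> c \<in> ori ((T ^^ n) x)"
proof (induction n)
  case (Suc n)
  then have "f \<circ> ((f ^^ n) \<circ> c) \<in> ori (T ((T ^^ n) x))" using f unfolding skew_maps_def by blast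
  then show ?case by (simp add: comp_def)
qed (use c in simp)

lemma skew_map_funpow_inj:
  assumes f: "f \<in> skew_maps p ori T" and uv: "p u = p v" and eq: "(f ^^ n) u = (f ^^ n) v"
  shows "u = v"
  using eq
proof (induction n)
  case (Suc n)
  obtain g where g: "homeomorphism (p -` {p ((f ^^ n) u)}) (p -` {T (p ((f ^^ n) u))}) f g"
    using f unfolding skew_maps_def by blast
  have "p ((f ^^ n) v) = p ((f ^^ n) u)" using skew_map_funpow_fibre[OF f] uv by simp
  then have "g (f ((f ^^ n) u)) = (f ^^ n) u" "g (f ((f ^^ n) v)) = (f ^^ n) v"
    by (auto intro!: homeomorphism_apply1[OF g])
  moreover have "f ((f ^^ n) u) = f ((f ^^ n) v)" using Suc.prems by simp
  ultimately have "(f ^^ n) u = (f ^^ n) v" by metis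
  then show ?case by (rule Suc.IH)
qed simp

text \<open>The parameter space is left general so that a path (over an interval) and a homotopy of
  paths (over a rectangle) are lifted by the same lemma.\<close>

definition skew_family :: "'s::topological_space set \<Rightarrow> ('s \<Rightarrow> 'e \<Rightarrow> 'e) \<Rightarrow> bool" where
  "skew_family S f \<longleftrightarrow> (\<forall>s\<in>S. f s \<in> skew_maps p ori T) \<and> continuous_on (S \<times> UNIV) (\<lambda>(s, u). f s u)"

lemma skew_family_funpow_continuous:
  assumes f: "skew_family S f" shows "continuous_on (S \<times> UNIV) (\<lambda>(s, u). (f s ^^ n) u)"
proof (induction n)
  case 0 then show ?case by (simp add: case_prod_unfold continuous_on_snd continuous_on_id)
next
  case (Suc n)
  have "continuous_on (S \<times> UNIV) (\<lambda>z. (\<lambda>(s, u). f s u) (fst z, (\<lambda>(s, u). (f s ^^ n) u) z))"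
  proof (rule continuous_on_compose2[where g = "\<lambda>(s, u). f s u" and t = "S \<times> UNIV"])
    show "continuous_on (S \<times> UNIV) (\<lambda>(s, u). f s u)" using f by (simp add: skew_family_def)
    show "continuous_on (S \<times> UNIV) (\<lambda>z. (fst z, (\<lambda>(s, u). (f s ^^ n) u) z))"
      by (intro continuous_on_Pair continuous_on_fst continuous_on_id Suc)
    show "(\<lambda>z. (fst z, (\<lambda>(s, u). (f s ^^ n) u) z)) ` (S \<times> UNIV) \<subseteq> S \<times> UNIV" by auto
  qed
  then show ?case by (simp add: case_prod_unfold)
qed

lemma skew_family_orbit_continuous:
  assumes f: "skew_family S f" and g: "continuous_on R g" "g ` R \<subseteq> S" and h: "continuous_on R h"
  shows "continuous_on R (\<lambda>r. (f (g r) ^^ n) (h r))"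
proof -
  have "(\<lambda>r. (g r, h r)) ` R \<subseteq> S \<times> UNIV" using g(2) by blast
  from continuous_on_compose2[OF skew_family_funpow_continuous[OF f, of n] continuous_on_Pair[OF g(1) h] this]
  show ?thesis by simp
qed

lemma skew_family_maps: "skew_family S f \<Longrightarrow> s \<in> S \<Longrightarrow> f s \<in> skew_maps p ori T"
  by (simp add: skew_family_def)

lemma dist_le_mdist_skew_space:
  assumes "f \<in> mspace (skew_space p ori T)" "g \<in> mspace (skew_space p ori T)"
  shows "dist (f u) (g u) \<le> mdist (skew_space p ori T) f g"
  using mdist_cfunspace_imp_mdist_le[of f euclidean euclidean_metric g _ u] assms
  by (auto simp: skew_space_def)

text \<open>Closeness of \<open>f t\<close> to \<open>f s\<close> in the uniform metric takes care
  of the parameter, continuity of the single map \<open>f s\<close> of the point.\<close>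

lemma skew_familyI:
  fixes f :: "'s::metric_space \<Rightarrow> 'e \<Rightarrow> 'e"
  assumes f: "continuous_map (top_of_set S) (mtopology_of (skew_space p ori T)) f"
  shows "skew_family S f"
proof -
  let ?M = "skew_space p ori T"
  have mem: "f s \<in> mspace ?M" if "s \<in> S" for s
    using f that by (auto simp: continuous_map_def Pi_iff)
  then have maps: "f s \<in> skew_maps p ori T" if "s \<in> S" for s
    using that by (auto simp: skew_space_def)
  have "continuous_on (S \<times> UNIV) (\<lambda>(s, u). f s u)"
    unfolding continuous_on_iff
  proof (intro ballI allI impI)
    fix z and e :: real assume z: "z \<in> S \<times> (UNIV :: 'e set)" and e: "0 < e"
    obtain s u where su: "z = (s, u)" by (cases z)
    have s: "s \<in> S" using z su by simp
    have "\<forall>s\<in>topspace (top_of_set S). \<forall>\<epsilon>>0. \<exists>V. openin (top_of_set S) V \<and> s \<in> V \<and>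
        (\<forall>t\<in>V. f t \<in> Metric_space.mball (mspace ?M) (mdist ?M) (f s) \<epsilon>)"
      using f unfolding mtopology_of_def Metric_space.continuous_map_to_metric[OF Metric_space_mspace_mdist] .
    moreover have "s \<in> topspace (top_of_set S)" "e / 2 > 0" using s e by auto
    ultimately have "\<exists>V. openin (top_of_set S) V \<and> s \<in> V \<and>
        (\<forall>t\<in>V. f t \<in> Metric_space.mball (mspace ?M) (mdist ?M) (f s) (e / 2))" by blast
    then obtain V where V: "openin (top_of_set S) V" "s \<in> V" "\<And>t. t \<in> V \<Longrightarrow> mdist ?M (f s) (f t) < e / 2"
      unfolding Metric_space.in_mball[OF Metric_space_mspace_mdist] by blast
    obtain r1 where r1: "r1 > 0" "\<And>t. t \<in> S \<Longrightarrow> dist t s < r1 \<Longrightarrow> t \<in> V"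
      using V(1,2) unfolding openin_euclidean_subtopology_iff by blast
    have "continuous_on UNIV (f s)" using maps[OF s] by (simp add: skew_maps_def)
    then have "\<exists>r>0. \<forall>v\<in>UNIV. dist v u < r \<longrightarrow> dist (f s v) (f s u) < e / 2"
      using e half_gt_zero unfolding continuous_on_iff by blast
    then obtain r2 where r2: "r2 > 0" "\<And>v. dist v u < r2 \<Longrightarrow> dist (f s v) (f s u) < e / 2"
      by blast
    show "\<exists>r>0. \<forall>x\<in>S \<times> UNIV. dist x z < r \<longrightarrow> dist (case x of (t, v) \<Rightarrow> f t v) (case z of (t, v) \<Rightarrow> f t v) < e"
      unfolding su
    proof (intro exI[of _ "min r1 r2"] conjI ballI impI)
      fix x assume x: "x \<in> S \<times> UNIV" "dist x (s, u) < min r1 r2"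
      obtain t v where tv: "x = (t, v)" by (cases x)
      have "dist t s < r1" "dist v u < r2"
        using x(2) dist_fst_le[of x "(s, u)"] dist_snd_le[of x "(s, u)"] by (auto simp: tv)
      then have "dist (f t v) (f s v) < e / 2" "dist (f s v) (f s u) < e / 2"
        using r1(2)[of t] V(3)[of t] dist_le_mdist_skew_space[OF mem[OF s] mem[of t], of v] x(1) r2(2)[of v]
        by (auto simp: tv dist_commute)
      then show "dist (case x of (t, v) \<Rightarrow> f t v) (case (s, u) of (t, v) \<Rightarrow> f t v) < e"
        using dist_triangle[of "f t v" "f s u" "f s v"] unfolding tv by simp
    qed (use r1(1) r2(1) in auto)
  qed
  then show ?thesis using maps by (simp add: skew_family_def)
qed

lemma skew_path_family: "\<phi> \<in> mspace P \<Longrightarrow> skew_family {a..b} \<phi>"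
  by (intro skew_familyI) (simp add: skew_paths_def)

lemma dist_skew_paths:
  assumes "\<phi> \<in> mspace P" "\<psi> \<in> mspace P" "mdist P \<phi> \<psi> < e" "t \<in> {a..b}"
  shows "dist (\<phi> t u) (\<psi> t u) < e"
proof -
  have "mdist (skew_space p ori T) (\<phi> t) (\<psi> t) \<le> mdist P \<phi> \<psi>"
    using assms unfolding skew_paths_def
    by (intro mdist_cfunspace_imp_mdist_le[of \<phi> "top_of_set {a..b}" _ \<psi>]) auto
  moreover have "\<phi> t \<in> mspace (skew_space p ori T)" "\<psi> t \<in> mspace (skew_space p ori T)"
    using assms by (auto simp: skew_paths_def Pi_iff)
  ultimately show ?thesis
    using dist_le_mdist_skew_space[of "\<phi> t" "\<psi> t" u] assms(3) by linarith
qed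

section \<open>Winding of orbit paths: change of point, iteration, homotopy, perturbation\<close>

definition winding :: "(real \<Rightarrow> 'e \<Rightarrow> 'e) \<Rightarrow> nat \<Rightarrow> 'e \<Rightarrow> real" where
  "winding \<phi> n u = circle_winding d (ori ((T ^^ n) (p u))) a b (\<lambda>t. (\<phi> t ^^ n) u)"

lemma winding_bounds:
  assumes "c \<in> ori ((T ^^ n) (p u))" "continuous_on {a..b} g"
    "\<And>t. t \<in> {a..b} \<Longrightarrow> (\<phi> t ^^ n) u = c (cis (2 * pi * g t))"
  shows "\<bar>winding \<phi> n u - (g b - g a)\<bar> \<le> 1"
  unfolding winding_def using unit_circle.circle_winding_bounds[OF unit_circle_fibre a_le_b assms] .

lemma orbit_lift:
  fixes f :: "'s::real_normed_vector \<Rightarrow> 'e \<Rightarrow> 'e"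
  assumes f: "skew_family S f" and S: "convex S" and c: "c \<in> ori ((T ^^ n) (p u))"
  obtains g where "continuous_on S g" "\<And>s. s \<in> S \<Longrightarrow> (f s ^^ n) u = c (cis (2 * pi * g s))"
proof (rule unit_circle.lift_exists[OF unit_circle_fibre c _ _ S])
  show "continuous_on S (\<lambda>s. (f s ^^ n) u)"
    by (rule skew_family_orbit_continuous[OF f continuous_on_id]) auto
  show "(\<lambda>s. (f s ^^ n) u) ` S \<subseteq> p -` {(T ^^ n) (p u)}"
    using skew_family_maps[OF f] by (auto simp: skew_map_funpow_fibre)
qed blast

lemma winding_same_fibre:
  assumes f: "skew_family {a..b} \<phi>" and uv: "p u = p v"
  shows "\<bar>winding \<phi> n u - winding \<phi> n v\<bar> \<le> 3"
proof (cases "u = v")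
  case False
  obtain c where c: "c \<in> ori ((T ^^ n) (p u))" using ori_nonempty by blast
  have cv: "c \<in> ori ((T ^^ n) (p v))" using c uv by simp
  obtain g where g: "continuous_on {a..b} g" "\<And>t. t \<in> {a..b} \<Longrightarrow> (\<phi> t ^^ n) u = c (cis (2 * pi * g t))"
    using orbit_lift[OF f _ c] by auto
  obtain h where h: "continuous_on {a..b} h" "\<And>t. t \<in> {a..b} \<Longrightarrow> (\<phi> t ^^ n) v = c (cis (2 * pi * h t))"
    using orbit_lift[OF f _ cv] by auto
  \<comment> \<open>Each \<open>\<phi> t ^^ n\<close> is injective on the fibre, so the two paths
    never meet and the difference of their lifts stays between consecutive integers. The 3 is this
    bound plus 1 for each of the two windings.\<close>
  have "\<bar>(g b - h b) - (g a - h a)\<bar> < 1"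
  proof (rule avoid_Ints_diff_less_1[where g = "\<lambda>t. g t - h t", OF _ a_le_b])
    show "continuous_on {a..b} (\<lambda>t. g t - h t)" by (intro continuous_intros g h)
    fix t assume t: "t \<in> {a..b}"
    have "(\<phi> t ^^ n) u \<noteq> (\<phi> t ^^ n) v"
      using skew_map_funpow_inj[OF skew_family_maps[OF f t] uv] False by blast
    then show "g t - h t \<notin> \<int>"
      using circle_orientation_cover_eq_iff[OF unit_circle.orient[OF unit_circle_fibre] c] g(2)[OF t] h(2)[OF t]
      by simp
  qed
  then show ?thesis using winding_bounds[OF c g] winding_bounds[OF cv h] by linarith
qed simp

text \<open>Lift the square \<open>(s, t) \<mapsto> f\<^sub>s\<^sup>m (f\<^sub>t\<^sup>n u)\<close>: the path along its diagonal, which is the one for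
  \<open>n + m\<close>, is homotopic to the concatenation of two of its sides. On the side \<open>s = a\<close> the
  homeomorphism \<open>f\<^sub>a\<^sup>m\<close> is constant and merely changes the parametrisation of the fibre.\<close>

lemma winding_almost_additive:
  assumes f: "skew_family {a..b} \<phi>"
  shows "\<bar>winding \<phi> (n + m) u - winding \<phi> n u - winding \<phi> m ((\<phi> b ^^ n) u)\<bar> \<le> 5"
proof -
  let ?Q = "{a..b} \<times> {a..b}" and ?v = "(\<phi> b ^^ n) u"
  have ab: "a \<in> {a..b}" "b \<in> {a..b}" using a_le_b by auto
  note maps = skew_family_maps[OF f]
  have pv: "p ((\<phi> t ^^ n) u) = (T ^^ n) (p u)" if "t \<in> {a..b}" for t
    using skew_map_funpow_fibre[OF maps[OF that]] .
  have T: "(T ^^ (n + m)) (p u) = (T ^^ m) ((T ^^ n) (p u))"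
    by (simp add: add.commute[of n] funpow_add)
  obtain c where c: "c \<in> ori ((T ^^ (n + m)) (p u))" using ori_nonempty by blast
  have "continuous_on ?Q (\<lambda>(s, t). (\<phi> s ^^ m) ((\<phi> t ^^ n) u))"
    unfolding case_prod_unfold
    by (intro skew_family_orbit_continuous[OF f] continuous_intros) auto
  moreover have "(\<lambda>(s, t). (\<phi> s ^^ m) ((\<phi> t ^^ n) u)) ` ?Q \<subseteq> p -` {(T ^^ (n + m)) (p u)}"
    using maps by (auto simp: skew_map_funpow_fibre T)
  moreover have "convex ?Q" by (intro convex_Times) auto
  ultimately obtain h where h: "continuous_on ?Q h"
    "\<And>z. z \<in> ?Q \<Longrightarrow> (case z of (s, t) \<Rightarrow> (\<phi> s ^^ m) ((\<phi> t ^^ n) u)) = c (cis (2 * pi * h z))"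
    using unit_circle.lift_exists[OF unit_circle_fibre c] by blast
  have hc: "continuous_on {a..b} (\<lambda>t. h (g1 t, g2 t))"
    if "continuous_on {a..b} g1" "continuous_on {a..b} g2" "g1 ` {a..b} \<subseteq> {a..b}" "g2 ` {a..b} \<subseteq> {a..b}" for g1 g2
    by (rule continuous_on_compose2[OF h(1) continuous_on_Pair[OF that(1,2)]]) (use that in auto)
  have diag: "\<bar>winding \<phi> (n + m) u - (h (b, b) - h (a, a))\<bar> \<le> 1"
    using h(2) by (intro winding_bounds[OF c, of "\<lambda>t. h (t, t)"] hc continuous_intros)
      (auto simp: add.commute[of n] funpow_add)
  have side2: "\<bar>winding \<phi> m ?v - (h (b, b) - h (a, b))\<bar> \<le> 1"
    using h(2) ab c by (intro winding_bounds[of c m ?v "\<lambda>t. h (t, b)"] hc continuous_intros) (auto simp: pv T)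
  let ?w = "circle_winding d (ori ((T ^^ (n + m)) (p u))) a b (\<lambda>t. (\<phi> a ^^ m) ((\<phi> t ^^ n) u))"
  have side1: "\<bar>?w - (h (a, b) - h (a, a))\<bar> \<le> 1"
    using h(2) ab
    by (intro unit_circle.circle_winding_bounds[OF unit_circle_fibre a_le_b c, of "\<lambda>t. h (a, t)"] hc continuous_intros) auto
  obtain c0 where c0: "c0 \<in> ori ((T ^^ n) (p u))" using ori_nonempty by blast
  obtain g where g: "continuous_on {a..b} g" "\<And>t. t \<in> {a..b} \<Longrightarrow> (\<phi> t ^^ n) u = c0 (cis (2 * pi * g t))"
    using orbit_lift[OF f _ c0] by auto
  \<comment> \<open>In this parametrisation the lift \<open>g\<close> of the orbit path of time
    \<open>n\<close> also lifts the side \<open>s = a\<close>, so \<open>?w\<close> can be compared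
    with \<open>winding \<phi> n u\<close>.\<close>
  have c1: "(\<phi> a ^^ m) \<circ> c0 \<in> ori ((T ^^ (n + m)) (p u))"
    using skew_map_funpow_ori[OF maps[OF ab(1)] c0] by (simp add: T)
  have "\<bar>?w - (g b - g a)\<bar> \<le> 1"
    by (rule unit_circle.circle_winding_bounds[OF unit_circle_fibre a_le_b c1 g(1)]) (simp add: g(2))
  moreover have "\<bar>winding \<phi> n u - (g b - g a)\<bar> \<le> 1" by (rule winding_bounds[OF c0 g])
  \<comment> \<open>Five errors of 1: the diagonal, the two sides in the lift \<open>h\<close>, and
    the side \<open>s = a\<close> and the path of time \<open>n\<close> in the lift
    \<open>g\<close>. The second side has \<open>t = b\<close>, which is why the cocycle relation
    involves \<open>\<phi> b\<close>.\<close>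
  ultimately show ?thesis using diag side1 side2 by linarith
qed

text \<open>The orbit of \<open>u\<close> is lifted over the rectangle of the homotopy. On the edges
  \<open>t = a\<close> and \<open>t = b\<close> the maps are fixed, hence so is the lift; both paths
  thus have the same lifted end points, and 2 is the error of the two windings.\<close>

lemma winding_homotopic:
  assumes hom: "homotopic_skew_paths p ori T a b \<phi> \<psi>"
  shows "\<bar>winding \<phi> n u - winding \<psi> n u\<bar> \<le> 2"
proof -
  obtain H where H: "continuous_map (prod_topology (top_of_set {0..1::real}) (top_of_set {a..b})) (mtopology_of (skew_space p ori T)) H"
    and H01: "\<And>t. H (0, t) = \<phi> t" "\<And>t. H (1, t) = \<psi> t"
    and Hab: "\<And>s. s \<in> {0..1} \<Longrightarrow> H (s, a) = \<phi> a \<and> H (s, b) = \<phi> b"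
    using hom unfolding homotopic_skew_paths_def homotopic_with_def by auto
  let ?Q = "{0..1::real} \<times> {a..b}"
  have f: "skew_family ?Q H"
    using H by (intro skew_familyI) (simp add: subtopology_Times)
  obtain c where c: "c \<in> ori ((T ^^ n) (p u))" using ori_nonempty by blast
  have "convex ?Q" by (intro convex_Times) auto
  then obtain h where h: "continuous_on ?Q h" "\<And>z. z \<in> ?Q \<Longrightarrow> (H z ^^ n) u = c (cis (2 * pi * h z))"
    using orbit_lift[OF f _ c] by blast
  have side: "h (1, t) = h (0, t)" if t: "t \<in> {a, b}" for t
  proof (rule Ints_valued_constant[where g = "\<lambda>s. h (s, t) - h (0, t)" and a = 0 and b = 1, simplified])
    show "continuous_on {0..1} (\<lambda>s. h (s, t) - h (0, t))"
      using t a_le_b by (intro continuous_intros continuous_on_compose2[OF h(1)]) auto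
    fix s :: real assume s: "0 \<le> s \<and> s \<le> 1"
    have "(H (s, t) ^^ n) u = (H (0, t) ^^ n) u" using Hab[of s] Hab[of 0] s t by auto
    then have "c (cis (2 * pi * h (s, t))) = c (cis (2 * pi * h (0, t)))"
      using h(2)[of "(s, t)"] h(2)[of "(0, t)"] s t a_le_b by auto
    then show "h (s, t) - h (0, t) \<in> \<int>"
      by (simp add: circle_orientation_cover_eq_iff[OF unit_circle.orient[OF unit_circle_fibre] c])
  qed
  have hc: "continuous_on {a..b} (\<lambda>t. h (s, t))" if "s \<in> {0..1}" for s
    by (rule continuous_on_compose2[OF h(1)]) (use that in \<open>auto intro!: continuous_intros\<close>)
  have "\<bar>winding \<phi> n u - (h (0, b) - h (0, a))\<bar> \<le> 1"
    using h(2) by (intro winding_bounds[OF c, of "\<lambda>t. h (0, t)"] hc) (auto simp flip: H01)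
  moreover have "\<bar>winding \<psi> n u - (h (1, b) - h (1, a))\<bar> \<le> 1"
    using h(2) by (intro winding_bounds[OF c, of "\<lambda>t. h (1, t)"] hc) (auto simp flip: H01)
  ultimately show ?thesis using side by auto
qed

text \<open>Induction on \<open>n\<close>, uniformly in \<open>t\<close>. In the last step
  \<open>\<psi> t\<close> is first replaced by \<open>\<phi> t\<close>, at a cost controlled by the
  distance of the paths; then joint continuity of \<phi> near the compact curve of reference points
  applies.\<close>

lemma orbit_tracking:
  assumes \<phi>: "\<phi> \<in> mspace P" and e: "e > 0"
  shows "\<exists>\<delta>>0. \<forall>\<psi>\<in>mspace P. mdist P \<phi> \<psi> < \<delta> \<longrightarrow>
    (\<forall>u. dist u u0 < \<delta> \<longrightarrow> (\<forall>t\<in>{a..b}. dist ((\<psi> t ^^ n) u) ((\<phi> t ^^ n) u0) < e))"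
  using e
proof (induction n arbitrary: e)
  case 0 then show ?case by (intro exI[of _ e]) auto
next
  case (Suc n)
  note f = skew_path_family[OF \<phi>]
  let ?K = "(\<lambda>t. (t, (\<phi> t ^^ n) u0)) ` {a..b}"
  have "compact ?K"
    by (intro compact_continuous_image continuous_intros skew_family_orbit_continuous[OF f]) auto
  moreover have "continuous_on ({a..b} \<times> UNIV) (\<lambda>(t, u). \<phi> t u)" using f by (simp add: skew_family_def)
  moreover have "?K \<subseteq> {a..b} \<times> UNIV" "0 < e / 2" using Suc.prems by auto
  ultimately obtain e' where e': "e' > 0" "\<And>k v. k \<in> ?K \<Longrightarrow> v \<in> {a..b} \<times> UNIV \<Longrightarrow> dist v k < e' \<Longrightarrow>
      dist ((\<lambda>(t, u). \<phi> t u) v) ((\<lambda>(t, u). \<phi> t u) k) < e / 2"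
    using continuous_near_compact by blast
  obtain \<delta> where \<delta>: "\<delta> > 0" "\<forall>\<psi>\<in>mspace P. mdist P \<phi> \<psi> < \<delta> \<longrightarrow>
    (\<forall>u. dist u u0 < \<delta> \<longrightarrow> (\<forall>t\<in>{a..b}. dist ((\<psi> t ^^ n) u) ((\<phi> t ^^ n) u0) < e'))"
    using Suc.IH[OF e'(1)] by blast
  show ?case
  proof (intro exI[of _ "min \<delta> (e / 2)"] conjI ballI impI allI)
    fix \<psi> u t assume \<psi>: "\<psi> \<in> mspace P" "mdist P \<phi> \<psi> < min \<delta> (e / 2)" and u: "dist u u0 < min \<delta> (e / 2)"
      and t: "t \<in> {a..b}"
    let ?v = "(\<psi> t ^^ n) u" and ?w = "(\<phi> t ^^ n) u0"
    have "mdist P \<phi> \<psi> < \<delta>" "dist u u0 < \<delta>" using \<psi>(2) u by simp_all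
    then have "dist ?v ?w < e'" using \<delta>(2) \<psi>(1) t by blast
    then have "dist (\<phi> t ?v) (\<phi> t ?w) < e / 2"
      using e'(2)[of "(t, ?w)" "(t, ?v)"] t by (simp add: dist_Pair_Pair)
    moreover have "dist (\<phi> t ?v) (\<psi> t ?v) < e / 2"
      by (rule dist_skew_paths[OF \<phi> \<psi>(1) _ t]) (use \<psi>(2) in simp)
    ultimately show "dist ((\<psi> t ^^ Suc n) u) ((\<phi> t ^^ Suc n) u0) < e"
      by (simp add: dist_triangle_half_r)
  qed (use \<delta>(1) Suc.prems in auto)
qed

lemma bundle_chart:
  obtains U h h' where "open U" "x \<in> U" "homeomorphism (U \<times> sphere 0 1) (p -` U) h h'"
    "\<And>y. y \<in> U \<Longrightarrow> (\<lambda>z. h (y, z)) \<in> ori y"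
    "\<And>v. p v \<in> U \<Longrightarrow> v = h (p v, snd (h' v)) \<and> snd (h' v) \<in> sphere 0 1"
proof -
  obtain U h h' where U: "open U" "x \<in> U" and h: "homeomorphism (U \<times> sphere 0 1) (p -` U) h h'"
    and o: "\<And>y. y \<in> U \<Longrightarrow> (\<lambda>z. h (y, z)) \<in> ori y"
    using circle_bundle unfolding oriented_circle_bundle_def by metis
  have "v = h (p v, snd (h' v)) \<and> snd (h' v) \<in> sphere 0 1" if v: "p v \<in> U" for v
  proof -
    obtain y z where yz: "h' v = (y, z)" by (cases "h' v")
    have "h' v \<in> U \<times> sphere 0 1" using homeomorphism_image2[OF h] v by blast
    then have y: "y \<in> U" and z: "norm z = 1" by (auto simp: yz)
    have "v = h (y, z)" using homeomorphism_apply2[OF h, of v] v yz by simp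
    moreover have "p (h (y, z)) = y" using ori_in_fibre[OF o[OF y] z] .
    ultimately show ?thesis using z by (metis yz snd_conv mem_sphere_0)
  qed
  then show ?thesis using that U h o by blast
qed

text \<open>In a chart around \<open>(T ^^ n) x0\<close> the circle coordinates of the two orbits
  are never antipodal, so their lifts turn by less than 1 relative to each other. The 9 is this 1,
  plus 1 for each winding, plus 3 for each move of a starting point within its fibre.\<close>

lemma winding_locally_close:
  assumes \<phi>: "\<phi> \<in> mspace P"
  shows "\<exists>\<delta>>0. \<forall>\<psi>\<in>mspace P. mdist P \<phi> \<psi> < \<delta> \<longrightarrow>
    (\<forall>u v. dist (p u) x0 < \<delta> \<longrightarrow> p v = x0 \<longrightarrow> \<bar>winding \<psi> n u - winding \<phi> n v\<bar> \<le> 9)"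
proof -
  note f = skew_path_family[OF \<phi>]
  obtain U0 h0 h0' where U0: "open U0" "x0 \<in> U0" and h0: "homeomorphism (U0 \<times> sphere 0 1) (p -` U0) h0 h0'"
    and o0: "\<And>y. y \<in> U0 \<Longrightarrow> (\<lambda>z. h0 (y, z)) \<in> ori y"
    using bundle_chart by metis
  define u0 where "u0 = h0 (x0, 1)"
  have pu0: "p u0 = x0" using ori_in_fibre[OF o0[OF U0(2)]] by (simp add: u0_def)
  define y0 where "y0 = (T ^^ n) x0"
  obtain U h h' where U: "open U" "y0 \<in> U" and h: "homeomorphism (U \<times> sphere 0 1) (p -` U) h h'"
    and o: "\<And>y. y \<in> U \<Longrightarrow> (\<lambda>z. h (y, z)) \<in> ori y"
    and hv: "\<And>v. p v \<in> U \<Longrightarrow> v = h (p v, snd (h' v)) \<and> snd (h' v) \<in> sphere 0 1"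
    using bundle_chart[of y0] by metis
  define q where "q v = snd (h' v)" for v
  have cq: "continuous_on (p -` U) q"
    unfolding q_def using h by (intro continuous_on_snd) (simp add: homeomorphism_def)
  let ?K = "(\<lambda>t. (\<phi> t ^^ n) u0) ` {a..b}"
  have cpath: "continuous_on {a..b} (\<lambda>t. (\<psi> t ^^ n) u)" if "skew_family {a..b} \<psi>" for \<psi> u
    by (intro skew_family_orbit_continuous[OF that] continuous_intros) auto
  have K: "compact ?K" by (intro compact_continuous_image cpath f) auto
  have KU: "?K \<subseteq> p -` U"
    using U(2) skew_family_maps[OF f] by (auto simp: skew_map_funpow_fibre pu0 y0_def)
  have op: "open (p -` U)"
    using circle_bundle U(1) by (auto simp: oriented_circle_bundle_def continuous_on_open_vimage)
  \<comment> \<open>A Lebesgue number for a cover by a single set: the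
    \<open>e1\<close>-neighbourhood of the reference curve stays in the chart.\<close>
  obtain e1 where e1: "e1 > 0" "\<And>k. k \<in> ?K \<Longrightarrow> \<exists>B\<in>{p -` U}. ball k e1 \<subseteq> B"
  proof (rule Heine_Borel_lemma[OF K, of "{p -` U}"])
    show "?K \<subseteq> \<Union>{p -` U}" using KU by simp
  qed (use op in simp_all)
  \<comment> \<open>2 is the diameter of the unit circle; points at distance less than 2 are not
    antipodal.\<close>
  obtain e2 where e2: "e2 > 0" "\<And>k v. k \<in> ?K \<Longrightarrow> v \<in> p -` U \<Longrightarrow> dist v k < e2 \<Longrightarrow> dist (q v) (q k) < 2"
    using continuous_near_compact[OF cq K KU, of 2] by (metis zero_less_numeral)
  have "0 < min e1 e2" using e1(1) e2(1) by simp
  from orbit_tracking[OF \<phi> this, of u0 n] obtain \<delta> where \<delta>: "\<delta> > 0" "\<forall>\<psi>\<in>mspace P. mdist P \<phi> \<psi> < \<delta> \<longrightarrow>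
    (\<forall>u. dist u u0 < \<delta> \<longrightarrow> (\<forall>t\<in>{a..b}. dist ((\<psi> t ^^ n) u) ((\<phi> t ^^ n) u0) < min e1 e2))"
    by blast
  have "continuous_on U0 (\<lambda>x. h0 (x, 1))"
  proof (rule continuous_on_compose2[OF homeomorphism_cont1[OF h0]])
    show "continuous_on U0 (\<lambda>x. (x, 1 :: complex))" by (intro continuous_intros)
  qed auto
  then have "\<exists>r>0. \<forall>x\<in>U0. dist x x0 < r \<longrightarrow> dist (h0 (x, 1)) u0 < \<delta>"
    using U0(2) \<delta>(1) unfolding continuous_on_iff u0_def by blast
  then obtain r1 where r1: "r1 > 0" "\<And>x. x \<in> U0 \<Longrightarrow> dist x x0 < r1 \<Longrightarrow> dist (h0 (x, 1)) u0 < \<delta>"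
    by blast
  obtain r2 where r2: "r2 > 0" "\<And>x. dist x x0 < r2 \<Longrightarrow> x \<in> U0"
    using U0 unfolding open_dist by blast
  obtain g where g: "continuous_on {a..b} g" "\<And>t. t \<in> {a..b} \<Longrightarrow> q ((\<phi> t ^^ n) u0) = cis (2 * pi * g t)"
  proof (rule lift_to_line[of "{a..b}" "\<lambda>t. q ((\<phi> t ^^ n) u0)"])
    show "continuous_on {a..b} (\<lambda>t. q ((\<phi> t ^^ n) u0))"
      using KU by (intro continuous_on_compose2[OF cq cpath[OF f]]) auto
    show "(\<lambda>t. q ((\<phi> t ^^ n) u0)) ` {a..b} \<subseteq> sphere 0 1"
      using KU hv unfolding q_def by blast
  qed auto
  have wg: "\<bar>winding \<phi> n u0 - (g b - g a)\<bar> \<le> 1"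
  proof (rule winding_bounds[OF _ g(1)])
    show "(\<lambda>z. h (y0, z)) \<in> ori ((T ^^ n) (p u0))" using o[OF U(2)] by (simp add: pu0 y0_def)
    fix t assume t: "t \<in> {a..b}"
    have "p ((\<phi> t ^^ n) u0) = y0"
      using skew_map_funpow_fibre[OF skew_family_maps[OF f t]] by (simp add: pu0 y0_def)
    then show "(\<phi> t ^^ n) u0 = h (y0, cis (2 * pi * g t))"
      using hv[of "(\<phi> t ^^ n) u0"] U(2) g(2)[OF t] by (simp add: q_def)
  qed
  show ?thesis
  proof (intro exI[of _ "min \<delta> (min r1 r2)"] conjI ballI impI allI)
    fix \<psi> u v assume \<psi>: "\<psi> \<in> mspace P" "mdist P \<phi> \<psi> < min \<delta> (min r1 r2)"
      and u: "dist (p u) x0 < min \<delta> (min r1 r2)" and v: "p v = x0"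
    note f' = skew_path_family[OF \<psi>(1)]
    \<comment> \<open>The point \<open>u\<close> may be far from \<open>u0\<close> inside its fibre,
      so it is exchanged for the point of the local section through \<open>u0\<close>.\<close>
    define u1 where "u1 = h0 (p u, 1)"
    have pU: "p u \<in> U0" using r2(2) u by simp
    have pu1: "p u1 = p u" using ori_in_fibre[OF o0[OF pU]] by (simp add: u1_def)
    have "dist u1 u0 < \<delta>" using r1(2)[OF pU] u by (simp add: u1_def)
    then have close: "dist ((\<psi> t ^^ n) u1) ((\<phi> t ^^ n) u0) < min e1 e2" if "t \<in> {a..b}" for t
      using \<delta>(2) \<psi> that by simp
    define y where "y = (T ^^ n) (p u1)"
    have py: "p ((\<psi> t ^^ n) u1) = y" if "t \<in> {a..b}" for t
      using skew_map_funpow_fibre[OF skew_family_maps[OF f' that]] by (simp add: y_def)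
    have inU: "p ((\<psi> t ^^ n) u1) \<in> U" if t: "t \<in> {a..b}" for t
    proof -
      have "(\<psi> t ^^ n) u1 \<in> ball ((\<phi> t ^^ n) u0) e1" using close[OF t] by (simp add: dist_commute)
      moreover have "ball ((\<phi> t ^^ n) u0) e1 \<subseteq> p -` U" using e1(2) t by blast
      ultimately show ?thesis by blast
    qed
    have yU: "y \<in> U" using inU[of a] py[of a] a_le_b by simp
    obtain g' where g': "continuous_on {a..b} g'" "\<And>t. t \<in> {a..b} \<Longrightarrow> q ((\<psi> t ^^ n) u1) = cis (2 * pi * g' t)"
    proof (rule lift_to_line[of "{a..b}" "\<lambda>t. q ((\<psi> t ^^ n) u1)"])
      show "continuous_on {a..b} (\<lambda>t. q ((\<psi> t ^^ n) u1))"
        using inU by (intro continuous_on_compose2[OF cq cpath[OF f']]) auto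
      show "(\<lambda>t. q ((\<psi> t ^^ n) u1)) ` {a..b} \<subseteq> sphere 0 1"
        using inU hv unfolding q_def by blast
    qed auto
    have wg': "\<bar>winding \<psi> n u1 - (g' b - g' a)\<bar> \<le> 1"
    proof (rule winding_bounds[OF _ g'(1)])
      show "(\<lambda>z. h (y, z)) \<in> ori ((T ^^ n) (p u1))" using o[OF yU] by (simp add: y_def)
      fix t assume t: "t \<in> {a..b}"
      show "(\<psi> t ^^ n) u1 = h (y, cis (2 * pi * g' t))"
        using hv[OF inU[OF t]] g'(2)[OF t] py[OF t] by (simp add: q_def)
    qed
    \<comment> \<open>With the shift by \<open>1/2\<close>, an integer value would mean antipodal
      coordinates instead of equal ones.\<close>
    have "\<bar>(g' b - g b + 1/2) - (g' a - g a + 1/2)\<bar> < 1"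
    proof (rule avoid_Ints_diff_less_1[where g = "\<lambda>t. g' t - g t + 1/2", OF _ a_le_b])
      show "continuous_on {a..b} (\<lambda>t. g' t - g t + 1/2)" by (intro continuous_intros g g')
      fix t assume t: "t \<in> {a..b}"
      show "g' t - g t + 1/2 \<notin> \<int>"
      proof
        assume "g' t - g t + 1/2 \<in> \<int>"
        then have "cis (2 * pi * (g' t + 1/2)) = cis (2 * pi * g t)"
          unfolding cis_2pi_eq_iff by (simp add: algebra_simps)
        moreover have "cis (2 * pi * (g' t + 1/2)) = - cis (2 * pi * g' t)"
          by (simp add: ring_distribs cis_mult[symmetric])
        ultimately have "cis (2 * pi * g t) = - cis (2 * pi * g' t)" by simp
        then have "q ((\<psi> t ^^ n) u1) - q ((\<phi> t ^^ n) u0) = 2 * cis (2 * pi * g' t)"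
          using g(2)[OF t] g'(2)[OF t] by simp
        then have "dist (q ((\<psi> t ^^ n) u1)) (q ((\<phi> t ^^ n) u0)) = 2"
          by (simp add: dist_norm norm_mult)
        moreover have "dist (q ((\<psi> t ^^ n) u1)) (q ((\<phi> t ^^ n) u0)) < 2"
          using e2(2)[of "(\<phi> t ^^ n) u0"] close[OF t] inU[OF t] t by auto
        ultimately show False by simp
      qed
    qed
    moreover have "\<bar>winding \<psi> n u - winding \<psi> n u1\<bar> \<le> 3" "\<bar>winding \<phi> n u0 - winding \<phi> n v\<bar> \<le> 3"
      using winding_same_fibre[OF f'] winding_same_fibre[OF f] pu1 pu0 v by auto
    ultimately show "\<bar>winding \<psi> n u - winding \<phi> n v\<bar> \<le> 9" using wg wg' by linarith
  qed (use \<delta>(1) r1(1) r2(1) in auto)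
qed

text \<open>Compactness of the base makes the radius uniform. Both windings are compared with that
  of \<phi> at a nearby centre of the finite cover, for \<phi> itself by taking the perturbed path
  equal to \<phi>; hence twice 9.\<close>

lemma winding_close:
  assumes \<phi>: "\<phi> \<in> mspace P"
  obtains \<delta> where "\<delta> > 0" "\<And>\<psi> u v. \<psi> \<in> mspace P \<Longrightarrow> mdist P \<phi> \<psi> < \<delta> \<Longrightarrow> p u = p v \<Longrightarrow>
    \<bar>winding \<psi> n u - winding \<phi> n v\<bar> \<le> 18"
proof -
  obtain \<delta> where \<delta>: "\<And>x. \<delta> x > 0" "\<And>x \<psi> u v. \<psi> \<in> mspace P \<Longrightarrow> mdist P \<phi> \<psi> < \<delta> x \<Longrightarrow>
      dist (p u) x < \<delta> x \<Longrightarrow> p v = x \<Longrightarrow> \<bar>winding \<psi> n u - winding \<phi> n v\<bar> \<le> 9"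
    using winding_locally_close[OF \<phi>, of _ n] by metis
  obtain F where F: "finite F" "UNIV \<subseteq> (\<Union>x\<in>F. ball x (\<delta> x))"
  proof (rule compactE_image[OF compact_base, of UNIV "\<lambda>x. ball x (\<delta> x)"])
    show "UNIV \<subseteq> (\<Union>x. ball x (\<delta> x))" using \<delta>(1) by (meson UNIV_I UN_I centre_in_ball subsetI)
  qed auto
  have ne: "F \<noteq> {}" using F(2) by auto
  have "\<bar>winding \<psi> n u - winding \<phi> n v\<bar> \<le> 18"
    if \<psi>: "\<psi> \<in> mspace P" "mdist P \<phi> \<psi> < Min (\<delta> ` F)" and uv: "p u = p v" for \<psi> u v
  proof -
    have "p u \<in> (\<Union>x\<in>F. ball x (\<delta> x))" using F(2) by blast
    then obtain x where x: "x \<in> F" "dist (p u) x < \<delta> x" by (auto simp: dist_commute)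
    obtain w where w: "p w = x" using fibre_nonempty by blast
    have "mdist P \<phi> \<psi> < \<delta> x" using \<psi>(2) F(1) x(1) by (auto dest!: Min_gr_iff[THEN iffD1, rotated 2])
    then have "\<bar>winding \<psi> n u - winding \<phi> n w\<bar> \<le> 9" using \<delta>(2) \<psi>(1) x(2) w by blast
    moreover have "\<bar>winding \<phi> n v - winding \<phi> n w\<bar> \<le> 9"
      using \<delta>(2)[OF \<phi> _ _ w, of v] x(2) uv \<delta>(1)[of x] Metric_space.mdist_zero[OF Metric_space_mspace_mdist \<phi>] by simp
    ultimately show ?thesis by linarith
  qed
  moreover have "Min (\<delta> ` F) > 0" using F(1) ne \<delta>(1) by simp
  ultimately show ?thesis using that by blast
qed

end

section \<open>Uniform boundedness\<close>

text \<open>Banach-Steinhaus for functionals. The closed sets \<open>F m\<close> cover the space, so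
  by Baire one of them contains a ball of radius \<open>r\<close> around some \<open>f0\<close>;
  subtracting the value at \<open>f0\<close> and rescaling gives the bound
  \<open>2 m / r\<close>.\<close>

lemma uniform_boundedness:
  fixes J :: "nat \<Rightarrow> 'a::{real_normed_vector,complete_space} \<Rightarrow> real"
  assumes J: "\<And>k. bounded_linear (J k)" and ptw: "\<And>f. \<exists>B. \<forall>k. \<bar>J k f\<bar> \<le> B"
  obtains M where "\<And>k f. \<bar>J k f\<bar> \<le> M * norm f"
proof -
  define F where "F m = {f. \<forall>k. \<bar>J k f\<bar> \<le> real m}" for m
  have cl: "closed (F m)" for m
    unfolding F_def
    by (intro closed_Collect_all closed_Collect_le continuous_intros
        linear_continuous_on[OF J, THEN continuous_on_rabs]) 
  have "(\<Union>m. F m) = UNIV"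
  proof -
    have "\<exists>m. f \<in> F m" for f
    proof -
      obtain B where "\<forall>k. \<bar>J k f\<bar> \<le> B" using ptw by blast
      moreover obtain m :: nat where "B \<le> real m" using real_arch_simple by blast
      ultimately show ?thesis unfolding F_def using order_trans by blast
    qed
    then show ?thesis by blast
  qed
  moreover have "Met_TC.mcomplete TYPE('a)" by (simp add: complete_UNIV)
  ultimately have "\<exists>m. interior (F m) \<noteq> {}"
    using Met_TC.metric_Baire_category_alt[of "range F"] cl by force
  then obtain m f0 where "f0 \<in> interior (F m)" by blast
  then obtain r where r: "r > 0" "cball f0 r \<subseteq> F m" unfolding mem_interior_cball by blast
  have "\<bar>J k f\<bar> \<le> (2 * real m / r) * norm f" for k f
  proof (cases "f = 0")
    case True then show ?thesis using linear_0[OF bounded_linear.linear[OF J[of k]]] by simp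
  next
    case False
    define g where "g = (r / norm f) *\<^sub>R f"
    have "f0 + g \<in> cball f0 r" "f0 \<in> cball f0 r" using r(1) False by (simp_all add: g_def dist_norm)
    then have "\<bar>J k (f0 + g)\<bar> \<le> real m" "\<bar>J k f0\<bar> \<le> real m" using r(2) unfolding F_def by blast+
    moreover have "J k (f0 + g) = J k f0 + (r / norm f) * J k f"
      unfolding g_def using J[of k] by (simp add: linear_simps)
    ultimately have "\<bar>(r / norm f) * J k f\<bar> \<le> 2 * real m" by linarith
    then have "(r / norm f) * \<bar>J k f\<bar> \<le> 2 * real m" using r(1) by (simp add: abs_mult)
    then show ?thesis using r(1) False by (simp add: field_simps)
  qed
  then show ?thesis using that by blast
qed

section \<open>Integration against signed measures\<close>

text \<open>A bound \<open>M\<close> for the norm of \<mu> as a functional on continuous functions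
  with the supremum norm. This form is common to the total variation and to what uniform boundedness
  yields.\<close>

definition integral_bound :: "('x::topological_space set \<Rightarrow> real) \<Rightarrow> real \<Rightarrow> bool" where
  "integral_bound \<mu> M \<longleftrightarrow> (\<forall>f c. continuous_on UNIV f \<longrightarrow> (\<forall>x. \<bar>f x\<bar> \<le> c) \<longrightarrow> \<bar>signed_integral \<mu> f\<bar> \<le> M * c)"

lemma integral_boundD:
  "integral_bound \<mu> M \<Longrightarrow> continuous_on UNIV f \<Longrightarrow> (\<And>x. \<bar>f x\<bar> \<le> c) \<Longrightarrow> \<bar>signed_integral \<mu> f\<bar> \<le> M * c"
  by (simp add: integral_bound_def)

context
  fixes \<mu> :: "'x::metric_space set \<Rightarrow> real"
  assumes \<mu>: "\<mu> \<in> signed_measures" and compact_UNIV: "compact (UNIV :: 'x set)"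
begin

lemma continuous_integrable_parts:
  assumes f: "continuous_on UNIV f"
  shows "integrable (positive_part \<mu>) (f :: 'x \<Rightarrow> real)" "integrable (negative_part \<mu>) f"
proof -
  obtain K where K: "\<And>x. \<bar>f x\<bar> \<le> K" using compact_UNIV_bounded[OF compact_UNIV f] by blast
  have m: "f \<in> borel_measurable borel" by (rule borel_measurable_continuous_onI[OF f])
  show "integrable (positive_part \<mu>) f"
    using K m by (intro finite_measure.integrable_const_bound[OF finite_measure_positive_part[OF \<mu>], of _ K]) auto
  show "integrable (negative_part \<mu>) f"
    using K m by (intro finite_measure.integrable_const_bound[OF finite_measure_negative_part[OF \<mu>], of _ K]) auto
qed

lemma signed_integral_add:
  assumes "continuous_on UNIV f" "continuous_on UNIV g"
  shows "signed_integral \<mu> (\<lambda>x. f x + g x) = signed_integral \<mu> f + signed_integral \<mu> g"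
  using continuous_integrable_parts[OF assms(1)] continuous_integrable_parts[OF assms(2)]
  by (simp add: signed_integral_def)

lemma signed_integral_diff:
  assumes "continuous_on UNIV f" "continuous_on UNIV g"
  shows "signed_integral \<mu> (\<lambda>x. f x - g x) = signed_integral \<mu> f - signed_integral \<mu> g"
  using continuous_integrable_parts[OF assms(1)] continuous_integrable_parts[OF assms(2)]
  by (simp add: signed_integral_def)

lemma signed_integral_mult:
  "signed_integral \<mu> (\<lambda>x. c * f x) = c * signed_integral \<mu> f"
  by (simp add: signed_integral_def right_diff_distrib)

lemma integral_bound_total_variation:
  "integral_bound \<mu> (measure (total_variation \<mu>) UNIV)"
  unfolding integral_bound_def
proof (intro allI impI)
  fix f :: "'x \<Rightarrow> real" and c assume f: "continuous_on UNIV f" and c: "\<forall>x. \<bar>f x\<bar> \<le> c"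
  interpret p: finite_measure "positive_part \<mu>" by (rule finite_measure_positive_part[OF \<mu>])
  interpret n: finite_measure "negative_part \<mu>" by (rule finite_measure_negative_part[OF \<mu>])
  have "\<bar>integral\<^sup>L (positive_part \<mu>) f\<bar> \<le> (\<integral>x. c \<partial>positive_part \<mu>)"
    using c continuous_integrable_parts[OF f]
    by (intro order_trans[OF integral_abs_bound integral_mono]) auto
  moreover have "\<bar>integral\<^sup>L (negative_part \<mu>) f\<bar> \<le> (\<integral>x. c \<partial>negative_part \<mu>)"
    using c continuous_integrable_parts[OF f]
    by (intro order_trans[OF integral_abs_bound integral_mono]) auto
  moreover have "measure (total_variation \<mu>) UNIV = measure (positive_part \<mu>) UNIV + measure (negative_part \<mu>) UNIV"
  proof (rule measure_eq_emeasure_eq_ennreal)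
    have "emeasure (total_variation \<mu>) UNIV = ennreal (measure (positive_part \<mu>) UNIV) + ennreal (measure (negative_part \<mu>) UNIV)"
      unfolding p.emeasure_eq_measure[symmetric] n.emeasure_eq_measure[symmetric]
      by (rule emeasure_total_variation) simp
    then show "emeasure (total_variation \<mu>) UNIV = ennreal (measure (positive_part \<mu>) UNIV + measure (negative_part \<mu>) UNIV)"
      by (simp add: ennreal_plus)
  qed simp
  ultimately show "\<bar>signed_integral \<mu> f\<bar> \<le> measure (total_variation \<mu>) UNIV * c"
    unfolding signed_integral_def by (simp add: ring_distribs)
qed

end

text \<open>Convergence of the integrals bounds the functionals pointwise on the Banach space of
  bounded continuous functions, to which Banach-Steinhaus applies.\<close>

lemma signed_measures_uniform_bound:
  fixes \<mu> :: "nat \<Rightarrow> 'x::metric_space set \<Rightarrow> real"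
  assumes \<mu>: "\<And>k. \<mu> k \<in> signed_measures" and compact: "compact (UNIV :: 'x set)"
    and ptw: "\<And>f. continuous_on UNIV f \<Longrightarrow> convergent (\<lambda>k. signed_integral (\<mu> k) f)"
  obtains M where "M \<ge> 0" "\<And>k. integral_bound (\<mu> k) M"
proof -
  define J where "J k f = signed_integral (\<mu> k) (apply_bcontfun f)" for k and f :: "'x \<Rightarrow>\<^sub>C real"
  note cont = continuous_on_apply_bcontfun[of UNIV]
  have "bounded_linear (J k)" for k
  proof (rule bounded_linear_intro[where K = "measure (total_variation (\<mu> k)) UNIV"])
    show "J k (f + g) = J k f + J k g" for f g
      using signed_integral_add[OF \<mu> compact cont cont] by (simp add: J_def)
    show "J k (r *\<^sub>R f) = r *\<^sub>R J k f" for r f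
      using signed_integral_mult[OF \<mu> compact, where c = r] by (simp add: J_def)
    show "norm (J k f) \<le> norm f * measure (total_variation (\<mu> k)) UNIV" for f
      using integral_boundD[OF integral_bound_total_variation[OF \<mu> compact] cont, of f "norm f"] norm_bounded[of f]
      by (simp add: J_def mult.commute)
  qed
  moreover have "\<exists>B. \<forall>k. \<bar>J k f\<bar> \<le> B" for f
    using convergent_imp_Bseq[OF ptw[OF cont[of f]]] by (auto simp: J_def Bseq_def)
  ultimately obtain M where M: "\<And>k f. \<bar>J k f\<bar> \<le> M * norm f"
    using uniform_boundedness[of J] by blast
  have "integral_bound (\<mu> k) (max M 0)" for k
    unfolding integral_bound_def
  proof (intro allI impI)
    fix f :: "'x \<Rightarrow> real" and c assume f: "continuous_on UNIV f" and c: "\<forall>x. \<bar>f x\<bar> \<le> c"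
    have fb: "f \<in> bcontfun" using f c by (intro bcontfun_normI[of f c]) auto
    have "norm (Bcontfun f) \<le> c"
      by (rule norm_bound) (use c fb in \<open>simp add: Bcontfun_inverse\<close>)
    have "\<bar>signed_integral (\<mu> k) f\<bar> \<le> M * norm (Bcontfun f)"
      using M[of k "Bcontfun f"] by (simp add: J_def Bcontfun_inverse[OF fb])
    also have "\<dots> \<le> max M 0 * norm (Bcontfun f)" by (intro mult_right_mono) auto
    also have "\<dots> \<le> max M 0 * c" using \<open>norm (Bcontfun f) \<le> c\<close> by (intro mult_left_mono) auto
    finally show "\<bar>signed_integral (\<mu> k) f\<bar> \<le> max M 0 * c" .
  qed
  then show ?thesis using that[of "max M 0"] by simp
qed

lemma topspace_weak_star: "topspace (weak_star_topology T) = invariant_signed_measures T"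
  by (auto simp: weak_star_topology_def topspace_pullback_topology)

lemma continuous_map_signed_integral:
  assumes f: "continuous_on UNIV f"
  shows "continuous_map (weak_star_topology T) euclideanreal (\<lambda>\<mu>. signed_integral \<mu> f)"
proof -
  have "continuous_map (weak_star_topology T) euclideanreal
      ((\<lambda>g. g f) \<circ> (\<lambda>\<mu>. restrict (signed_integral \<mu>) {f. continuous_on UNIV f}))"
    unfolding weak_star_topology_def
    by (intro continuous_map_pullback continuous_map_product_projection) (use f in simp)
  then show ?thesis using f by (simp add: o_def)
qed

section \<open>Rotation numbers\<close>

text \<open>\<open>g\<close> is a weighted mean of finitely many values of \<open>b\<close>, with
  tent functions as weights. At \<open>y\<close> only centres \<open>x\<close> with
  \<open>dist y x < \<delta> x\<close> have positive weight, and for these \<open>b x\<close> is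
  within \<open>C\<close> of \<open>b y\<close>.\<close>

lemma continuous_regularisation:
  fixes b :: "'x::metric_space \<Rightarrow> real"
  assumes compact: "compact (UNIV :: 'x set)"
    and loc: "\<And>x. \<exists>\<delta>>0. \<forall>y. dist y x < \<delta> \<longrightarrow> \<bar>b y - b x\<bar> \<le> C"
  obtains g where "continuous_on UNIV g" "\<And>x. \<bar>g x - b x\<bar> \<le> C"
proof -
  obtain \<delta> where \<delta>: "\<And>x. \<delta> x > 0" "\<And>x y. dist y x < \<delta> x \<Longrightarrow> \<bar>b y - b x\<bar> \<le> C"
    using loc by metis
  obtain F where F: "finite F" "UNIV \<subseteq> (\<Union>x\<in>F. ball x (\<delta> x))"
  proof (rule compactE_image[OF compact, of UNIV "\<lambda>x. ball x (\<delta> x)"])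
    show "UNIV \<subseteq> (\<Union>x. ball x (\<delta> x))" using \<delta>(1) by (meson UNIV_I UN_I centre_in_ball subsetI)
  qed auto
  define \<eta> where "\<eta> x y = max 0 (\<delta> x - dist y x)" for x y
  define s where "s y = (\<Sum>x\<in>F. \<eta> x y)" for y
  have \<eta>0: "\<eta> x y \<ge> 0" for x y by (simp add: \<eta>_def)
  have spos: "s y > 0" for y
  proof -
    have "y \<in> (\<Union>x\<in>F. ball x (\<delta> x))" using F(2) by blast
    then obtain x where x: "x \<in> F" "dist y x < \<delta> x" by (auto simp: dist_commute)
    have "0 < \<eta> x y" using x(2) by (simp add: \<eta>_def)
    also have "\<dots> \<le> s y" unfolding s_def using F(1) x(1) \<eta>0 by (intro member_le_sum) auto
    finally show ?thesis .
  qed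
  define g where "g y = (\<Sum>x\<in>F. \<eta> x y * b x) / s y" for y
  have "continuous_on UNIV g"
    unfolding g_def s_def \<eta>_def using spos[unfolded s_def \<eta>_def]
    by (intro continuous_intros) (auto simp: less_le)
  moreover have "\<bar>g y - b y\<bar> \<le> C" for y
  proof -
    have "g y - b y = ((\<Sum>x\<in>F. \<eta> x y * b x) - s y * b y) / s y"
      using spos[of y] by (simp add: g_def field_simps)
    also have "(\<Sum>x\<in>F. \<eta> x y * b x) - s y * b y = (\<Sum>x\<in>F. \<eta> x y * (b x - b y))"
      by (simp add: s_def sum_distrib_right sum_subtractf right_diff_distrib)
    also have "\<bar>(\<Sum>x\<in>F. \<eta> x y * (b x - b y)) / s y\<bar> \<le> (\<Sum>x\<in>F. \<eta> x y * C) / s y"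
    proof -
      have "\<bar>\<Sum>x\<in>F. \<eta> x y * (b x - b y)\<bar> \<le> (\<Sum>x\<in>F. \<eta> x y * C)"
      proof (rule order_trans[OF sum_abs], rule sum_mono)
        fix x
        show "\<bar>\<eta> x y * (b x - b y)\<bar> \<le> \<eta> x y * C"
        proof (cases "dist y x < \<delta> x")
          case True
          then show ?thesis using \<delta>(2)[OF True] \<eta>0[of x y]
            by (simp add: abs_mult abs_minus_commute mult_left_mono)
        qed (simp add: \<eta>_def)
      qed
      then show ?thesis using spos[of y] by (simp add: divide_right_mono)
    qed
    also have "\<dots> = C" using spos[of y] by (simp add: s_def sum_distrib_right[symmetric])
    finally show ?thesis .
  qed
  ultimately show ?thesis using that by blast
qed

context circle_bundle_dynamics
begin

text \<open>12 = 9 + 3: the oscillation allowed near a base point, and the change of point within a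
  fibre.\<close>

definition mean_winding :: "(real \<Rightarrow> 'e \<Rightarrow> 'e) \<Rightarrow> nat \<Rightarrow> 'x \<Rightarrow> real" where
  "mean_winding \<phi> n = (SOME g. continuous_on UNIV g \<and> (\<forall>u. \<bar>g (p u) - winding \<phi> n u\<bar> \<le> 12))"

lemma mean_winding:
  assumes \<phi>: "\<phi> \<in> mspace P"
  shows "continuous_on UNIV (mean_winding \<phi> n)" "\<bar>mean_winding \<phi> n (p u) - winding \<phi> n u\<bar> \<le> 12"
proof -
  define b where "b x = winding \<phi> n (SOME u. p u = x)" for x
  have some: "p (SOME u. p u = x) = x" for x by (rule someI_ex[OF fibre_nonempty])
  have "\<exists>\<delta>>0. \<forall>y. dist y x < \<delta> \<longrightarrow> \<bar>b y - b x\<bar> \<le> 9" for x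
  proof -
    obtain \<delta> where \<delta>: "\<delta> > 0" "\<forall>\<psi>\<in>mspace P. mdist P \<phi> \<psi> < \<delta> \<longrightarrow>
      (\<forall>u v. dist (p u) x < \<delta> \<longrightarrow> p v = x \<longrightarrow> \<bar>winding \<psi> n u - winding \<phi> n v\<bar> \<le> 9)"
      using winding_locally_close[OF \<phi>] by blast
    have "mdist P \<phi> \<phi> < \<delta>"
      using Metric_space.mdist_zero[OF Metric_space_mspace_mdist \<phi>] \<delta>(1) by simp
    then have close: "\<And>u v. dist (p u) x < \<delta> \<Longrightarrow> p v = x \<Longrightarrow> \<bar>winding \<phi> n u - winding \<phi> n v\<bar> \<le> 9"
      using \<delta>(2) \<phi> by blast
    show ?thesis
    proof (intro exI[of _ \<delta>] conjI allI impI)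
      fix y assume "dist y x < \<delta>"
      then show "\<bar>b y - b x\<bar> \<le> 9" unfolding b_def by (intro close) (simp_all add: some)
    qed (rule \<delta>(1))
  qed
  then obtain g where g: "continuous_on UNIV g" "\<And>x. \<bar>g x - b x\<bar> \<le> 9"
    using continuous_regularisation[OF compact_base, of b 9] by blast
  have "\<bar>g (p u) - winding \<phi> n u\<bar> \<le> 12" for u
    using g(2)[of "p u"] winding_same_fibre[OF skew_path_family[OF \<phi>] some[of "p u"], of n]
    unfolding b_def by linarith
  then have ex: "\<exists>g. continuous_on UNIV g \<and> (\<forall>u. \<bar>g (p u) - winding \<phi> n u\<bar> \<le> 12)" using g(1) by blast
  from someI_ex[OF ex] show "continuous_on UNIV (mean_winding \<phi> n)"
    "\<bar>mean_winding \<phi> n (p u) - winding \<phi> n u\<bar> \<le> 12"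
    unfolding mean_winding_def[symmetric] by blast+
qed

text \<open>41 = 3 * 12 + 5: three passages from the mean to the winding at a point, and the error
  of \<open>winding_almost_additive\<close>. All points over \<open>(T ^^ n) x\<close> serve
  equally, in particular \<open>(\<phi> b ^^ n) u\<close>.\<close>

lemma almost_additive_mean_winding:
  assumes \<phi>: "\<phi> \<in> mspace P"
  shows "almost_additive T (mean_winding \<phi>) 41"
proof
  show "compact (UNIV :: 'x set)" by (rule compact_base)
  show "continuous_on UNIV T" by (rule continuous_T)
  show "continuous_on UNIV (mean_winding \<phi> n)" for n by (rule mean_winding(1)[OF \<phi>])
  fix n m x
  note f = skew_path_family[OF \<phi>]
  obtain u where u: "p u = x" using fibre_nonempty by blast
  have v: "p ((\<phi> b ^^ n) u) = (T ^^ n) x"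
    using skew_map_funpow_fibre[OF skew_family_maps[OF f]] a_le_b u by simp
  show "\<bar>mean_winding \<phi> (n + m) x - mean_winding \<phi> n x - mean_winding \<phi> m ((T ^^ n) x)\<bar> \<le> 41"
    using mean_winding(2)[OF \<phi>, of "n + m" u] mean_winding(2)[OF \<phi>, of n u]
      mean_winding(2)[OF \<phi>, of m "(\<phi> b ^^ n) u"] winding_almost_additive[OF f, of n m u]
    unfolding u v by linarith
qed

section \<open>Existence, measurability and invariance of the rotation number\<close>

abbreviation D where "D \<equiv> rotation_domain p ori d T a b"
abbreviation \<rho> where "\<rho> \<equiv> rotation_number p ori d T a b"
abbreviation R where "R \<equiv> (\<lambda>(\<mu>, \<phi>). mean_rotation_number p ori d T a b \<mu> \<phi>)"

lemma has_rotation_number_iff: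
  assumes \<phi>: "\<phi> \<in> mspace P"
  shows "has_rotation_number p ori d T a b \<phi> x r \<longleftrightarrow> (\<lambda>n. mean_winding \<phi> n x / real n) \<longlonglongrightarrow> r"
proof -
  have eq: "has_rotation_number p ori d T a b \<phi> x r \<longleftrightarrow> (\<forall>u. p u = x \<longrightarrow> (\<lambda>n. winding \<phi> n u / real n) \<longlonglongrightarrow> r)"
    by (auto simp: has_rotation_number_def winding_def)
  have close: "\<bar>mean_winding \<phi> n (p u) - winding \<phi> n u\<bar> \<le> 12" "\<bar>winding \<phi> n u - mean_winding \<phi> n (p u)\<bar> \<le> 12" for n u
    using mean_winding(2)[OF \<phi>, of n u] by (simp_all add: abs_minus_commute)
  show ?thesis
  proof
    assume *: "has_rotation_number p ori d T a b \<phi> x r"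
    obtain u where u: "p u = x" using fibre_nonempty by blast
    then have "(\<lambda>n. winding \<phi> n u / real n) \<longlonglongrightarrow> r" using * eq by blast
    then show "(\<lambda>n. mean_winding \<phi> n x / real n) \<longlonglongrightarrow> r"
      unfolding u[symmetric] by (rule LIMSEQ_div_if_bounded_diff[of 0, rotated]) (rule close)
  next
    assume *: "(\<lambda>n. mean_winding \<phi> n x / real n) \<longlonglongrightarrow> r"
    show "has_rotation_number p ori d T a b \<phi> x r"
      unfolding eq
    proof (intro allI impI)
      fix u assume "p u = x"
      with * have "(\<lambda>n. mean_winding \<phi> n (p u) / real n) \<longlonglongrightarrow> r" by simp
      then show "(\<lambda>n. winding \<phi> n u / real n) \<longlonglongrightarrow> r"
        by (rule LIMSEQ_div_if_bounded_diff[of 0, rotated]) (rule close)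
    qed
  qed
qed

lemma mem_D_iff:
  assumes \<phi>: "\<phi> \<in> mspace P"
  shows "x \<in> D \<phi> \<longleftrightarrow> convergent (\<lambda>n. mean_winding \<phi> n x / real n)"
  by (simp add: rotation_domain_def has_rotation_number_iff[OF \<phi>] convergent_def)

lemma rotation_number_eq:
  assumes \<phi>: "\<phi> \<in> mspace P" and lim: "(\<lambda>n. mean_winding \<phi> n x / real n) \<longlonglongrightarrow> r"
  shows "\<rho> \<phi> x = r"
proof -
  have "x \<in> D \<phi>" using lim by (auto simp: mem_D_iff[OF \<phi>] convergent_def)
  moreover have "(THE r. has_rotation_number p ori d T a b \<phi> x r) = r"
    unfolding has_rotation_number_iff[OF \<phi>] using lim LIMSEQ_unique by blast
  ultimately show ?thesis by (simp add: rotation_number_def)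
qed

lemma LIMSEQ_rotation_number:
  assumes \<phi>: "\<phi> \<in> mspace P" and x: "x \<in> D \<phi>"
  shows "(\<lambda>n. mean_winding \<phi> n x / real n) \<longlonglongrightarrow> \<rho> \<phi> x"
  using x rotation_number_eq[OF \<phi>] by (auto simp: mem_D_iff[OF \<phi>] convergent_def)

lemma mean_winding_measurable:
  "\<phi> \<in> mspace P \<Longrightarrow> mean_winding \<phi> n \<in> borel_measurable borel"
  by (intro borel_measurable_continuous_onI mean_winding)

lemma D_borel:
  assumes \<phi>: "\<phi> \<in> mspace P" shows "D \<phi> \<in> sets borel"
proof -
  have "D \<phi> = {x \<in> space borel. Cauchy (\<lambda>n. mean_winding \<phi> n x / real n)}"
    using mem_D_iff[OF \<phi>] by (auto simp: Cauchy_convergent_iff)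
  then show ?thesis
    by (simp only:) (intro sets_Collect_Cauchy borel_measurable_divide mean_winding_measurable[OF \<phi>] borel_measurable_const)
qed

text \<open>With the dummy value 0, the function is a limit of continuous functions on a Borel set
  and constant elsewhere, hence Borel on the whole base and fit for integration there.\<close>

lemma rotation_number_measurable:
  assumes \<phi>: "\<phi> \<in> mspace P" shows "\<rho> \<phi> \<in> borel_measurable borel"
proof -
  have "\<rho> \<phi> = (\<lambda>x. if x \<in> D \<phi> then lim (\<lambda>n. mean_winding \<phi> n x / real n) else 0)"
  proof
    fix x
    show "\<rho> \<phi> x = (if x \<in> D \<phi> then lim (\<lambda>n. mean_winding \<phi> n x / real n) else 0)"
      using limI[OF LIMSEQ_rotation_number[OF \<phi>, of x]] by (simp add: rotation_number_def)
  qed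
  moreover have "(\<lambda>x. lim (\<lambda>n. mean_winding \<phi> n x / real n)) \<in> borel_measurable borel"
    by (intro borel_measurable_lim_metric borel_measurable_divide mean_winding_measurable[OF \<phi>] borel_measurable_const)
  ultimately show ?thesis using D_borel[OF \<phi>] by (simp add: measurable_If_set)
qed

lemma rotation_number_bounded:
  assumes \<phi>: "\<phi> \<in> mspace P" shows "\<exists>K. \<forall>x\<in>D \<phi>. \<bar>\<rho> \<phi> x\<bar> \<le> K"
proof -
  interpret almost_additive T "mean_winding \<phi>" 41 by (rule almost_additive_mean_winding[OF \<phi>])
  obtain K where K: "\<And>n x. \<bar>mean_winding \<phi> n x / real n\<bar> \<le> K" using a_linear_growth by metis
  have "\<bar>\<rho> \<phi> x\<bar> \<le> K" if "x \<in> D \<phi>" for x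
    by (rule LIMSEQ_le_const2[OF tendsto_rabs[OF LIMSEQ_rotation_number[OF \<phi> that]]]) (use K in blast)
  then show ?thesis by blast
qed

lemma rotation_number_invariant:
  assumes \<phi>: "\<phi> \<in> mspace P"
  shows "T x \<in> D \<phi> \<longleftrightarrow> x \<in> D \<phi>" "x \<in> D \<phi> \<Longrightarrow> \<rho> \<phi> (T x) = \<rho> \<phi> x"
proof -
  interpret almost_additive T "mean_winding \<phi>" 41 by (rule almost_additive_mean_winding[OF \<phi>])
  show "T x \<in> D \<phi> \<longleftrightarrow> x \<in> D \<phi>" by (simp add: mem_D_iff[OF \<phi>] convergent_def LIMSEQ_T_iff)
  assume "x \<in> D \<phi>"
  then show "\<rho> \<phi> (T x) = \<rho> \<phi> x"
    by (intro rotation_number_eq[OF \<phi>]) (simp add: LIMSEQ_T_iff LIMSEQ_rotation_number[OF \<phi>])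
qed

lemma rotation_number_homotopic:
  assumes \<phi>: "\<phi> \<in> mspace P" and \<psi>: "\<psi> \<in> mspace P" and hom: "homotopic_skew_paths p ori T a b \<phi> \<psi>"
  shows "D \<psi> = D \<phi>" "\<rho> \<psi> x = \<rho> \<phi> x"
proof -
  \<comment> \<open>26 = 12 + 12 + 2, the last summand from
    \<open>winding_homotopic\<close>.\<close>
  have close: "\<bar>mean_winding \<phi> n x - mean_winding \<psi> n x\<bar> \<le> 26" for n x
  proof -
    obtain u where u: "p u = x" using fibre_nonempty by blast
    show ?thesis
      using mean_winding(2)[OF \<phi>, of n u] mean_winding(2)[OF \<psi>, of n u] winding_homotopic[OF hom, of n u]
      unfolding u by linarith
  qed
  then have close': "\<bar>mean_winding \<psi> n x - mean_winding \<phi> n x\<bar> \<le> 26" for n x by (simp add: abs_minus_commute)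
  have iff: "(\<lambda>n. mean_winding \<psi> n x / real n) \<longlonglongrightarrow> r \<longleftrightarrow> (\<lambda>n. mean_winding \<phi> n x / real n) \<longlonglongrightarrow> r" for x r
    using LIMSEQ_div_if_bounded_diff[of 0 "\<lambda>n. mean_winding \<psi> n x" "\<lambda>n. mean_winding \<phi> n x", OF close']
      LIMSEQ_div_if_bounded_diff[of 0 "\<lambda>n. mean_winding \<phi> n x" "\<lambda>n. mean_winding \<psi> n x", OF close] by blast
  have hiff: "has_rotation_number p ori d T a b \<psi> x = has_rotation_number p ori d T a b \<phi> x" for x
    by (rule ext) (simp add: has_rotation_number_iff \<phi> \<psi> iff)
  show "D \<psi> = D \<phi>" by (simp add: rotation_domain_def hiff)
  then show "\<rho> \<psi> x = \<rho> \<phi> x" by (simp add: rotation_number_def hiff)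
qed

section \<open>The mean rotation number and its continuity\<close>

lemma T_borel: "T \<in> borel_measurable borel"
  by (rule borel_measurable_continuous_onI[OF continuous_T])

lemma almost_additive_measure_parts:
  assumes \<phi>: "\<phi> \<in> mspace P" and \<mu>: "\<mu> \<in> invariant_signed_measures T"
  shows "almost_additive_measure T (mean_winding \<phi>) 41 (positive_part \<mu>)"
    and "almost_additive_measure T (mean_winding \<phi>) 41 (negative_part \<mu>)"
proof -
  have s: "\<mu> \<in> signed_measures" using \<mu> by (simp add: invariant_signed_measures_def)
  have m: "measurable (positive_part \<mu>) (positive_part \<mu>) = borel_measurable borel"
    "measurable (negative_part \<mu>) (negative_part \<mu>) = borel_measurable borel"
    by (intro measurable_cong_sets; simp)+
  show "almost_additive_measure T (mean_winding \<phi>) 41 (positive_part \<mu>)"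
    by (intro almost_additive_measure.intro almost_additive_mean_winding[OF \<phi>] finite_measure_preserving.intro
        finite_measure_positive_part[OF s] finite_measure_preserving_axioms.intro
        almost_additive_measure_axioms.intro distr_positive_part[OF \<mu> T_borel]) (simp_all add: m T_borel)
  show "almost_additive_measure T (mean_winding \<phi>) 41 (negative_part \<mu>)"
    by (intro almost_additive_measure.intro almost_additive_mean_winding[OF \<phi>] finite_measure_preserving.intro
        finite_measure_negative_part[OF s] finite_measure_preserving_axioms.intro
        almost_additive_measure_axioms.intro distr_negative_part[OF \<mu> T_borel]) (simp_all add: m T_borel)
qed

lemma AE_D_parts:
  assumes \<phi>: "\<phi> \<in> mspace P" and \<mu>: "\<mu> \<in> invariant_signed_measures T"
  shows "AE x in positive_part \<mu>. x \<in> D \<phi>" "AE x in negative_part \<mu>. x \<in> D \<phi>"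
  unfolding mem_D_iff[OF \<phi>]
  using almost_additive_measure_parts[OF \<phi> \<mu>] by (auto intro: almost_additive_measure.AE_convergent)

abbreviation pot :: "(real \<Rightarrow> 'e \<Rightarrow> 'e) \<Rightarrow> nat \<Rightarrow> 'x \<Rightarrow> real" where
  "pot \<phi> \<equiv> almost_additive.potential T (mean_winding \<phi>)"

text \<open>The freedom in \<open>j\<close> is the point: \<open>j = 0\<close> gives one continuous
  test function for the weak-* topology, a large \<open>j\<close> makes the comparison of two paths
  precise.\<close>

lemma mean_rotation_number_eq:
  assumes \<phi>: "\<phi> \<in> mspace P" and \<mu>: "\<mu> \<in> invariant_signed_measures T"
  shows "mean_rotation_number p ori d T a b \<mu> \<phi> = signed_integral \<mu> (pot \<phi> j)"
proof -
  have 1: "AE x in positive_part \<mu>. (\<lambda>n. mean_winding \<phi> n x / real n) \<longlonglongrightarrow> \<rho> \<phi> x"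
    using AE_D_parts(1)[OF \<phi> \<mu>] by eventually_elim (rule LIMSEQ_rotation_number[OF \<phi>])
  have 2: "AE x in negative_part \<mu>. (\<lambda>n. mean_winding \<phi> n x / real n) \<longlonglongrightarrow> \<rho> \<phi> x"
    using AE_D_parts(2)[OF \<phi> \<mu>] by eventually_elim (rule LIMSEQ_rotation_number[OF \<phi>])
  have m: "\<rho> \<phi> \<in> borel_measurable (positive_part \<mu>)" "\<rho> \<phi> \<in> borel_measurable (negative_part \<mu>)"
    using rotation_number_measurable[OF \<phi>] by simp_all
  note parts = almost_additive_measure_parts[OF \<phi> \<mu>]
  show ?thesis
    unfolding mean_rotation_number_def signed_integral_def
    using almost_additive_measure.integral_limit[OF parts(1) m(1) 1]
      almost_additive_measure.integral_limit[OF parts(2) m(2) 2]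
      almost_additive_measure.integral_potential[OF parts(1), of j]
      almost_additive_measure.integral_potential[OF parts(2), of j] by simp
qed

lemma continuous_pot: "\<phi> \<in> mspace P \<Longrightarrow> continuous_on UNIV (pot \<phi> j)"
  by (rule almost_additive.continuous_potential[OF almost_additive_mean_winding])

text \<open>Paths close to \<open>\<phi>\<close> have windings close to those of \<open>\<phi>\<close> up to time \<open>2 ^ j\<close>, and by almost
  additivity their rotation numbers can then only differ by a multiple of \<open>1 / 2 ^ j\<close>.\<close>

lemma mean_rotation_number_close:
  assumes \<phi>: "\<phi> \<in> mspace P" and e: "e > 0"
  obtains \<delta> where "\<delta> > 0" "\<And>\<psi> \<mu> M. \<psi> \<in> mspace P \<Longrightarrow> mdist P \<phi> \<psi> < \<delta> \<Longrightarrow>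
    \<mu> \<in> invariant_signed_measures T \<Longrightarrow> integral_bound \<mu> M \<Longrightarrow> \<bar>R (\<mu>, \<psi>) - R (\<mu>, \<phi>)\<bar> \<le> M * e"
proof -
  \<comment> \<open>124 = 42 + 41 + 41, where 42 = 18 + 12 + 12 compares the mean windings at time
    \<open>2 ^ j\<close> and each 41 comes from a defect tail; all are divided by
    \<open>2 ^ j\<close>.\<close>
  obtain j where j: "124 / e < 2 ^ j" using real_arch_pow[of 2 "124 / e"] by auto
  obtain \<delta> where \<delta>: "\<delta> > 0" "\<And>\<psi> u v. \<psi> \<in> mspace P \<Longrightarrow> mdist P \<phi> \<psi> < \<delta> \<Longrightarrow> p u = p v \<Longrightarrow>
    \<bar>winding \<psi> (2 ^ j) u - winding \<phi> (2 ^ j) v\<bar> \<le> 18"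
    using winding_close[OF \<phi>] by blast
  have "\<bar>R (\<mu>, \<psi>) - R (\<mu>, \<phi>)\<bar> \<le> M * e"
    if \<psi>: "\<psi> \<in> mspace P" "mdist P \<phi> \<psi> < \<delta>" and \<mu>: "\<mu> \<in> invariant_signed_measures T" and M: "integral_bound \<mu> M" for \<psi> \<mu> M
  proof -
    have s: "\<mu> \<in> signed_measures" using \<mu> by (simp add: invariant_signed_measures_def)
    have "\<bar>pot \<psi> j x - pot \<phi> j x\<bar> \<le> e" for x
    proof -
      interpret A: almost_additive T "mean_winding \<phi>" 41 by (rule almost_additive_mean_winding[OF \<phi>])
      interpret B: almost_additive T "mean_winding \<psi>" 41 by (rule almost_additive_mean_winding[OF \<psi>(1)])
      obtain u where u: "p u = x" using fibre_nonempty by blast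
      have "\<bar>mean_winding \<psi> (2 ^ j) x - mean_winding \<phi> (2 ^ j) x\<bar> \<le> 42"
        using \<delta>(2)[OF \<psi> refl, of u] mean_winding(2)[OF \<phi>, of "2 ^ j" u] mean_winding(2)[OF \<psi>(1), of "2 ^ j" u]
        unfolding u by linarith
      then have "\<bar>mean_winding \<psi> (2 ^ j) x - mean_winding \<phi> (2 ^ j) x\<bar> / 2 ^ j \<le> 42 / 2 ^ j"
        by (rule divide_right_mono) simp
      then have "\<bar>mean_winding \<psi> (2 ^ j) x / 2 ^ j - mean_winding \<phi> (2 ^ j) x / 2 ^ j\<bar> \<le> 42 / 2 ^ j"
        by (simp add: diff_divide_distrib[symmetric])
      moreover have "42 / 2 ^ j + 41 / 2 ^ j + 41 / 2 ^ j = (124 :: real) / 2 ^ j"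
        by (simp add: add_divide_distrib[symmetric])
      ultimately have "\<bar>pot \<psi> j x - pot \<phi> j x\<bar> \<le> 124 / 2 ^ j"
        using A.defect_tail_bound[of j x] B.defect_tail_bound[of j x]
        unfolding A.potential_def B.potential_def by linarith
      also have "\<dots> \<le> e" using j e by (simp add: field_simps)
      finally show ?thesis .
    qed
    then have "\<bar>signed_integral \<mu> (\<lambda>x. pot \<psi> j x - pot \<phi> j x)\<bar> \<le> M * e"
      by (intro integral_boundD[OF M] continuous_on_diff continuous_pot \<phi> \<psi>(1))
    then show ?thesis
      using signed_integral_diff[OF s compact_base continuous_pot[OF \<psi>(1)] continuous_pot[OF \<phi>]]
      by (simp add: mean_rotation_number_eq[OF \<phi> \<mu>, of j] mean_rotation_number_eq[OF \<psi>(1) \<mu>, of j])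
  qed
  then show ?thesis using \<delta>(1) that by blast
qed

lemma mean_rotation_number_continuous_measure:
  assumes \<phi>: "\<phi> \<in> mspace P"
  shows "continuous_map (weak_star_topology T) euclideanreal (\<lambda>\<mu>. R (\<mu>, \<phi>))"
  by (rule continuous_map_eq[OF continuous_map_signed_integral[OF continuous_pot[OF \<phi>, of 0]]])
    (simp add: topspace_weak_star mean_rotation_number_eq[OF \<phi>, of _ 0])

text \<open>The path is changed first, at the current measure \<mu>, with an error proportional to
  the common bound on the measures; then the measure is changed at the fixed path \<phi>, by weak-*
  continuity.\<close>

lemma mean_rotation_number_continuous_bounded:
  "continuous_map
     (prod_topology
        (subtopology (weak_star_topology T) {\<mu>. emeasure (total_variation \<mu>) UNIV \<le> ennreal K})
        (mtopology_of P))
     euclideanreal R"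
  (is "continuous_map (prod_topology ?W _) _ _")
  unfolding mtopology_is_euclidean[symmetric] Met_TC.continuous_map_to_metric
proof (intro ballI allI impI)
  fix z and e :: real
  assume z: "z \<in> topspace (prod_topology ?W (mtopology_of P))" and e: "0 < e"
  obtain \<mu>0 \<phi> where z_eq: "z = (\<mu>0, \<phi>)" by (cases z)
  have \<mu>0: "\<mu>0 \<in> topspace ?W" and \<phi>: "\<phi> \<in> mspace P" using z by (auto simp: z_eq)
  \<comment> \<open>For negative \<open>K\<close> the value \<open>ennreal K\<close> is 0, so the
    nonnegative number \<open>max K 0\<close> bounds the total variation in every case.\<close>
  define M where "M = max K 0"
  have bound: "integral_bound \<mu> M" and inv: "\<mu> \<in> invariant_signed_measures T" if "\<mu> \<in> topspace ?W" for \<mu>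
  proof -
    show \<mu>: "\<mu> \<in> invariant_signed_measures T" using that by (simp add: topspace_weak_star)
    then have "integral_bound \<mu> (measure (total_variation \<mu>) UNIV)"
      by (intro integral_bound_total_variation compact_base) (simp add: invariant_signed_measures_def)
    moreover have "emeasure (total_variation \<mu>) UNIV \<le> ennreal M"
      using that unfolding M_def by (auto intro: order_trans ennreal_leI)
    then have "measure (total_variation \<mu>) UNIV \<le> M"
      unfolding measure_def by (intro enn2real_leI) (simp_all add: M_def)
    moreover have "0 \<le> c" if "\<forall>x. \<bar>f x\<bar> \<le> c" for f :: "'x \<Rightarrow> real" and c using that by (meson abs_ge_zero order_trans)
    ultimately show "integral_bound \<mu> M"
      unfolding integral_bound_def by (meson mult_right_mono order_trans)
  qed
  \<comment> \<open>\<open>M + 1\<close> instead of \<open>M\<close> keeps the denominator positive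
    when \<open>M = 0\<close>.\<close>
  have "0 < e / (2 * (M + 1))" using e by (simp add: M_def)
  from mean_rotation_number_close[OF \<phi> this] obtain \<delta> where \<delta>: "\<delta> > 0"
    "\<And>\<psi> \<mu> M'. \<psi> \<in> mspace P \<Longrightarrow> mdist P \<phi> \<psi> < \<delta> \<Longrightarrow> \<mu> \<in> invariant_signed_measures T \<Longrightarrow> integral_bound \<mu> M' \<Longrightarrow>
      \<bar>R (\<mu>, \<psi>) - R (\<mu>, \<phi>)\<bar> \<le> M' * (e / (2 * (M + 1)))"
    by blast
  have "continuous_map ?W euclideanreal (\<lambda>\<mu>. R (\<mu>, \<phi>))"
    by (rule continuous_map_from_subtopology[OF mean_rotation_number_continuous_measure[OF \<phi>]])
  then have "\<exists>V. openin ?W V \<and> \<mu>0 \<in> V \<and> (\<forall>\<mu>\<in>V. R (\<mu>, \<phi>) \<in> Met_TC.mball (R (\<mu>0, \<phi>)) (e / 2))"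
    using \<mu>0 half_gt_zero[OF e]
    unfolding mtopology_is_euclidean[symmetric] Met_TC.continuous_map_to_metric by blast
  then obtain V where V: "openin ?W V" "\<mu>0 \<in> V" "\<And>\<mu>. \<mu> \<in> V \<Longrightarrow> \<bar>R (\<mu>, \<phi>) - R (\<mu>0, \<phi>)\<bar> < e / 2"
    unfolding mball_eq_ball mem_ball dist_real_def by (metis abs_minus_commute)
  let ?B = "Metric_space.mball (mspace P) (mdist P) \<phi> \<delta>"
  have "openin (prod_topology ?W (mtopology_of P)) (V \<times> ?B)"
    unfolding openin_prod_Times_iff mtopology_of_def
    using V(1) Metric_space.openin_mball[OF Metric_space_mspace_mdist, of P] by blast
  moreover have "z \<in> V \<times> ?B"
    using V(2) \<phi> \<delta>(1) by (simp add: z_eq Metric_space.centre_in_mball_iff[OF Metric_space_mspace_mdist])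
  moreover have "R y \<in> Met_TC.mball (R z) e" if y: "y \<in> V \<times> ?B" for y
  proof -
    obtain \<mu> \<psi> where y_eq: "y = (\<mu>, \<psi>)" by (cases y)
    have \<mu>: "\<mu> \<in> V" "\<mu> \<in> topspace ?W" using y openin_subset[OF V(1)] by (auto simp: y_eq)
    have \<psi>: "\<psi> \<in> mspace P" "mdist P \<phi> \<psi> < \<delta>"
      using y by (auto simp: y_eq Metric_space.in_mball[OF Metric_space_mspace_mdist])
    have "\<bar>R (\<mu>, \<psi>) - R (\<mu>, \<phi>)\<bar> \<le> M * (e / (2 * (M + 1)))"
      by (rule \<delta>(2)[OF \<psi> inv bound]) (rule \<mu>)+
    also have "\<dots> \<le> e / 2" using e by (simp add: M_def field_simps)
    finally have "\<bar>R y - R z\<bar> < e" using V(3)[OF \<mu>(1)] unfolding y_eq z_eq by linarith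
    then show ?thesis by (simp add: dist_real_def abs_minus_commute)
  qed
  ultimately show "\<exists>U. openin (prod_topology ?W (mtopology_of P)) U \<and> z \<in> U \<and> (\<forall>y\<in>U. R y \<in> Met_TC.mball (R z) e)"
    by blast
qed

text \<open>The path is changed first and then the measure, as in the bounded case; here the bound
  on the measures comes from uniform boundedness along the sequence.\<close>

lemma mean_rotation_number_continuous_sequence:
  assumes lim: "limitin (prod_topology (weak_star_topology T) (mtopology_of P)) \<sigma> l sequentially"
  shows "(\<lambda>k. R (\<sigma> k)) \<longlonglongrightarrow> R l"
proof -
  obtain \<mu> \<phi> where l: "l = (\<mu>, \<phi>)" by (cases l)
  have lim1: "limitin (weak_star_topology T) (fst \<circ> \<sigma>) \<mu> sequentially"
    and lim2: "limitin (mtopology_of P) (snd \<circ> \<sigma>) \<phi> sequentially"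
    using lim unfolding limitin_pairwise l by simp_all
  have \<phi>: "\<phi> \<in> mspace P" and lim2': "\<And>e. e > 0 \<Longrightarrow> \<forall>\<^sub>F k in sequentially. snd (\<sigma> k) \<in> mspace P \<and> mdist P (snd (\<sigma> k)) \<phi> < e"
    using lim2 unfolding mtopology_of_def Metric_space.limitin_metric[OF Metric_space_mspace_mdist] by auto
  have conv: "(\<lambda>k. signed_integral (fst (\<sigma> k)) f) \<longlonglongrightarrow> signed_integral \<mu> f" if "continuous_on UNIV f" for f
    using continuous_map_limit[OF continuous_map_signed_integral[OF that] lim1] by (simp add: o_def)
  have "\<forall>\<^sub>F k in sequentially. fst (\<sigma> k) \<in> invariant_signed_measures T"
    using lim1 openin_topspace[of "weak_star_topology T"] unfolding limitin_def topspace_weak_star by auto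
  then obtain N where N: "\<And>k. k \<ge> N \<Longrightarrow> fst (\<sigma> k) \<in> invariant_signed_measures T"
    unfolding eventually_sequentially by blast
  \<comment> \<open>Convergence places \<open>\<sigma> k\<close> in the space only for large
    \<open>k\<close>, so uniform boundedness is applied to the tail from \<open>N\<close>
    on.\<close>
  obtain M where M: "M \<ge> 0" "\<And>k. integral_bound (fst (\<sigma> (k + N))) M"
  proof (rule signed_measures_uniform_bound[OF _ compact_base, of "\<lambda>k. fst (\<sigma> (k + N))"])
    show "fst (\<sigma> (k + N)) \<in> signed_measures" for k
      using N[of "k + N"] by (simp add: invariant_signed_measures_def)
    show "convergent (\<lambda>k. signed_integral (fst (\<sigma> (k + N))) f)" if "continuous_on UNIV f" for f
      using LIMSEQ_ignore_initial_segment[OF conv[OF that]] by (auto simp: convergent_def)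
  qed blast
  have lim0: "(\<lambda>k. R (fst (\<sigma> k), \<phi>)) \<longlonglongrightarrow> R (\<mu>, \<phi>)"
    using continuous_map_limit[OF mean_rotation_number_continuous_measure[OF \<phi>] lim1] by (simp add: o_def)
  show ?thesis
    unfolding l
  proof (rule tendstoI)
    fix e :: real assume e: "0 < e"
    have "0 < e / (2 * (M + 1))" using e M(1) by simp
    from mean_rotation_number_close[OF \<phi> this] obtain \<delta> where \<delta>: "\<delta> > 0"
      "\<And>\<psi> \<mu> M'. \<psi> \<in> mspace P \<Longrightarrow> mdist P \<phi> \<psi> < \<delta> \<Longrightarrow> \<mu> \<in> invariant_signed_measures T \<Longrightarrow> integral_bound \<mu> M' \<Longrightarrow>
        \<bar>R (\<mu>, \<psi>) - R (\<mu>, \<phi>)\<bar> \<le> M' * (e / (2 * (M + 1)))"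
      by blast
    have "\<forall>\<^sub>F k in sequentially. dist (R (fst (\<sigma> k), \<phi>)) (R (\<mu>, \<phi>)) < e / 2"
      using tendstoD[OF lim0 half_gt_zero[OF e]] .
    with lim2'[OF \<delta>(1)] eventually_ge_at_top[of N]
    show "\<forall>\<^sub>F k in sequentially. dist (R (\<sigma> k)) (R (\<mu>, \<phi>)) < e"
    proof eventually_elim
      case (elim k)
      have "integral_bound (fst (\<sigma> k)) M" using M(2)[of "k - N"] elim by simp
      moreover have "mdist P \<phi> (snd (\<sigma> k)) < \<delta>"
        using elim Metric_space.commute[OF Metric_space_mspace_mdist] by metis
      ultimately have "\<bar>R (fst (\<sigma> k), snd (\<sigma> k)) - R (fst (\<sigma> k), \<phi>)\<bar> \<le> M * (e / (2 * (M + 1)))"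
        using elim N by (intro \<delta>(2)) auto
      also have "\<dots> \<le> e / 2" using e M(1) by (simp add: field_simps)
      finally have "\<bar>R (\<sigma> k) - R (fst (\<sigma> k), \<phi>)\<bar> \<le> e / 2" by (metis prod.collapse)
      then show ?case using elim unfolding dist_real_def by linarith
    qed
  qed
qed

end

theorem proposition3p2:
  fixes T :: "'x::metric_space \<Rightarrow> 'x"
    and p :: "'e::metric_space \<Rightarrow> 'x"
    and ori :: "'x \<Rightarrow> (complex \<Rightarrow> 'e) set"
    and d :: "'e \<Rightarrow> 'e \<Rightarrow> real"
    and a b :: real
  assumes "compact (UNIV :: 'x set)"
    and "continuous_on UNIV T"
    and "oriented_circle_bundle p ori"
    and "unit_length_metric p ori d"
    and "a \<le> b"
  defines "P \<equiv> skew_paths p ori T a b"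
    and "D \<equiv> rotation_domain p ori d T a b"
    and "\<rho> \<equiv> rotation_number p ori d T a b"
    and "R \<equiv> (\<lambda>(\<mu>, \<phi>). mean_rotation_number p ori d T a b \<mu> \<phi>)"
  shows
    "(\<forall>\<phi>\<in>mspace P. \<forall>\<mu>\<in>invariant_signed_measures T.
        (AE x in total_variation \<mu>. x \<in> D \<phi>) \<and>
        (\<exists>K. \<forall>x\<in>D \<phi>. \<bar>\<rho> \<phi> x\<bar> \<le> K) \<and>
        (\<forall>x. (T x \<in> D \<phi> \<longleftrightarrow> x \<in> D \<phi>) \<and> (x \<in> D \<phi> \<longrightarrow> \<rho> \<phi> (T x) = \<rho> \<phi> x)) \<and>
        D \<phi> \<in> sets borel \<and> \<rho> \<phi> \<in> borel_measurable (restrict_space borel (D \<phi>)) \<and>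
        (\<forall>\<psi>\<in>mspace P. homotopic_skew_paths p ori T a b \<phi> \<psi> \<longrightarrow>
           D \<psi> = D \<phi> \<and> (\<forall>x\<in>D \<phi>. \<rho> \<psi> x = \<rho> \<phi> x))) \<and>
     \<comment> \<open>joint continuity along sequences, for the product of the weak-* and uniform topologies\<close>
     (\<forall>\<sigma> l. limitin (prod_topology (weak_star_topology T) (mtopology_of P)) \<sigma> l sequentially
        \<longrightarrow> (\<lambda>k. R (\<sigma> k)) \<longlonglongrightarrow> R l) \<and>
     \<comment> \<open>joint topological continuity on the sets of measures of bounded total variation\<close>
     (\<forall>K. continuous_map
        (prod_topology
           (subtopology (weak_star_topology T) {\<mu>. emeasure (total_variation \<mu>) UNIV \<le> ennreal K})
           (mtopology_of P))
        euclideanreal R) \<and>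
     \<comment> \<open>topological continuity in the measure, without any bound on the total variation\<close>
     (\<forall>\<phi>\<in>mspace P. continuous_map (weak_star_topology T) euclideanreal (\<lambda>\<mu>. R (\<mu>, \<phi>)))"
proof -
  interpret circle_bundle_dynamics T p ori d a b
    using assms(1-5) by (intro circle_bundle_dynamics.intro)
  show ?thesis
    unfolding P_def D_def \<rho>_def R_def
  proof (intro conjI ballI allI impI)
    fix \<phi> \<mu> assume \<phi>: "\<phi> \<in> mspace (skew_paths p ori T a b)" and \<mu>: "\<mu> \<in> invariant_signed_measures T"
    show "AE x in total_variation \<mu>. x \<in> rotation_domain p ori d T a b \<phi>"
      by (intro AE_total_variation AE_D_parts \<phi> \<mu>)
  qed (rule rotation_number_bounded rotation_number_invariant D_borel
      measurable_restrict_space1[OF rotation_number_measurable] rotation_number_homotopic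
      mean_rotation_number_continuous_sequence mean_rotation_number_continuous_bounded
      mean_rotation_number_continuous_measure; assumption)+
qed

end
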